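(* Let $Q(x,y)=Ax^{2}+Bxy+Cy^{2}$ be a binary, integral, positive definite quadratic form with $\Delta:=4AC-B^{2}$. Assume $\gcd(A,B,C)=1$ and $\sqrt{\Delta}\equiv2 \pmod 4$ (in particular $\sqrt\Delta$ is an integer). Let $(c_{j})_{j\in\mathbb{N}}$ be a sequence of non-zero real numbers with $\sum_{j}|c_{j}|<\infty$, and let $(\lambda_{j})_{j\in\mathbb{N}}$ be a bounded sequence of distinct real numbers attaining its bounds. Let $z$ belong to \[ \mathscr{D}_{Q}:=\left\{ z\in\mathbb{C}\,:\,|\mathrm{Re}(z)|<\frac{2\sqrt{\pi}}{\Delta^{3/4}},\ |\mathrm{Im}(z)|<\frac{2\sqrt{\pi}}{\Delta^{3/4}}\right\}. \] Then the function \[ F_{z,Q}(s)=\sum_{j=1}^{\infty}c_{j}\left(\frac{2\pi}{\sqrt{\Delta}}\right)^{-(s+i\lambda_{j})}\Gamma(s+i\lambda_{j})\,\zeta(s+i\lambda_{j},Q)\left\{ {}_{1}F_{1}\!\left(1-s-i\lambda_{j};1;\tfrac{z^{2}}{4}\right)+{}_{1}F_{1}\!\left(1-\overline{s}+i\lambda_{j};1;\tfrac{\overline{z}^{2}}{4}\right)\right\} \] has infinitely many zeros on the line $\mathrm{Re}(s)=\frac{1}{2}$.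
   Context: The Epstein zeta function is $\zeta(s,Q)=\sum_{(m,n)\in\mathbb{Z}^2\setminus\{(0,0)\}}Q(m,n)^{-s}$ for $\mathrm{Re}(s)>1$; it extends meromorphically to $\mathbb{C}$ (simple pole at $s=1$) and satisfies $(2\pi/\sqrt\Delta)^{-s}\Gamma(s)\zeta(s,Q)=(2\pi/\sqrt\Delta)^{-(1-s)}\Gamma(1-s)\zeta(1-s,Q)$; $\zeta(s,Q)$ denotes this continuation. A bounded real sequence "attains its bounds" if its supremum and infimum are attained. ${}_{1}F_{1}$ is Kummer's confluent hypergeometric function. *)

theory Defs
  imports "HOL-Complex_Analysis.Complex_Analysis" "HOL-Number_Theory.Cong"
begin

definition quad_form :: "int \<Rightarrow> int \<Rightarrow> int \<Rightarrow> real \<Rightarrow> real \<Rightarrow> real" where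
  "quad_form A B C x y = of_int A * x\<^sup>2 + of_int B * x * y + of_int C * y\<^sup>2"

definition pos_def_form :: "int \<Rightarrow> int \<Rightarrow> int \<Rightarrow> bool" where
  "pos_def_form A B C \<longleftrightarrow> (\<forall>x y. (x, y) \<noteq> (0, 0) \<longrightarrow> quad_form A B C x y > 0)"

definition form_disc :: "int \<Rightarrow> int \<Rightarrow> int \<Rightarrow> int" where
  "form_disc A B C = 4 * A * C - B\<^sup>2"

definition epstein_series :: "int \<Rightarrow> int \<Rightarrow> int \<Rightarrow> complex \<Rightarrow> complex" where
  "epstein_series A B C s =
     (\<Sum>\<^sub>\<infinity>(m, n) \<in> (UNIV :: (int \<times> int) set) - {(0, 0)}.
        complex_of_real (quad_form A B C (of_int m) (of_int n)) powr (- s))"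

(* The meromorphic continuation of the series to the whole plane. The predicate
   nicely_meromorphic_on requires the value 0 at poles and continuity elsewhere,
   so that by the identity theorem at most one function fits the description. *)
definition epstein_zeta :: "int \<Rightarrow> int \<Rightarrow> int \<Rightarrow> complex \<Rightarrow> complex" where
  "epstein_zeta A B C =
     (THE f. f nicely_meromorphic_on UNIV \<and>
             (\<forall>s. Re s > 1 \<longrightarrow> f s = epstein_series A B C s))"

definition hypergeo_1F1 :: "complex \<Rightarrow> complex \<Rightarrow> complex \<Rightarrow> complex" where
  "hypergeo_1F1 a b w = eval_fps (fps_hypergeo [a] [b] 1) w"

definition attains_bounds :: "(nat \<Rightarrow> real) \<Rightarrow> bool" where
  "attains_bounds l \<longleftrightarrow> Sup (range l) \<in> range l \<and> Inf (range l) \<in> range l"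

definition region_D :: "int \<Rightarrow> int \<Rightarrow> int \<Rightarrow> complex set" where
  "region_D A B C =
     {z. \<bar>Re z\<bar> < 2 * sqrt pi / of_int (form_disc A B C) powr (3 / 4) \<and>
         \<bar>Im z\<bar> < 2 * sqrt pi / of_int (form_disc A B C) powr (3 / 4)}"

definition F_term :: "int \<Rightarrow> int \<Rightarrow> int \<Rightarrow> complex \<Rightarrow> real \<Rightarrow> complex \<Rightarrow> complex" where
  "F_term A B C z l s =
     complex_of_real (2 * pi / sqrt (of_int (form_disc A B C))) powr (- (s + \<i> * of_real l))
     * Gamma (s + \<i> * of_real l) * epstein_zeta A B C (s + \<i> * of_real l)
     * (hypergeo_1F1 (1 - s - \<i> * of_real l) 1 (z\<^sup>2 / 4)
        + hypergeo_1F1 (1 - cnj s + \<i> * of_real l) 1 ((cnj z)\<^sup>2 / 4))"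

(* The sequences are indexed from 0 rather than from 1. *)
definition F_fun :: "int \<Rightarrow> int \<Rightarrow> int \<Rightarrow> (nat \<Rightarrow> real) \<Rightarrow> (nat \<Rightarrow> real) \<Rightarrow> complex \<Rightarrow> complex \<Rightarrow> complex" where
  "F_fun A B C c l z s = (\<Sum>j. of_real (c j) * F_term A B C z (l j) s)"

end

(* Put k = sqrt Delta, so that k = 2 h with h odd. On the critical line the j-th summand is the
   translate by lambda_j of the real function Phi(t) = 2 Re (L(t) 1F1(1/2 - i t; 1; z^2/4)), where L
   is the completed zeta function, so F is real there. Writing 1F1 as a contour integral of
   (1 - 1/v)^(i t - 1/2) exp(z^2 v/4) turns the integral of Phi(t) exp((pi/2 - b) t) into a contour
   integral of the theta function of Q along a curve which, as b -> 0, tends to the cusp i of that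
   function. There theta vanishes to infinite order, because its leading coefficient is the Gauss
   sum of Q mod k, and shifting by h a variable whose square has an odd coefficient flips the sign
   of that sum. Hence the transform is an explicit exponential sum up to O(exp(-c/b)), the region
   for z being what keeps the decay of theta ahead of the growth of exp(z^2 v/4).

   If F had finitely many zeros on the line, F would have constant sign near each end. Then, for
   suitable n, the n-th moments of F(t) exp(pi t/2) would grow faster than any C^n, whereas the
   exponential sum bounds them by a geometric sequence. *)
theory Submission
  imports Defs "HOL-Probability.Probability" "HOL-Real_Asymp.Real_Asymp"
begin

section \<open>Poisson summation for Gaussians\<close>

text \<open>Along the contour the argument of \<open>theta\<close> is exp(i (pi/2 - b)) / (1 - 1/v),
  which is near the cusp i only for large v. Centre and radius of the circle are therefore of order
  1/b; then exp(z^2 v/4) grows like exp(const/b), the very scale on which \<open>theta\<close>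
  decays, and the region for z is decided by comparing constants. The decay constant is 2 pi / k^3:
  splitting modulo k replaces e by k e, and Poisson summation brings in 1 / Delta = 1 / k^2. The
  explicit exponentials stem from the two terms that are subtracted from the Mellin integrand to
  make it decay; their contour integrals are 1F1 at parameters 1 and 0. Moments at b = 0 are not
  accessible directly, because F(t) exp(pi t/2) is not known to be integrable. They are replaced by
  n-th differences in b with step d, and an error exp(-c/d) divided by d^n still tends to 0. The
  exponential sum has bounded frequencies - lambda_j + i/2, the part of the line where the sign of F
  is unknown is compact, and so both contribute at most geometrically, while a window further out
  gives a larger ratio.\<close>

lemma holomorphic_difference_bound:
  fixes f :: "complex \<Rightarrow> complex"
  assumes "f holomorphic_on cball z0 r" "r > 0"
    and "\<And>z. z \<in> cball z0 r \<Longrightarrow> norm (f z) \<le> D" "z \<in> cball z0 (r / 2)"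
  shows "norm (f z - f z0) \<le> 2 * D / r * norm (z - z0)"
proof (rule field_differentiable_bound[where S = "cball z0 (r/2)" and f' = "deriv f"])
  fix y assume y: "y \<in> cball z0 (r/2)"
  have sub: "ball y (r/2) \<subseteq> ball z0 r" "cball y (r/2) \<subseteq> cball z0 r"
    using y by (auto simp: dist_norm norm_minus_commute intro!: ball_subset_ball_iff[THEN iffD2])
       (smt (verit, best) dist_norm dist_triangle2 dist_commute field_sum_of_halves dist_triangle)+
  have "y \<in> ball z0 r" using y assms(2) by (auto intro: le_less_trans)
  then show "(f has_field_derivative deriv f y) (at y within cball z0 (r/2))"
    using assms(1) by (meson ball_subset_cball holomorphic_derivI holomorphic_on_subset open_ball
          has_field_derivative_at_within)
  have "norm ((deriv ^^ 1) f y) \<le> fact 1 * D / (r/2) ^ 1"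
  proof (rule Cauchy_inequality)
    show "f holomorphic_on ball y (r/2)"
      using assms(1) holomorphic_on_subset sub(2) ball_subset_cball by blast
    show "continuous_on (cball y (r/2)) f"
      using assms(1) holomorphic_on_subset sub(2) holomorphic_on_imp_continuous_on by blast
    show "norm (f x) \<le> D" if "norm (y - x) = r/2" for x
      using assms(3) sub(2) that by (auto simp: dist_norm subset_iff)
  qed (use assms in auto)
  then show "norm (deriv f y) \<le> 2 * D / r" by (simp add: field_simps)
qed (use assms in auto)

text \<open>Dominated convergence for the difference quotients along arbitrary sequences. By
  \<open>holomorphic_difference_bound\<close>, which is Cauchy's inequality on discs of radius r/2,
  a local integrable majorant of f itself also dominates the quotients, so no majorant of the
  derivative has to be found.\<close>

lemma holomorphic_on_lebesgue_integral:
  fixes f :: "'a \<Rightarrow> complex \<Rightarrow> complex"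
  assumes "open S" and hol: "\<And>x. x \<in> space M \<Longrightarrow> f x holomorphic_on S"
    and meas: "\<And>z. z \<in> S \<Longrightarrow> (\<lambda>x. f x z) \<in> borel_measurable M"
    and dom: "\<And>z0. z0 \<in> S \<Longrightarrow> \<exists>r>0. \<exists>D. integrable M D \<and>
                (\<forall>x\<in>space M. \<forall>z\<in>S \<inter> cball z0 r. norm (f x z) \<le> D x)"
  shows "(\<lambda>z. \<integral>x. f x z \<partial>M) holomorphic_on S"
proof -
  have "(\<lambda>z. \<integral>x. f x z \<partial>M) field_differentiable at z0" if z0: "z0 \<in> S" for z0
  proof -
    obtain r0 D where r0: "r0 > 0" and D: "integrable M D"
      and bd0: "\<And>x z. x \<in> space M \<Longrightarrow> z \<in> S \<Longrightarrow> z \<in> cball z0 r0 \<Longrightarrow> norm (f x z) \<le> D x"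
      using dom[OF z0] by blast
    obtain r1 where r1: "r1 > 0" "cball z0 r1 \<subseteq> S"
      using \<open>open S\<close> z0 open_contains_cball by blast
    define r where "r = min r0 r1"
    have r: "r > 0" "cball z0 r \<subseteq> S" and bd: "\<And>x z. x \<in> space M \<Longrightarrow> z \<in> cball z0 r \<Longrightarrow> norm (f x z) \<le> D x"
      using r0 r1 bd0 by (auto simp: r_def)
    have int: "integrable M (\<lambda>x. f x z)" if "z \<in> cball z0 r" for z
      by (rule Bochner_Integration.integrable_bound[OF D])
         (use that r meas bd in \<open>auto intro!: AE_I2 order_trans[OF bd]\<close>)
    have der: "((\<lambda>y. (f x y - f x z0) / (y - z0)) \<longlongrightarrow> deriv (f x) z0) (at z0)" if "x \<in> space M" for x
      using holomorphic_derivI[OF hol[OF that] \<open>open S\<close> z0] by (simp add: has_field_derivative_iff)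
    have "((\<lambda>y. ((\<integral>x. f x y \<partial>M) - (\<integral>x. f x z0 \<partial>M)) / (y - z0)) \<longlongrightarrow> (\<integral>x. deriv (f x) z0 \<partial>M)) (at z0)"
      unfolding tendsto_at_iff_sequentially
    proof (intro allI impI)
      fix X assume X: "\<forall>i. X i \<in> UNIV - {z0}" "X \<longlonglongrightarrow> z0"
      have "eventually (\<lambda>i. X i \<in> cball z0 (r/2)) sequentially"
        using X(2) r(1) by (auto simp: tendsto_iff dist_commute elim!: allE[of _ "r/2"] eventually_mono)
      then obtain N where N: "\<And>i. i \<ge> N \<Longrightarrow> X i \<in> cball z0 (r/2)" by (auto simp: eventually_sequentially)
      \<comment> \<open>Dropping the first N terms puts the whole sequence into the half-size disc,
        where the Lipschitz bound holds.\<close>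
      have N': "X (i + N) \<in> cball z0 (r/2)" "X (i+N) \<in> cball z0 r" for i
        using N[of "i + N"] r by auto
      define s where "s = (\<lambda>i x. (f x (X (i + N)) - f x z0) / (X (i + N) - z0))"
      have s_int: "(\<integral>x. s i x \<partial>M) = ((\<integral>x. f x (X (i+N)) \<partial>M) - (\<integral>x. f x z0 \<partial>M)) / (X (i+N) - z0)" for i
        unfolding s_def using int[OF N'(2)] int[of z0] r by simp
      have Xl: "(\<lambda>i. X (i + N)) \<longlonglongrightarrow> z0" using X(2) by (rule LIMSEQ_ignore_initial_segment)
      have lim: "(\<lambda>i. s i x) \<longlonglongrightarrow> deriv (f x) z0" if "x \<in> space M" for x
        using der[OF that, unfolded tendsto_at_iff_sequentially, rule_format, of "\<lambda>i. X (i + N)"] X Xl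
        by (auto simp: s_def o_def)
      have smeas: "s i \<in> borel_measurable M" for i
        unfolding s_def using meas[OF z0] meas[OF subsetD[OF r(2) N'(2)[of i]]]
        by (intro borel_measurable_diff borel_measurable_divide borel_measurable_const)
      have "(\<lambda>i. \<integral>x. s i x \<partial>M) \<longlonglongrightarrow> (\<integral>x. deriv (f x) z0 \<partial>M)"
      proof (rule integral_dominated_convergence)
        show "(\<lambda>x. deriv (f x) z0) \<in> borel_measurable M"
          by (rule borel_measurable_LIMSEQ_metric[OF smeas lim])
        show "integrable M (\<lambda>x. 2 * D x / r)" using D by simp
        show "AE x in M. (\<lambda>i. s i x) \<longlonglongrightarrow> deriv (f x) z0" using lim by auto
        show "AE x in M. norm (s i x) \<le> 2 * D x / r" for i
        proof (rule AE_I2)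
          fix x assume x: "x \<in> space M"
          have "norm (f x (X (i+N)) - f x z0) \<le> 2 * D x / r * norm (X (i+N) - z0)"
            by (rule holomorphic_difference_bound)
               (use r hol[OF x] bd x N' in \<open>auto intro: holomorphic_on_subset\<close>)
          then show "norm (s i x) \<le> 2 * D x / r"
            using X(1) by (auto simp: s_def norm_divide divide_le_eq)
        qed
      qed (use smeas in auto)
      then have "(\<lambda>i. ((\<integral>x. f x (X (i+N)) \<partial>M) - (\<integral>x. f x z0 \<partial>M)) / (X (i+N) - z0)) \<longlonglongrightarrow> (\<integral>x. deriv (f x) z0 \<partial>M)"
        by (simp add: s_int)
      then show "((\<lambda>y. ((\<integral>x. f x y \<partial>M) - (\<integral>x. f x z0 \<partial>M)) / (y - z0)) \<circ> X) \<longlonglongrightarrow> (\<integral>x. deriv (f x) z0 \<partial>M)"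
        unfolding o_def by (rule LIMSEQ_offset)
    qed
    then show ?thesis
      by (auto simp: field_differentiable_def has_field_derivative_iff)
  qed
  then show ?thesis
    by (simp add: holomorphic_on_def field_differentiable_at_within)
qed

text \<open>Series over the lattice are treated as integrals over \<open>count_space\<close>, so
  that exchanging sum and integral is Fubini. Here the L1 norms are summed;
  \<open>fubini_count_space_swap\<close> is the version that sums pointwise first.\<close>

lemma fubini_count_space:
  fixes f :: "'i::countable \<Rightarrow> 'a \<Rightarrow> 'b::{banach, second_countable_topology}"
  assumes "sigma_finite_measure M" and int: "\<And>i. integrable M (f i)"
    and sum: "integrable (count_space UNIV) (\<lambda>i. \<integral>x. norm (f i x) \<partial>M)"
  shows "integrable M (\<lambda>x. \<integral>i. f i x \<partial>count_space UNIV)"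
    and "(\<integral>x. (\<integral>i. f i x \<partial>count_space UNIV) \<partial>M) = (\<integral>i. (\<integral>x. f i x \<partial>M) \<partial>count_space UNIV)"
    and "AE x in M. integrable (count_space UNIV) (\<lambda>i. f i x)"
proof -
  interpret M: sigma_finite_measure M by fact
  interpret C: sigma_finite_measure "count_space (UNIV :: 'i set)"
    by (rule sigma_finite_measure_count_space)
  interpret P: pair_sigma_finite "count_space (UNIV :: 'i set)" M ..
  have I: "integrable (count_space UNIV \<Otimes>\<^sub>M M) (case_prod f)"
  proof (rule P.Fubini_integrable)
    show "case_prod f \<in> borel_measurable (count_space UNIV \<Otimes>\<^sub>M M)"
      by (rule measurable_pair_measure_countable1) (use int in auto)
  qed (use int sum in auto)
  show "integrable M (\<lambda>x. \<integral>i. f i x \<partial>count_space UNIV)"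
    by (rule P.integrable_snd[OF I])
  show "(\<integral>x. (\<integral>i. f i x \<partial>count_space UNIV) \<partial>M) = (\<integral>i. (\<integral>x. f i x \<partial>M) \<partial>count_space UNIV)"
    by (rule P.Fubini_integral[OF I])
  show "AE x in M. integrable (count_space UNIV) (\<lambda>i. f i x)"
    by (rule P.AE_integrable_snd[OF I])
qed

text \<open>Unfolding modulo Z: the line is cut into the intervals [n, n + 1), each piece is
  translated to [0, 1), and sum and integral are exchanged both before and after the
  translation.\<close>

lemma integral_fold_int:
  fixes g :: "real \<Rightarrow> complex"
  assumes g: "integrable lborel g"
  shows "(\<integral>u. g u \<partial>lborel) = (LINT v:{0..1}|lborel. (\<integral>n. g (of_int n + v) \<partial>count_space UNIV))"
proof -
  define G where "G = (\<lambda>(n::int) u. indicator {of_int n..<of_int n + 1::real} u *\<^sub>R g u)"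
  define G' where "G' = (\<lambda>(n::int) v. indicator {0..<1::real} v *\<^sub>R g (of_int n + v))"
  have sf: "sigma_finite_measure (lborel :: real measure)" by (rule sigma_finite_lborel)
  have Gi: "integrable lborel (G n)" for n
    unfolding G_def by (intro integrable_mult_indicator g) auto
  have G'G: "G' n v = G n (of_int n + 1 * v)" for n v
    by (auto simp: G_def G'_def split: split_indicator)
  have G'i: "integrable lborel (G' n)" for n
    unfolding G'G[abs_def] by (rule lborel_integrable_real_affine[OF Gi]) simp
  have eq: "(\<integral>v. h (G' n v) \<partial>lborel) = (\<integral>u. h (G n u) \<partial>lborel)" for n and h :: "complex \<Rightarrow> 'b::{banach,second_countable_topology}"
    using lborel_integral_real_affine[of 1 "\<lambda>u. h (G n u)" "of_int n"] by (simp add: G'G)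
  have ind: "(\<lambda>n::int. indicator {of_int n..<of_int n + 1::real} u :: real) = (\<lambda>n. indicator {\<lfloor>u\<rfloor>} n)" for u
    by (auto simp: fun_eq_iff indicator_def floor_unique) 
  have pt: "(\<integral>n. G n u \<partial>count_space UNIV) = g u" for u
  proof -
    have "G n u = (if n = \<lfloor>u\<rfloor> then g u else 0)" for n
      using fun_cong[OF ind[of u], of n] by (simp add: G_def indicator_def)
    then have "(\<integral>n. G n u \<partial>count_space UNIV) = infsetsum (\<lambda>n. if n = \<lfloor>u\<rfloor> then g u else 0) UNIV"
      by (simp add: infsetsum_def)
    also have "\<dots> = infsetsum (\<lambda>n. g u) {\<lfloor>u\<rfloor>}"
      by (rule infsetsum_cong_neutral) auto
    finally show ?thesis by simp
  qed
  have sum: "integrable (count_space UNIV) (\<lambda>n. \<integral>u. norm (G n u) \<partial>lborel)"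
  proof -
    have "(\<integral>\<^sup>+n. ennreal (norm (\<integral>u. norm (G n u) \<partial>lborel)) \<partial>count_space UNIV)
       = (\<integral>\<^sup>+n. (\<integral>\<^sup>+u. norm (G n u) \<partial>lborel) \<partial>count_space UNIV)"
      by (intro nn_integral_cong) (simp add: nn_integral_eq_integral Gi integrable_norm)
    also have "\<dots> = (\<integral>\<^sup>+u. (\<integral>\<^sup>+n. norm (G n u) \<partial>count_space UNIV) \<partial>lborel)"
    proof -
      interpret C: sigma_finite_measure "count_space (UNIV :: int set)"
        by (rule sigma_finite_measure_count_space)
      interpret P: pair_sigma_finite "count_space (UNIV :: int set)" "lborel :: real measure" ..
      show ?thesis
        by (rule P.Fubini'[symmetric], rule measurable_pair_measure_countable1) (use Gi in auto)
    qed
    also have "\<dots> = (\<integral>\<^sup>+u. norm (g u) \<partial>lborel)"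
    proof (intro nn_integral_cong)
      fix u
      have "(\<integral>\<^sup>+n. norm (G n u) \<partial>count_space UNIV) = (\<integral>\<^sup>+n. ennreal (norm (g u)) * indicator {\<lfloor>u\<rfloor>} n \<partial>count_space UNIV)"
        by (intro nn_integral_cong) (use fun_cong[OF ind[of u]] in \<open>auto simp: G_def indicator_def\<close>)
      also have "\<dots> = norm (g u)" by (subst nn_integral_cmult_indicator) auto
      finally show "(\<integral>\<^sup>+n. norm (G n u) \<partial>count_space UNIV) = norm (g u)" .
    qed
    also have "\<dots> < \<infinity>" using g by (simp add: integrable_iff_bounded)
    finally show ?thesis by (simp add: integrable_iff_bounded)
  qed
  have "(\<integral>u. g u \<partial>lborel) = (\<integral>u. (\<integral>n. G n u \<partial>count_space UNIV) \<partial>lborel)" by (simp add: pt)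
  also have "\<dots> = (\<integral>n. (\<integral>u. G n u \<partial>lborel) \<partial>count_space UNIV)"
    by (rule fubini_count_space(2)[OF sf Gi sum])
  also have "\<dots> = (\<integral>n. (\<integral>u. G' n u \<partial>lborel) \<partial>count_space UNIV)"
    using eq[of id] by simp
  also have "\<dots> = (\<integral>v. (\<integral>n. G' n v \<partial>count_space UNIV) \<partial>lborel)"
    by (rule fubini_count_space(2)[OF sf G'i, symmetric]) (use sum eq[of norm] in simp)
  also have "\<dots> = (LINT v:{0..<1}|lborel. (\<integral>n. g (of_int n + v) \<partial>count_space UNIV))"
    by (simp add: G'_def set_lebesgue_integral_def)
  also have "\<dots> = (LINT v:{0..1}|lborel. (\<integral>n. g (of_int n + v) \<partial>count_space UNIV))"
    by (rule set_integral_discrete_difference[where X = "{1}"]) auto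
  finally show ?thesis .
qed

text \<open>One integration by parts: 2 pi i q times the coefficient is the coefficient of h' plus
  boundary terms. Periodicity of h is not assumed, so h(1) and h(0) stay in the constant, but they
  do not depend on q.\<close>

lemma fourier_coefficient_bound:
  fixes h :: "complex \<Rightarrow> complex"
  assumes "h holomorphic_on S" "open S" "of_real ` {0..1} \<subseteq> S"
  shows "\<exists>C. \<forall>q::int. norm (of_int q * (LINT v:{0..1}|lborel. h (of_real v) * exp (-2*pi*\<i> * of_int q * of_real v))) \<le> C"
proof -
  define C where "C = (LINT v:{0..1}|lborel. norm (deriv h (of_real v))) + norm (h 1) + norm (h 0)"
  have cont: "continuous_on {0..1::real} (\<lambda>v. h (of_real v))" "continuous_on {0..1::real} (\<lambda>v. deriv h (of_real v))"
    by (rule continuous_on_compose2[OF holomorphic_on_imp_continuous_on[OF assms(1)]],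
        use assms(3) in \<open>auto intro!: continuous_intros\<close>)
       (rule continuous_on_compose2[OF holomorphic_on_imp_continuous_on[OF holomorphic_deriv[OF assms(1,2)]]],
        use assms(3) in \<open>auto intro!: continuous_intros\<close>)
  have "norm (of_int q * (LINT v:{0..1}|lborel. h (of_real v) * exp (-2*pi*\<i> * of_int q * of_real v))) \<le> C" for q :: int
  proof -
    define E where "E = (\<lambda>v::real. exp (-2*pi*\<i> * of_int q * of_real v))"
    have contE: "continuous_on {0..1} E" unfolding E_def by (intro continuous_intros)
    have nE: "norm (E v) = 1" for v by (simp add: E_def)
    have E01: "E 0 = 1" "E 1 = 1"
      using exp_integer_2pi[of "of_int (-q)"] by (auto simp: E_def mult_ac)
    have i1: "set_integrable lborel {0..1} (\<lambda>v. deriv h (of_real v) * E v)"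
      and i2: "set_integrable lborel {0..1} (\<lambda>v. h (of_real v) * E v)"
      by (rule borel_integrable_atLeastAtMost'; intro continuous_intros cont contE)+
    have "(\<integral>v. indicator {0..1} v *\<^sub>R (deriv h (of_real v) * E v - 2*pi*\<i> * of_int q * (h (of_real v) * E v)) \<partial>lborel)
         = h (of_real 1) * E 1 - h (of_real 0) * E 0"
    proof (rule integral_FTC_atLeastAtMost)
      fix v :: real assume v: "0 \<le> v" "v \<le> 1"
      have "(h has_field_derivative deriv h (of_real v)) (at (of_real v))"
        by (rule holomorphic_derivI[OF assms(1,2)]) (use assms(3) v in \<open>auto simp: image_subset_iff\<close>)
      then have 1: "((\<lambda>v. h (of_real v)) has_vector_derivative deriv h (of_real v)) (at v within {0..1})"
        by (rule has_vector_derivative_real_field)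
      have 2: "(E has_vector_derivative (-2*pi*\<i> * of_int q) * E v) (at v within {0..1})"
        unfolding E_def by (rule has_vector_derivative_real_field) (auto intro!: derivative_eq_intros)
      show "((\<lambda>v. h (of_real v) * E v) has_vector_derivative
          deriv h (of_real v) * E v - 2*pi*\<i> * of_int q * (h (of_real v) * E v)) (at v within {0..1})"
        using has_vector_derivative_mult[OF 1 2] by (simp add: algebra_simps)
    qed (auto intro!: continuous_intros cont contE)
    also have "(\<integral>v. indicator {0..1} v *\<^sub>R (deriv h (of_real v) * E v - 2*pi*\<i> * of_int q * (h (of_real v) * E v)) \<partial>lborel)
       = (LINT v:{0..1}|lborel. deriv h (of_real v) * E v) - 2*pi*\<i> * of_int q * (LINT v:{0..1}|lborel. h (of_real v) * E v)"
      unfolding set_integral_mult_right[symmetric]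
      by (subst set_integral_diff(2)[symmetric]) (use i1 i2 in \<open>auto simp: set_lebesgue_integral_def\<close>)
    finally have eq: "2*pi*\<i>*(of_int q * (LINT v:{0..1}|lborel. h (of_real v) * E v))
        = (LINT v:{0..1}|lborel. deriv h (of_real v) * E v) - h 1 + h 0"
      by (simp add: E01 algebra_simps)
    have nb: "norm (LINT v:{0..1}|lborel. deriv h (of_real v) * E v) \<le> (LINT v:{0..1}|lborel. norm (deriv h (of_real v)))"
      using integral_norm_bound[of lborel "\<lambda>v. indicator {0..1} v *\<^sub>R (deriv h (of_real v) * E v)"]
      by (simp add: set_lebesgue_integral_def norm_mult nE)
    have "norm (of_int q * (LINT v:{0..1}|lborel. h (of_real v) * E v)) * 1
        \<le> norm (of_int q * (LINT v:{0..1}|lborel. h (of_real v) * E v)) * (2 * pi)"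
      by (rule mult_left_mono) (use pi_ge_two in auto)
    also have "\<dots> = norm (2*pi*\<i>*(of_int q * (LINT v:{0..1}|lborel. h (of_real v) * E v)))"
      by (simp add: norm_mult)
    also have "\<dots> \<le> C"
      unfolding eq C_def using nb norm_triangle_ineq4[of "(LINT v:{0..1}|lborel. deriv h (of_real v) * E v)" "h 1"]
        norm_triangle_ineq[of "(LINT v:{0..1}|lborel. deriv h (of_real v) * E v) - h 1" "h 0"] by linarith
    finally show ?thesis by (simp add: E_def)
  qed
  then show ?thesis by blast
qed

text \<open>Dividing f - f(0) by exp(2 pi i z) - 1 leaves a function h holomorphic near [0, 1].
  Multiplication by exp(2 pi i z) shifts Fourier indices, so the coefficients of f - f(0) are
  differences of consecutive coefficients of h and the symmetric sums telescope;
  \<open>fourier_coefficient_bound\<close> makes the two end terms vanish in the limit.\<close>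

lemma fourier_partial_sums:
  fixes f :: "complex \<Rightarrow> complex"
  assumes f: "f holomorphic_on UNIV" and per: "\<And>z. f (z + 1) = f z"
  shows "(\<lambda>N. \<Sum>q=-int N..int N. LINT v:{0..1}|lborel. f (of_real v) * exp (-2 * pi * \<i>* of_int q * of_real v))
           \<longlonglongrightarrow> f 0"
proof -
  define G where "G = (\<lambda>z::complex. exp (2 * pi * \<i> * z) - 1)"
  define F where "F = (\<lambda>z. f z - f 0)"
  \<comment> \<open>The strip contains [0, 1] but no integer other than 0 and 1, the only zeros that
    have to be removed from the quotient.\<close>
  define S where "S = {z::complex. - (1/2) < Re z \<and> Re z < 3/2}"
  define h where "h = (\<lambda>z. if z = 0 \<or> z = 1 then deriv f z / (2 * pi * \<i>) else F z / G z)"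
  have S: "open S" unfolding S_def
    by (intro open_Collect_conj open_halfspace_Re_gt open_halfspace_Re_lt)
  have G0: "z = 0 \<or> z = 1" if "z \<in> S" "G z = 0" for z
  proof -
    have "exp (2 * pi * \<i> * z) = 1" using that(2) by (simp add: G_def)
    then obtain n where "Re (2 * pi * \<i> * z) = 0" "Im (2 * pi * \<i> * z) = of_int (2 * n) * pi"
      using exp_eq_1 by blast
    then have z: "z = of_int n" by (auto simp: complex_eq_iff)
    with that(1) have "n = 0 \<or> n = 1" by (auto simp: S_def) 
    with z show ?thesis by auto
  qed
  have f1: "f 1 = f 0" using per[of 0] by simp
  have Gd: "(G has_field_derivative 2 * pi * \<i>) (at a)" if "a = 0 \<or> a = 1" for a
    unfolding G_def using that by (auto intro!: derivative_eq_intros) 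
  have Fd: "(F has_field_derivative deriv f a) (at a)" for a
    unfolding F_def using holomorphic_derivI[OF f open_UNIV, of a] by (auto intro!: derivative_eq_intros)
  have Ga: "G a = 0" "F a = 0" if "a = 0 \<or> a = 1" for a
    using that f1 by (auto simp: G_def F_def)
  have h: "h holomorphic_on S"
  proof (rule no_isolated_singularity'[where K = "{0,1}"])
    show "(h \<longlongrightarrow> h a) (at a within S)" if "a \<in> {0,1}" for a
    proof -
      have "((\<lambda>w. F w / G w) \<longlongrightarrow> deriv f a / (2 * pi * \<i>)) (at a)"
        using that Ga[of a] by (intro lhopital_complex_simple[OF Fd Gd]) auto
      moreover have "eventually (\<lambda>w. F w / G w = h w) (at a)"
      proof -
        have "eventually (\<lambda>w. w \<in> - ({0,1} - {a})) (at a)"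
          by (intro eventually_at_in_open' open_Compl finite_imp_closed) auto
        moreover have "eventually (\<lambda>w. w \<noteq> a) (at a)" by (simp add: eventually_at_filter)
        ultimately show ?thesis by eventually_elim (auto simp: h_def)
      qed
      ultimately have "(h \<longlongrightarrow> deriv f a / (2 * pi * \<i>)) (at a)" by (rule Lim_transform_eventually)
      then show ?thesis using that by (auto simp: h_def intro: tendsto_within_subset)
    qed
    have "(\<lambda>z. F z / G z) holomorphic_on S - {0,1}"
      unfolding F_def
      by (intro holomorphic_intros holomorphic_on_subset[OF f]) (use G0 in \<open>auto simp: G_def intro!: holomorphic_intros\<close>)
    then show "h holomorphic_on S - {0,1}"
      by (rule holomorphic_transform) (auto simp: h_def)
  qed (use S in auto)
  have fh: "f z = f 0 + (exp (2 * pi * \<i> * z) - 1) * h z" if "z \<in> S" for z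
  proof (cases "z = 0 \<or> z = 1")
    case True
    with f1 Ga(1)[of z] show ?thesis by (auto simp: G_def)
  next
    case False
    with G0[OF that] have "G z \<noteq> 0" "h z = F z / G z" by (auto simp: h_def)
    moreover have "exp (2 * pi * \<i> * z) - 1 = G z" by (simp add: G_def)
    ultimately show ?thesis by (simp add: F_def)
  qed
  have S01: "of_real v \<in> S" if "v \<in> {0..1}" for v :: real using that by (auto simp: S_def)
  define hh where "hh = (\<lambda>q::int. LINT v:{0..1}|lborel. h (of_real v) * exp (-2 * pi * \<i>* of_int q * of_real v))"
  have conth: "continuous_on {0..1::real} (\<lambda>v. h (of_real v))"
    by (rule continuous_on_compose2[OF holomorphic_on_imp_continuous_on[OF h]])
       (use S01 in \<open>auto intro!: continuous_intros\<close>)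
  have inth: "set_integrable lborel {0..1} (\<lambda>v. h (of_real v) * exp (-2 * pi * \<i>* of_int q * of_real v))" for q :: int
    by (rule borel_integrable_atLeastAtMost') (intro continuous_intros conth)
  have e0: "(LINT v:{0..1}|lborel. exp (-2 * pi * \<i>* of_int q * of_real v)) = (if q = 0 then 1 else 0)" for q :: int
  proof (cases "q = 0")
    case True
    then show ?thesis by (simp add: set_lebesgue_integral_def)
  next
    case False
    have "(\<integral>v. indicator {0..1} v *\<^sub>R exp (-2 * pi * \<i>* of_int q * of_real v) \<partial>lborel)
       = exp (-2 * pi * \<i>* of_int q * of_real 1) / (-2 * pi * \<i>* of_int q) - exp (-2 * pi * \<i>* of_int q * of_real 0) / (-2 * pi * \<i>* of_int q)"
    proof (rule integral_FTC_atLeastAtMost)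
      show "((\<lambda>v. exp (-2 * pi * \<i>* of_int q * of_real v) / (-2 * pi * \<i>* of_int q)) has_vector_derivative
            exp (-2 * pi * \<i>* of_int q * of_real v)) (at v within {0..1})" for v
        using False by (intro has_vector_derivative_real_field) (auto intro!: derivative_eq_intros)
    qed (auto intro!: continuous_intros)
    also have "exp (-2 * pi * \<i>* of_int q * of_real 1) = 1"
      using exp_integer_2pi[of "of_int (-q)"] by (auto simp: mult_ac)
    finally show ?thesis using False by (simp add: set_lebesgue_integral_def)
  qed
  \<comment> \<open>The factor exp(2 pi i v) in the decomposition \<open>fh\<close> lowers the index
    q by one.\<close>
  have coef: "(LINT v:{0..1}|lborel. f (of_real v) * exp (-2 * pi * \<i>* of_int q * of_real v))
       = (if q = 0 then f 0 else 0) + (hh (q - 1) - hh q)" for q :: int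
  proof -
    have ie: "set_integrable lborel {0..1} (\<lambda>v. exp (-2 * pi * \<i>* of_int q * of_real v))"
      by (rule borel_integrable_atLeastAtMost') (intro continuous_intros)
    have "(LINT v:{0..1}|lborel. f (of_real v) * exp (-2 * pi * \<i>* of_int q * of_real v))
      = (LINT v:{0..1}|lborel. f 0 * exp (-2 * pi * \<i>* of_int q * of_real v) +
           (h (of_real v) * exp (-2 * pi * \<i>* of_int (q-1) * of_real v) - h (of_real v) * exp (-2 * pi * \<i>* of_int q * of_real v)))"
      by (intro set_lebesgue_integral_cong)
         (auto simp: fh[OF S01] algebra_simps exp_add[symmetric] exp_diff)
    also have "\<dots> = f 0 * (LINT v:{0..1}|lborel. exp (-2 * pi * \<i>* of_int q * of_real v)) + (hh (q - 1) - hh q)"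
      using inth[of q] inth[of "q-1"] ie
      by (subst set_integral_add(2)) (auto simp: hh_def set_integral_diff)
    finally show ?thesis unfolding e0 by simp
  qed
  define cc where "cc = (\<lambda>q::int. LINT v:{0..1}|lborel. f (of_real v) * exp (-2 * pi * \<i> * of_int q * of_real v))"
  have cc: "cc q = (if q = 0 then f 0 else 0) + (hh (q - 1) - hh q)" for q
    unfolding cc_def by (rule coef)
  have tele: "(\<Sum>q=-int N..int N. cc q) = f 0 + hh (- int (Suc N)) - hh (int N)" for N
  proof (induction N)
    case 0 show ?case by (simp add: cc)
  next
    case (Suc N)
    have "{-int (Suc N)..int (Suc N)} = insert (- int (Suc N)) (insert (int (Suc N)) {-int N..int N})" by auto
    then have "(\<Sum>q=-int (Suc N)..int (Suc N). cc q) = cc (- int (Suc N)) + (cc (int (Suc N)) + (\<Sum>q=-int N..int N. cc q))"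
      by simp
    also have "\<dots> = f 0 + hh (- int (Suc N) - 1) - hh (int (Suc N))"
      unfolding Suc by (simp add: cc)
    finally show ?case by (simp add: algebra_simps)
  qed
  obtain C where C: "\<And>q::int. norm (of_int q * hh q) \<le> C"
    unfolding hh_def using fourier_coefficient_bound[OF h S] S01 by (auto simp: image_subset_iff)
  have hb: "norm (hh q) \<le> C / \<bar>of_int q\<bar>" if "q \<noteq> 0" for q
    using C[of q] that by (simp add: norm_mult field_simps)
  have l1: "(\<lambda>N. hh (- int (Suc N))) \<longlonglongrightarrow> 0"
  proof (rule Lim_null_comparison)
    show "eventually (\<lambda>N. norm (hh (- int (Suc N))) \<le> C / real (Suc N)) sequentially"
      using hb[of "- int (Suc _)"] by (auto simp del: of_nat_Suc)
    show "(\<lambda>N. C / real (Suc N)) \<longlonglongrightarrow> 0" by (rule LIMSEQ_Suc[OF lim_const_over_n])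
  qed
  have l2: "(\<lambda>N. hh (int N)) \<longlonglongrightarrow> 0"
  proof (rule Lim_null_comparison)
    show "eventually (\<lambda>N. norm (hh (int N)) \<le> C / real N) sequentially"
      using eventually_gt_at_top[of 0] by eventually_elim (use hb[of "int _"] in auto)
    show "(\<lambda>N. C / real N) \<longlonglongrightarrow> 0" by (rule lim_const_over_n)
  qed
  show ?thesis unfolding cc_def[symmetric] tele using tendsto_diff[OF tendsto_add[OF tendsto_const l1] l2, of "f 0"] by simp
qed

text \<open>The substitution x = r u with r = sqrt (2 pi s) turns the integrand into the standard
  normal density times a character, so the value is read off from the characteristic function of the
  normal distribution.\<close>

lemma gauss_fourier:
  fixes s w :: real
  assumes s: "s > 0"
  shows "integrable lborel (\<lambda>u. exp (- of_real (pi * s * u\<^sup>2) + 2 * pi * \<i>* of_real w * of_real u))"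
    and "(\<integral>u. exp (- of_real (pi * s * u\<^sup>2) + 2 * pi * \<i>* of_real w * of_real u) \<partial>lborel)
           = of_real (1 / sqrt s * exp (- (pi * w\<^sup>2/s)))"
proof -
  define r where "r = sqrt (2 * pi * s)"
  have r: "r > 0" "r\<^sup>2 = 2 * pi * s" using s by (auto simp: r_def)
  define \<phi> where "\<phi> = (\<lambda>x. std_normal_density x *\<^sub>R exp (\<i> * of_real (2 * pi * w/r * x)))"
  have ge: "exp (- of_real (pi * s * u\<^sup>2) + 2 * pi * \<i>* of_real w * of_real u) = sqrt (2 * pi) *\<^sub>R \<phi> (0 + r * u)" for u
  proof -
    have "std_normal_density (r * u) = 1 / sqrt (2 * pi) * exp (- (pi * s * u\<^sup>2))"
      using r by (simp add: std_normal_density_def power_mult_distrib)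
    moreover have "\<i> * of_real (2 * pi * w/r * (r * u)) = 2 * pi * \<i>* of_real w * of_real u" using r by simp
    moreover have "exp (- of_real (pi * s * u\<^sup>2) + 2 * pi * \<i> * of_real w * of_real u)
        = of_real (exp (- (pi * s * u\<^sup>2))) * exp (2 * pi * \<i> * of_real w * of_real u)"
      by (simp only: exp_add exp_of_real[symmetric] of_real_minus)
    ultimately show ?thesis unfolding \<phi>_def add_0 by (simp add: scaleR_conv_of_real mult_ac)
  qed
  have im: "integrable lborel \<phi>"
    unfolding \<phi>_def
    by (rule Bochner_Integration.integrable_bound[OF integrable_std_normal_moment[of 0]]) auto
  show "integrable lborel (\<lambda>u. exp (- of_real (pi * s * u\<^sup>2) + 2 * pi * \<i>* of_real w * of_real u))"
    unfolding ge using lborel_integrable_real_affine[OF im, of r 0] r by simp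
  have "(\<integral>x. \<phi> x \<partial>lborel) = char std_normal_distribution (2 * pi * w/r)"
    unfolding char_def \<phi>_def by (subst integral_density) (auto simp: normal_density_nonneg)
  also have "\<dots> = of_real (exp (- (pi * w\<^sup>2/s)))"
    unfolding char_std_normal_distribution using r(2) s by (simp add: power_divide power_mult_distrib power2_eq_square)
  finally have 1: "(\<integral>x. \<phi> x \<partial>lborel) = of_real (exp (- (pi * w\<^sup>2/s)))" .
  have 2: "(\<integral>u. \<phi> (0 + r * u) \<partial>lborel) = of_real (exp (- (pi * w\<^sup>2/s)) / r)"
    using lborel_integral_real_affine[of r \<phi> 0] r by (simp add: 1 scaleR_conv_of_real field_simps)
  have 3: "sqrt (2 * pi) / r = 1 / sqrt s" by (simp add: r_def real_sqrt_mult)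
  have "(\<integral>u. exp (- of_real (pi * s * u\<^sup>2) + 2 * pi * \<i> * of_real w * of_real u) \<partial>lborel)
      = of_real (sqrt (2 * pi) * (exp (- (pi * w\<^sup>2 / s)) / r))"
    unfolding ge integral_scaleR_right 2 unfolding scaleR_conv_of_real of_real_mult[of "sqrt (2 * pi)"] ..
  also have "sqrt (2 * pi) * (exp (- (pi * w\<^sup>2 / s)) / r) = 1 / sqrt s * exp (- (pi * w\<^sup>2 / s))"
    unfolding 3[symmetric] by simp
  finally show "(\<integral>u. exp (- of_real (pi * s * u\<^sup>2) + 2 * pi * \<i> * of_real w * of_real u) \<partial>lborel)
           = of_real (1 / sqrt s * exp (- (pi * w\<^sup>2 / s)))" .
qed

lemma integrable_int_exp_square:
  fixes s :: real
  assumes "s > 0"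
  shows "integrable (count_space UNIV) (\<lambda>n::int. exp (- (s * (of_int n)\<^sup>2)))"
proof -
  have g: "summable (\<lambda>n::nat. exp (-s) ^ n)" using assms by (intro summable_geometric) auto
  have b: "exp (- (s * (real n)\<^sup>2)) \<le> exp (-s) ^ n" for n
  proof -
    have "real n \<le> (real n)\<^sup>2" by (cases n) (auto simp: power2_eq_square)
    then have "s * real n \<le> s * (real n)\<^sup>2" using assms by simp
    then show ?thesis by (simp add: exp_of_nat_mult[symmetric] mult.commute)
  qed
  have sn: "Infinite_Set_Sum.abs_summable_on (\<lambda>n::nat. exp (- (s * (real n)\<^sup>2))) UNIV"
    unfolding abs_summable_on_nat_iff' by (rule summable_comparison_test'[OF g, of 0]) (use b in auto)
  have "Infinite_Set_Sum.abs_summable_on (\<lambda>n::int. exp (- (s * (of_int n)\<^sup>2))) (range int)"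
       "Infinite_Set_Sum.abs_summable_on (\<lambda>n::int. exp (- (s * (of_int n)\<^sup>2))) (range (\<lambda>n. - int n))"
    by (intro abs_summable_on_reindex_iff[THEN iffD1]; use sn in \<open>auto simp: inj_on_def\<close>)+
  then have "Infinite_Set_Sum.abs_summable_on (\<lambda>n::int. exp (- (s * (of_int n)\<^sup>2))) (range int \<union> range (\<lambda>n. - int n))"
    by (rule abs_summable_on_union)
  also have "range int \<union> range (\<lambda>n. - int n) = UNIV"
    by (auto simp: image_iff) (metis int_cases2)
  finally show ?thesis by (simp add: Infinite_Set_Sum.abs_summable_on_def)
qed

text \<open>Dominated convergence identifies the unordered sum with the limit of symmetric partial
  sums, the form in which the Fourier expansion at 0 is available.\<close>

lemma int_symmetric_partial_sums:
  fixes a :: "int \<Rightarrow> complex"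
  assumes a: "integrable (count_space UNIV) a"
  shows "(\<lambda>N. \<Sum>q=-int N..int N. a q) \<longlonglongrightarrow> (\<integral>q. a q \<partial>count_space UNIV)"
proof -
  have "(\<lambda>N. \<integral>q. indicator {-int N..int N} q *\<^sub>R a q \<partial>count_space UNIV) \<longlonglongrightarrow> (\<integral>q. a q \<partial>count_space UNIV)"
  proof (rule integral_dominated_convergence)
    show "integrable (count_space UNIV) (\<lambda>q. norm (a q))" using a by simp
    show "AE q in count_space UNIV. (\<lambda>N. indicator {-int N..int N} q *\<^sub>R a q) \<longlonglongrightarrow> a q"
    proof (rule AE_I2)
      fix q :: int
      have "eventually (\<lambda>N. indicator {-int N..int N} q *\<^sub>R a q = a q) sequentially"
        using eventually_ge_at_top[of "nat \<bar>q\<bar>"] by eventually_elim (auto simp: indicator_def)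
      then show "(\<lambda>N. indicator {-int N..int N} q *\<^sub>R a q) \<longlonglongrightarrow> a q"
        by (rule tendsto_eventually)
    qed
  qed (auto simp: indicator_def)
  moreover have "(\<integral>q. indicator {-int N..int N} q *\<^sub>R a q \<partial>count_space UNIV) = (\<Sum>q=-int N..int N. a q)" for N
  proof -
    have "(\<integral>q. indicator {-int N..int N} q *\<^sub>R a q \<partial>count_space UNIV) = infsetsum (\<lambda>q. indicator {-int N..int N} q *\<^sub>R a q) UNIV"
      by (simp add: infsetsum_def)
    also have "\<dots> = infsetsum a {-int N..int N}"
      by (rule infsetsum_cong_neutral) auto
    finally show ?thesis by simp
  qed
  ultimately show ?thesis by simp
qed

text \<open>The periodised Gaussian f is entire with period 1, and its Fourier expansion at 0 is the
  dual sum; the coefficients are Gaussian integrals after unfolding. Both a shift a and a frequency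
  c are kept because summing a binary form one variable at a time makes the cross term a shift in
  the first sum and a frequency in the second.\<close>

lemma gauss_poisson:
  fixes s c a :: real
  assumes s: "s > 0"
  shows "(\<integral>n. exp (- of_real (pi * s * (of_int n + a)\<^sup>2) + 2 * pi * \<i>* of_real c * of_real (of_int n + a)) \<partial>count_space (UNIV::int set))
       = of_real (1 / sqrt s) * (\<integral>q. exp (- of_real (pi * (of_int q - c)\<^sup>2/s) + 2 * pi * \<i>* of_int q * of_real a) \<partial>count_space (UNIV::int set))"
proof -
  define \<phi> where "\<phi> = (\<lambda>u::complex. exp (- of_real (pi * s) * u\<^sup>2 + 2 * pi * \<i>* of_real c * u))"
  define f where "f = (\<lambda>z. \<integral>n. \<phi> (of_int n + of_real a + z) \<partial>count_space (UNIV::int set))"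
  have bd: "norm (\<phi> (of_int n + w)) \<le> exp (- (pi * s/2 * (of_int n)\<^sup>2)) * exp (pi * s * R\<^sup>2 + 2 * pi * \<bar>c\<bar> * R)"
    if "norm w \<le> R" for n :: int and w R
  proof -
    define x y where "x = Re w" and "y = Im w"
    have xy: "x\<^sup>2 + y\<^sup>2 \<le> R\<^sup>2" "\<bar>y\<bar> \<le> R" 
      using that power_mono[OF that, of 2] abs_Im_le_cmod[of w] by (auto simp: cmod_power2 x_def y_def)
    have "norm (\<phi> (of_int n + w)) = exp (- (pi * s) * ((of_int n + x)\<^sup>2 - y\<^sup>2) - 2 * pi * c * y)"
      by (simp add: \<phi>_def x_def y_def Re_power2)
    also have "\<dots> \<le> exp (- (pi * s/2 * (of_int n)\<^sup>2) + (pi * s * R\<^sup>2 + 2 * pi * \<bar>c\<bar> * R))"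
    proof -
      \<comment> \<open>The difference of the two sides is (n + 2 x)^2 / 2 + R^2 - x^2 -
        y^2.\<close>
      have "(of_int n + x)\<^sup>2 - y\<^sup>2 \<ge> (of_int n)\<^sup>2 / 2 - R\<^sup>2"
        using xy(1) zero_le_power2[of "of_int n + 2 * x"] by (simp add: power2_eq_square algebra_simps)
      then have "(pi * s) * ((of_int n)\<^sup>2 / 2 - R\<^sup>2) \<le> (pi * s) * ((of_int n + x)\<^sup>2 - y\<^sup>2)"
        using s by (intro mult_left_mono) auto
      moreover have "- (c * y) \<le> \<bar>c\<bar> * R"
      proof -
        have "- (c * y) \<le> \<bar>c\<bar> * \<bar>y\<bar>" by (metis abs_ge_minus_self abs_mult)
        also have "\<dots> \<le> \<bar>c\<bar> * R" using xy by (intro mult_left_mono) auto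
        finally show ?thesis .
      qed
      then have "2 * pi * (- (c * y)) \<le> 2 * pi * (\<bar>c\<bar> * R)" by (intro mult_left_mono) auto
      ultimately show ?thesis by (simp add: algebra_simps)
    qed
    finally show ?thesis by (simp only: exp_add)
  qed
  have int_bd: "integrable (count_space UNIV) (\<lambda>n::int. exp (- (pi * s/2 * (of_int n)\<^sup>2)) * K)" for K
    using integrable_int_exp_square[of "pi * s/2"] s by auto
  have f_hol: "f holomorphic_on UNIV"
    unfolding f_def
  proof (rule holomorphic_on_lebesgue_integral)
    show "\<exists>r>0. \<exists>D. integrable (count_space UNIV) D \<and> (\<forall>n\<in>space (count_space (UNIV::int set)). \<forall>z\<in>UNIV \<inter> cball z0 r.
       norm (\<phi> (of_int n + of_real a + z)) \<le> D n)" for z0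
    proof (intro exI conjI ballI)
      let ?R = "\<bar>a\<bar> + norm z0 + 1"
      show "integrable (count_space UNIV) (\<lambda>n::int. exp (- (pi * s/2 * (of_int n)\<^sup>2)) * exp (pi * s* ?R\<^sup>2 + 2 * pi * \<bar>c\<bar>* ?R))"
        by (rule int_bd)
      fix n :: int and z assume "z \<in> UNIV \<inter> cball z0 1"
      then have "norm (z - z0) \<le> 1" by (simp add: dist_norm norm_minus_commute)
      then have "norm (of_real a + z) \<le> ?R"
        using norm_triangle_ineq[of "of_real a" z] norm_triangle_sub[of z z0] by auto
      then show "norm (\<phi> (of_int n + of_real a + z)) \<le> exp (- (pi * s/2 * (of_int n)\<^sup>2)) * exp (pi * s* ?R\<^sup>2 + 2 * pi * \<bar>c\<bar>* ?R)"
        using bd[of "of_real a + z" ?R n] by (simp add: add.assoc)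
    qed auto
  qed (auto simp: \<phi>_def intro!: holomorphic_intros)
  have per: "f (z + 1) = f z" for z
  proof -
    have "f (z + 1) = infsetsum (\<lambda>n::int. \<phi> (of_int (n + 1) + of_real a + z)) UNIV"
    proof -
      have "of_int n + of_real a + (z + 1) = of_int (n + 1) + of_real a + z" for n :: int by simp
      then show ?thesis by (simp only: f_def infsetsum_def)
    qed
    also have "\<dots> = infsetsum (\<lambda>n::int. \<phi> (of_int n + of_real a + z)) UNIV"
      by (rule infsetsum_reindex_bij_betw[where g = "\<lambda>n::int. n + 1"])
         (rule bij_betwI[where g = "\<lambda>n. n - 1"]; simp)
    finally show ?thesis by (simp add: f_def infsetsum_def)
  qed
  have coef: "(LINT v:{0..1}|lborel. f (of_real v) * exp (-2 * pi * \<i>* of_int q * of_real v))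
      = exp (2 * pi * \<i>* of_int q * of_real a) * of_real (1 / sqrt s * exp (- (pi * (of_int q - c)\<^sup>2/s)))" for q :: int
  proof -
    define g where "g = (\<lambda>u::real. exp (- of_real (pi * s * u\<^sup>2) + 2 * pi * \<i>* of_real (c - of_int q) * of_real u))"
    have gi: "integrable lborel g" unfolding g_def by (rule gauss_fourier(1)[OF s])
    have gi': "integrable lborel (\<lambda>u. g (a + 1 * u))" by (rule lborel_integrable_real_affine[OF gi]) simp
    have "f (of_real v) * exp (-2 * pi * \<i>* of_int q * of_real v) =
       exp (2 * pi * \<i>* of_int q * of_real a) * (\<integral>n. g (a + 1 * (of_int n + v)) \<partial>count_space UNIV)" for v
    proof -
      have "\<phi> (of_int n + of_real a + of_real v) * exp (-2 * pi * \<i>* of_int q * of_real v)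
         = exp (2 * pi * \<i>* of_int q * of_real a) * g (a + 1 * (of_int n + v))" for n :: int
      proof -
        \<comment> \<open>Since q n is an integer, moving exp(-2 pi i q v) onto the shifted argument
          costs only the trivial phase.\<close>
        have p: "exp (2 * pi * \<i>* of_int (-q * n)) = 1" using exp_integer_2pi[of "of_int (-q * n)"] by (simp add: mult_ac)
        have "exp (2 * pi * \<i>* of_int q * of_real a) * g (a + 1 * (of_int n + v)) =
           \<phi> (of_int n + of_real a + of_real v) * exp (-2 * pi * \<i>* of_int q * of_real v) * exp (2 * pi * \<i>* of_int (-q * n))"
          unfolding g_def \<phi>_def exp_add[symmetric] by (rule arg_cong[of _ _ exp]) (simp add: algebra_simps)
        then show ?thesis using p by simp
      qed
      then show ?thesis
        unfolding f_def integral_mult_right_zero[symmetric] integral_mult_left_zero[symmetric] by (simp only:)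
    qed
    then have "(LINT v:{0..1}|lborel. f (of_real v) * exp (-2 * pi * \<i>* of_int q * of_real v))
      = exp (2 * pi * \<i>* of_int q * of_real a) * (LINT v:{0..1}|lborel. (\<integral>n. g (a + 1 * (of_int n + v)) \<partial>count_space UNIV))"
      by simp
    also have "\<dots> = exp (2 * pi * \<i>* of_int q * of_real a) * (\<integral>u. g (a + 1 * u) \<partial>lborel)"
      using integral_fold_int[OF gi'] by simp
    also have "(\<integral>u. g (a + 1 * u) \<partial>lborel) = (\<integral>u. g u \<partial>lborel)"
      using lborel_integral_real_affine[of 1 g a] by simp
    also have "\<dots> = of_real (1 / sqrt s * exp (- (pi * (of_int q - c)\<^sup>2/s)))"
      unfolding g_def gauss_fourier(2)[OF s] by (simp add: power2_commute)
    finally show ?thesis .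
  qed
  define b where "b = (\<lambda>q::int. exp (- of_real (pi * (of_int q - c)\<^sup>2/s) + 2 * pi * \<i>* of_int q * of_real a))"
  have bi: "integrable (count_space UNIV) b"
  proof (rule Bochner_Integration.integrable_bound)
    show "integrable (count_space UNIV) (\<lambda>q::int. exp (- (pi/(2 * s) * (of_int q)\<^sup>2)) * exp (pi * c\<^sup>2/s))"
      using integrable_int_exp_square[of "pi/(2 * s)"] s by auto
    show "AE q in count_space UNIV. norm (b q) \<le> norm (exp (- (pi/(2 * s) * (of_int q)\<^sup>2)) * exp (pi * c\<^sup>2/s))"
    proof (rule AE_I2)
      fix q :: int
      have "(of_int q)\<^sup>2 / 2 - c\<^sup>2 \<le> (of_int q - c)\<^sup>2"
        using zero_le_power2[of "of_int q - 2 * c"] by (simp add: power2_eq_square algebra_simps)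
      then have "pi/s * ((of_int q)\<^sup>2 / 2 - c\<^sup>2) \<le> pi/s * (of_int q - c)\<^sup>2"
        using s by (intro mult_left_mono) auto
      then show "norm (b q) \<le> norm (exp (- (pi/(2 * s) * (of_int q)\<^sup>2)) * exp (pi * c\<^sup>2/s))"
        by (simp add: b_def exp_add[symmetric] algebra_simps)
    qed
  qed auto
  have coef': "(LINT v:{0..1}|lborel. f (of_real v) * exp (-2 * pi * \<i>* of_int q * of_real v)) = of_real (1 / sqrt s) * b q" for q :: int
  proof -
    have bq: "b q = of_real (exp (- (pi * (of_int q - c)\<^sup>2 / s))) * exp (2 * pi * \<i> * of_int q * of_real a)"
      unfolding b_def by (simp only: exp_add exp_of_real[symmetric] of_real_minus)
    have comm: "x * (y * z) = y * (z * x)" for x y z :: complex by (simp add: mult_ac)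
    show ?thesis unfolding coef of_real_mult[of "1 / sqrt s"] bq by (rule comm)
  qed
  have "f 0 = (\<integral>q. of_real (1 / sqrt s) * b q \<partial>count_space UNIV)"
  proof (rule LIMSEQ_unique)
    show "(\<lambda>N. \<Sum>q=-int N..int N. of_real (1 / sqrt s) * b q) \<longlonglongrightarrow> f 0"
      using fourier_partial_sums[OF f_hol per] unfolding coef' .
    show "(\<lambda>N. \<Sum>q=-int N..int N. of_real (1 / sqrt s) * b q) \<longlonglongrightarrow> (\<integral>q. of_real (1 / sqrt s) * b q \<partial>count_space UNIV)"
      by (rule int_symmetric_partial_sums) (use bi in auto)
  qed
  then have "f 0 = of_real (1 / sqrt s) * (\<integral>q. b q \<partial>count_space UNIV)"
    by (simp only: integral_mult_right_zero)
  moreover have "\<phi> (of_int n + of_real a + 0) = exp (- of_real (pi * s * (of_int n + a)\<^sup>2) + 2 * pi * \<i>* of_real c * of_real (of_int n + a))" for n :: int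
    by (simp add: \<phi>_def)
  ultimately show ?thesis by (simp only: f_def b_def)
qed

section \<open>The theta function of a binary form\<close>

lemma count_space_pair_integral:
  fixes f :: "'a::countable \<times> 'b::countable \<Rightarrow> 'c::{banach, second_countable_topology}"
  assumes f: "integrable (count_space UNIV) f"
  shows "(\<integral>u. f u \<partial>count_space UNIV) = (\<integral>m. (\<integral>n. f (m, n) \<partial>count_space UNIV) \<partial>count_space UNIV)"
    and "(\<integral>u. f u \<partial>count_space UNIV) = (\<integral>n. (\<integral>m. f (m, n) \<partial>count_space UNIV) \<partial>count_space UNIV)"
proof -
  interpret A: sigma_finite_measure "count_space (UNIV :: 'a set)" by (rule sigma_finite_measure_count_space)
  interpret B: sigma_finite_measure "count_space (UNIV :: 'b set)" by (rule sigma_finite_measure_count_space)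
  interpret P: pair_sigma_finite "count_space (UNIV :: 'a set)" "count_space (UNIV :: 'b set)" ..
  have eq: "count_space (UNIV :: 'a set) \<Otimes>\<^sub>M count_space (UNIV :: 'b set) = count_space UNIV"
    by (subst pair_measure_countable) auto
  have f': "integrable (count_space UNIV \<Otimes>\<^sub>M count_space UNIV) (case_prod (curry f))"
    using f by (simp add: eq)
  show "(\<integral>u. f u \<partial>count_space UNIV) = (\<integral>m. (\<integral>n. f (m, n) \<partial>count_space UNIV) \<partial>count_space UNIV)"
    using P.integral_fst[OF f'] by (simp add: eq)
  show "(\<integral>u. f u \<partial>count_space UNIV) = (\<integral>n. (\<integral>m. f (m, n) \<partial>count_space UNIV) \<partial>count_space UNIV)"
    using P.integral_snd[OF f'] by (simp add: eq)
qed

lemma count_space_pair_integrable_mult: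
  fixes f :: "'a::countable \<Rightarrow> real" and g :: "'b::countable \<Rightarrow> real"
  assumes "integrable (count_space UNIV) f" "integrable (count_space UNIV) g"
  shows "integrable (count_space UNIV) (\<lambda>u. f (fst u) * g (snd u))"
proof -
  interpret A: sigma_finite_measure "count_space (UNIV :: 'a set)" by (rule sigma_finite_measure_count_space)
  interpret B: sigma_finite_measure "count_space (UNIV :: 'b set)" by (rule sigma_finite_measure_count_space)
  interpret P: pair_sigma_finite "count_space (UNIV :: 'a set)" "count_space (UNIV :: 'b set)" ..
  have eq: "count_space (UNIV :: 'a set) \<Otimes>\<^sub>M count_space (UNIV :: 'b set) = count_space UNIV"
    by (subst pair_measure_countable) auto
  have "integrable (count_space UNIV \<Otimes>\<^sub>M count_space UNIV) (\<lambda>u. f (fst u) * g (snd u))"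
    by (rule P.Fubini_integrable) (use assms in \<open>auto simp: eq abs_mult\<close>)
  then show ?thesis by (simp add: eq)
qed

section \<open>Positive definite binary forms and the transformation of their theta series\<close>

lemma pos_def_formD:
  assumes "pos_def_form A B C"
  shows "A > 0" "C > 0" "form_disc A B C > 0"
proof -
  have p: "quad_form A B C x y > 0" if "(x, y) \<noteq> (0, 0)" for x y
    using assms that by (auto simp: pos_def_form_def)
  show A: "A > 0" using p[of 1 0] by (simp add: quad_form_def)
  show "C > 0" using p[of 0 1] by (simp add: quad_form_def)
  \<comment> \<open>This vector annihilates the square in the completed form, which leaves A times
    Delta.\<close>
  have "quad_form A B C (- of_int B) (2 * of_int A) > 0" using A by (intro p) auto
  also have "quad_form A B C (- of_int B) (2 * of_int A) = of_int (A * form_disc A B C)"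
    by (simp add: quad_form_def form_disc_def power2_eq_square algebra_simps)
  finally show "form_disc A B C > 0" using A by (simp add: zero_less_mult_iff)
qed

lemma quad_form_complete_square:
  assumes "A \<noteq> 0"
  shows "quad_form A B C x y = of_int A * (x + of_int B * y / (2 * of_int A))\<^sup>2 + of_int (form_disc A B C) / (4 * of_int A) * y\<^sup>2"
  using assms by (simp add: quad_form_def form_disc_def power2_eq_square field_simps)

lemma quad_form_swap: "quad_form C B A y x = quad_form A B C x y"
  by (simp add: quad_form_def algebra_simps)

text \<open>Completing the square in one variable bounds Q below by a multiple of the square of the
  other variable; the average of the two bounds controls both.\<close>

lemma quad_form_lower_bound:
  assumes "pos_def_form A B C"
  shows "\<exists>d>0. \<forall>x y. d * (x\<^sup>2 + y\<^sup>2) \<le> quad_form A B C x y"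
proof -
  define D where "D = real_of_int (form_disc A B C)"
  have pos: "real_of_int A > 0" "real_of_int C > 0" "D > 0" using pos_def_formD[OF assms] by (auto simp: D_def)
  have 1: "D / (4 * of_int A) * y\<^sup>2 \<le> quad_form A B C x y" for x y
    using quad_form_complete_square[of A B C x y] pos by (simp add: D_def)
  have 2: "D / (4 * of_int C) * x\<^sup>2 \<le> quad_form A B C x y" for x y
    using quad_form_complete_square[of C B A y x] pos quad_form_swap[of C B A y x]
    by (simp add: D_def form_disc_def mult_ac)
  define d where "d = min (D / (4 * of_int A)) (D / (4 * of_int C)) / 2"
  have "d > 0" using pos by (simp add: d_def)
  moreover have "d * (x\<^sup>2 + y\<^sup>2) \<le> quad_form A B C x y" for x y
  proof -
    have "2 * d * y\<^sup>2 \<le> D / (4 * of_int A) * y\<^sup>2" "2 * d * x\<^sup>2 \<le> D / (4 * of_int C) * x\<^sup>2"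
      by (intro mult_right_mono; simp add: d_def)+
    with 1[of y x] 2[of x y] show ?thesis by (simp add: algebra_simps)
  qed
  ultimately show ?thesis by blast
qed

text \<open>(C, -B, A) is the adjugate of Q, the form that Poisson summation produces on the dual
  side; it is Q evaluated at (y, -x).\<close>

lemma quad_form_dual_pos_def:
  assumes "pos_def_form A B C" shows "pos_def_form C (- B) A"
  unfolding pos_def_form_def
proof (intro allI impI)
  fix x y :: real assume "(x, y) \<noteq> (0, 0)"
  then have "quad_form A B C y (- x) > 0" using assms by (auto simp: pos_def_form_def)
  then show "quad_form C (- B) A x y > 0" by (simp add: quad_form_def algebra_simps)
qed

text \<open>The series is dominated by a product of two one-dimensional Gaussians; the shifts cost
  only a constant, since (m + a)^2 is at least m^2 / 2 - a^2.\<close>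

lemma theta_integrable:
  fixes s a1 a2 :: real
  assumes "pos_def_form A B C" "s > 0"
  shows "integrable (count_space UNIV) (\<lambda>u::int\<times>int. exp (- (s * quad_form A B C (of_int (fst u) + a1) (of_int (snd u) + a2))))"
proof -
  obtain d where d: "d > 0" "\<And>x y. d * (x\<^sup>2 + y\<^sup>2) \<le> quad_form A B C x y"
    using quad_form_lower_bound[OF assms(1)] by blast
  define r where "r = s * d / 2"
  have r: "r > 0" using d assms by (simp add: r_def)
  have "integrable (count_space UNIV) (\<lambda>u::int\<times>int. exp (- (r * (of_int (fst u))\<^sup>2)) * exp (- (r * (of_int (snd u))\<^sup>2)))"
    by (intro count_space_pair_integrable_mult integrable_int_exp_square r)
  then have "integrable (count_space UNIV) (\<lambda>u::int\<times>int. exp (- (r * (of_int (fst u))\<^sup>2)) * exp (- (r * (of_int (snd u))\<^sup>2)) * exp (2 * r * (a1\<^sup>2 + a2\<^sup>2)))"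
    by simp
  then show ?thesis
  proof (rule Bochner_Integration.integrable_bound)
    show "AE u in count_space UNIV. norm (exp (- (s * quad_form A B C (of_int (fst u) + a1) (of_int (snd u) + a2))))
       \<le> norm (exp (- (r * (of_int (fst u))\<^sup>2)) * exp (- (r * (of_int (snd u))\<^sup>2)) * exp (2 * r * (a1\<^sup>2 + a2\<^sup>2)))"
    proof (rule AE_I2)
      fix u :: "int \<times> int"
      define m n where "m = real_of_int (fst u)" and "n = real_of_int (snd u)"
      have "s * (d * ((m + a1)\<^sup>2 + (n + a2)\<^sup>2)) \<le> s * quad_form A B C (m + a1) (n + a2)"
        using d(2) assms(2) by (intro mult_left_mono) auto
      moreover have "s * (d * ((m + a1)\<^sup>2 + (n + a2)\<^sup>2)) = 2 * r * ((m + a1)\<^sup>2 + (n + a2)\<^sup>2)"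
        by (simp add: r_def)
      moreover have "2 * r * ((m\<^sup>2 / 2 - a1\<^sup>2) + (n\<^sup>2 / 2 - a2\<^sup>2)) \<le> 2 * r * ((m + a1)\<^sup>2 + (n + a2)\<^sup>2)"
      proof (rule mult_left_mono)
        show "(m\<^sup>2 / 2 - a1\<^sup>2) + (n\<^sup>2 / 2 - a2\<^sup>2) \<le> (m + a1)\<^sup>2 + (n + a2)\<^sup>2"
          using zero_le_power2[of "m + 2 * a1"] zero_le_power2[of "n + 2 * a2"] by (simp add: power2_eq_square algebra_simps)
      qed (use r in auto)
      ultimately show "norm (exp (- (s * quad_form A B C (of_int (fst u) + a1) (of_int (snd u) + a2))))
       \<le> norm (exp (- (r * (of_int (fst u))\<^sup>2)) * exp (- (r * (of_int (snd u))\<^sup>2)) * exp (2 * r * (a1\<^sup>2 + a2\<^sup>2)))"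
        unfolding m_def[symmetric] n_def[symmetric] by (simp add: exp_add[symmetric] algebra_simps)
    qed
  qed auto
qed

text \<open>Poisson summation in the first variable, then in the second. After completing the square
  the shift of the first sum contains b Y / (2 a); dualised, it becomes a frequency of the second
  sum, and the two Gaussian exponents recombine to the adjugate form. The constant is 1 / sqrt (s1
  s2) with s1 s2 = t^2 Delta.\<close>

lemma theta_transform_real:
  fixes t a1 a2 :: real
  assumes pd: "pos_def_form A B C" and t: "t > 0"
  defines "D \<equiv> real_of_int (form_disc A B C)"
  shows "(\<integral>u. complex_of_real (exp (- (2 * pi * t * quad_form A B C (of_int (fst u) + a1) (of_int (snd u) + a2)))) \<partial>count_space (UNIV :: (int \<times> int) set))
       = of_real (1 / (t * sqrt D)) *
         (\<integral>v. of_real (exp (- (2 * pi / (D * t) * quad_form C (- B) A (of_int (fst v)) (of_int (snd v))))) *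
               exp (2 * pi * \<i> * of_real (of_int (fst v) * a1 + of_int (snd v) * a2)) \<partial>count_space (UNIV :: (int \<times> int) set))"
proof -
  define a b where "a = real_of_int A" and "b = real_of_int B"
  have pos: "a > 0" "D > 0" using pos_def_formD[OF pd] by (auto simp: D_def a_def)
  define s1 s2 where "s1 = 2 * t * a" and "s2 = t * D / (2 * a)"
  have s: "s1 > 0" "s2 > 0" using pos t by (auto simp: s1_def s2_def)
  define Y where "Y = (\<lambda>n::int. of_int n + a2)"
  have sq: "2 * pi * t * quad_form A B C (of_int m + a1) (Y n) =
      pi * s1 * (of_int m + (a1 + b * Y n / (2 * a)))\<^sup>2 + pi * s2 * (Y n)\<^sup>2" for m n :: int
    using pos by (subst quad_form_complete_square) (auto simp: a_def b_def D_def s1_def s2_def algebra_simps)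
  define h where "h = (\<lambda>(p::int) (n::int). complex_of_real (exp (- (pi * (of_int p)\<^sup>2 / s1))) *
       exp (2 * pi * \<i> * of_int p * of_real (a1 + b * Y n / (2 * a))) * of_real (exp (- (pi * s2 * (Y n)\<^sup>2))))"
  have inner: "(\<integral>m. complex_of_real (exp (- (2 * pi * t * quad_form A B C (of_int m + a1) (Y n)))) \<partial>count_space UNIV)
      = of_real (1 / sqrt s1) * (\<integral>p. h p n \<partial>count_space UNIV)" for n
  proof -
    have "(\<integral>m. complex_of_real (exp (- (2 * pi * t * quad_form A B C (of_int m + a1) (Y n)))) \<partial>count_space UNIV)
       = (\<integral>m. exp (- of_real (pi * s1 * (of_int m + (a1 + b * Y n / (2 * a)))\<^sup>2) + 2 * pi * \<i> * of_real 0 * of_real (of_int m + (a1 + b * Y n / (2 * a))))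
            \<partial>count_space (UNIV::int set)) * of_real (exp (- (pi * s2 * (Y n)\<^sup>2)))"
      unfolding sq integral_mult_left_zero[symmetric]
      by (intro Bochner_Integration.integral_cong refl) (simp add: exp_add[symmetric] exp_of_real[symmetric])
    also have "\<dots> = of_real (1 / sqrt s1) * (\<integral>p. exp (- of_real (pi * (of_int p - 0)\<^sup>2/s1) + 2 * pi * \<i> * of_int p * of_real (a1 + b * Y n / (2 * a)))
            \<partial>count_space (UNIV::int set)) * of_real (exp (- (pi * s2 * (Y n)\<^sup>2)))"
      by (subst gauss_poisson[OF s(1)]) simp
    also have "\<dots> = of_real (1 / sqrt s1) * (\<integral>p. h p n \<partial>count_space UNIV)"
    proof -
      have "h p n = exp (- of_real (pi * (of_int p - 0)\<^sup>2/s1) + 2 * pi * \<i> * of_int p * of_real (a1 + b * Y n / (2 * a))) * of_real (exp (- (pi * s2 * (Y n)\<^sup>2)))" for p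
        by (simp only: h_def exp_add exp_of_real[symmetric] of_real_minus diff_zero)
      then show ?thesis by (simp only: integral_mult_left_zero mult.assoc)
    qed
    finally show ?thesis .
  qed
  have int0: "integrable (count_space UNIV) (\<lambda>u::int\<times>int. complex_of_real (exp (- (2 * pi * t * quad_form A B C (of_int (fst u) + a1) (Y (snd u))))))"
    unfolding Y_def using theta_integrable[OF pd, of "2 * pi * t" a1 a2] t by simp
  have "integrable (count_space UNIV) (\<lambda>n::int. exp (- (pi * s2 * (Y n)\<^sup>2)))"
  proof (rule Bochner_Integration.integrable_bound)
    show "integrable (count_space UNIV) (\<lambda>n::int. exp (- (pi * s2 / 2 * (of_int n)\<^sup>2)) * exp (pi * s2 * a2\<^sup>2))"
      using integrable_int_exp_square[of "pi * s2 / 2"] s by simp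
    show "AE n in count_space UNIV. norm (exp (- (pi * s2 * (Y n)\<^sup>2))) \<le> norm (exp (- (pi * s2 / 2 * (of_int n)\<^sup>2)) * exp (pi * s2 * a2\<^sup>2))"
    proof (rule AE_I2)
      fix n :: int
      have "pi * s2 * ((of_int n)\<^sup>2 / 2 - a2\<^sup>2) \<le> pi * s2 * (Y n)\<^sup>2"
        using s zero_le_power2[of "of_int n + 2 * a2"] by (intro mult_left_mono) (auto simp: Y_def power2_eq_square algebra_simps)
      then show "norm (exp (- (pi * s2 * (Y n)\<^sup>2))) \<le> norm (exp (- (pi * s2 / 2 * (of_int n)\<^sup>2)) * exp (pi * s2 * a2\<^sup>2))"
        by (simp add: exp_add[symmetric] algebra_simps)
    qed
  qed auto
  then have inth: "integrable (count_space UNIV) (\<lambda>u. h (fst u) (snd u))"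
    by (intro Bochner_Integration.integrable_bound[OF count_space_pair_integrable_mult[OF integrable_int_exp_square[of "pi / s1"]]])
       (use s in \<open>auto simp: h_def norm_mult\<close>)
  have outer: "(\<integral>n. h p n \<partial>count_space UNIV) = of_real (1 / sqrt s2) *
      (\<integral>q. of_real (exp (- (2 * pi / (D * t) * quad_form C (- B) A (of_int p) (of_int q)))) *
               exp (2 * pi * \<i> * of_real (of_int p * a1 + of_int q * a2)) \<partial>count_space UNIV)" for p :: int
  proof -
    \<comment> \<open>The frequency that the second sum inherits from the cross term.\<close>
    define c where "c = of_int p * b / (2 * a)"
    define K where "K = complex_of_real (exp (- (pi * (of_int p)\<^sup>2 / s1))) * exp (2 * pi * \<i> * of_int p * of_real a1)"
    have "(\<integral>n. h p n \<partial>count_space UNIV) = K * (\<integral>n. exp (- of_real (pi * s2 * (of_int n + a2)\<^sup>2) + 2 * pi * \<i> * of_real c * of_real (of_int n + a2)) \<partial>count_space (UNIV::int set))"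
      unfolding integral_mult_right_zero[symmetric]
    proof (intro Bochner_Integration.integral_cong refl)
      fix n :: int
      have "exp (2 * pi * \<i> * of_int p * of_real (a1 + b * Y n / (2 * a))) = exp (2 * pi * \<i> * of_int p * of_real a1) * exp (2 * pi * \<i> * of_real c * of_real (of_int n + a2))"
        unfolding exp_add[symmetric] by (rule arg_cong[of _ _ exp]) (use pos in \<open>simp add: c_def Y_def field_simps\<close>)
      moreover have "exp (- of_real (pi * s2 * (of_int n + a2)\<^sup>2) + 2 * pi * \<i> * of_real c * of_real (of_int n + a2)) =
         of_real (exp (- (pi * s2 * (Y n)\<^sup>2))) * exp (2 * pi * \<i> * of_real c * of_real (of_int n + a2))"
        unfolding Y_def by (simp only: exp_add exp_of_real[symmetric] of_real_minus)
      ultimately show "h p n = K * exp (- of_real (pi * s2 * (of_int n + a2)\<^sup>2) + 2 * pi * \<i> * of_real c * of_real (of_int n + a2))"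
        unfolding h_def K_def by (simp only: mult_ac)
    qed
    also have "\<dots> = of_real (1 / sqrt s2) * (\<integral>q. K * exp (- of_real (pi * (of_int q - c)\<^sup>2/s2) + 2 * pi * \<i> * of_int q * of_real a2) \<partial>count_space (UNIV::int set))"
      unfolding gauss_poisson[OF s(2)] integral_mult_right_zero by (simp only: mult_ac)
    also have "(\<integral>q. K * exp (- of_real (pi * (of_int q - c)\<^sup>2/s2) + 2 * pi * \<i> * of_int q * of_real a2) \<partial>count_space (UNIV::int set)) =
       (\<integral>q. of_real (exp (- (2 * pi / (D * t) * quad_form C (- B) A (of_int p) (of_int q)))) *
               exp (2 * pi * \<i> * of_real (of_int p * a1 + of_int q * a2)) \<partial>count_space UNIV)"
    proof (intro Bochner_Integration.integral_cong refl)
      fix q :: int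
      have "pi * (of_int p)\<^sup>2 / s1 + pi * (of_int q - c)\<^sup>2 / s2 = 2 * pi / (D * t) * quad_form C (- B) A (of_int p) (of_int q)"
      proof -
        have Qe: "quad_form C (- B) A (of_int p) (of_int q) = a * (of_int q - b * of_int p / (2 * a))\<^sup>2 + D / (4 * a) * (of_int p)\<^sup>2"
          using quad_form_complete_square[of A "- B" C "of_int q" "of_int p"] pos
          by (simp add: a_def b_def D_def form_disc_def quad_form_swap[of C "-B" A])
        show ?thesis unfolding Qe s1_def s2_def c_def using pos t
          by (simp add: field_simps power2_eq_square)
      qed
      then have e: "of_real (exp (- (2 * pi / (D * t) * quad_form C (- B) A (of_int p) (of_int q))))
          = complex_of_real (exp (- (pi * (of_int p)\<^sup>2 / s1))) * of_real (exp (- (pi * (of_int q - c)\<^sup>2 / s2)))"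
        by (simp add: exp_add[symmetric] flip: of_real_mult)
      have f: "exp (2 * pi * \<i> * of_real (of_int p * a1 + of_int q * a2)) = exp (2 * pi * \<i> * of_int p * of_real a1) * exp (2 * pi * \<i> * of_int q * of_real a2)"
        unfolding exp_add[symmetric] by (rule arg_cong[of _ _ exp]) (simp add: algebra_simps)
      have g: "exp (- of_real (pi * (of_int q - c)\<^sup>2/s2) + 2 * pi * \<i> * of_int q * of_real a2) =
         of_real (exp (- (pi * (of_int q - c)\<^sup>2 / s2))) * exp (2 * pi * \<i> * of_int q * of_real a2)"
        by (simp only: exp_add exp_of_real[symmetric] of_real_minus)
      show "K * exp (- of_real (pi * (of_int q - c)\<^sup>2/s2) + 2 * pi * \<i> * of_int q * of_real a2) =
         of_real (exp (- (2 * pi / (D * t) * quad_form C (- B) A (of_int p) (of_int q)))) *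
               exp (2 * pi * \<i> * of_real (of_int p * a1 + of_int q * a2))"
        unfolding e f g K_def by (simp only: mult_ac)
    qed
    finally show ?thesis .
  qed
  have intr: "integrable (count_space UNIV) (\<lambda>v. complex_of_real (exp (- (2 * pi / (D * t) * quad_form C (- B) A (of_int (fst v)) (of_int (snd v))))) *
               exp (2 * pi * \<i> * of_real (of_int (fst v) * a1 + of_int (snd v) * a2)))"
    by (rule Bochner_Integration.integrable_bound[OF theta_integrable[OF quad_form_dual_pos_def[OF pd], of "2 * pi / (D * t)" 0 0]])
       (use pos t in \<open>auto simp: norm_mult\<close>)
  have "(\<integral>u. complex_of_real (exp (- (2 * pi * t * quad_form A B C (of_int (fst u) + a1) (of_int (snd u) + a2)))) \<partial>count_space (UNIV :: (int \<times> int) set))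
     = (\<integral>n. (\<integral>m. complex_of_real (exp (- (2 * pi * t * quad_form A B C (of_int m + a1) (Y n)))) \<partial>count_space UNIV) \<partial>count_space UNIV)"
    using count_space_pair_integral(2)[OF int0] by (simp add: Y_def)
  also have "\<dots> = of_real (1 / sqrt s1) * (\<integral>n. (\<integral>p. h p n \<partial>count_space UNIV) \<partial>count_space UNIV)"
    unfolding inner by (rule integral_mult_right_zero)
  also have "(\<integral>n. (\<integral>p. h p n \<partial>count_space UNIV) \<partial>count_space UNIV) = (\<integral>p. (\<integral>n. h p n \<partial>count_space UNIV) \<partial>count_space UNIV)"
    using count_space_pair_integral[OF inth] by simp
  also have "\<dots> = of_real (1 / sqrt s2) * (\<integral>p. (\<integral>q. of_real (exp (- (2 * pi / (D * t) * quad_form C (- B) A (of_int p) (of_int q)))) *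
               exp (2 * pi * \<i> * of_real (of_int p * a1 + of_int q * a2)) \<partial>count_space UNIV) \<partial>count_space UNIV)"
    unfolding outer by (rule integral_mult_right_zero)
  also have "(\<integral>p. (\<integral>q. of_real (exp (- (2 * pi / (D * t) * quad_form C (- B) A (of_int p) (of_int q)))) *
               exp (2 * pi * \<i> * of_real (of_int p * a1 + of_int q * a2)) \<partial>count_space UNIV) \<partial>count_space UNIV) =
      (\<integral>v. of_real (exp (- (2 * pi / (D * t) * quad_form C (- B) A (of_int (fst v)) (of_int (snd v))))) *
               exp (2 * pi * \<i> * of_real (of_int (fst v) * a1 + of_int (snd v) * a2)) \<partial>count_space (UNIV :: (int \<times> int) set))"
    using count_space_pair_integral(1)[OF intr] by simp
  also have "complex_of_real (1 / sqrt s1) * (of_real (1 / sqrt s2) * X) = of_real (1 / (t * sqrt D)) * X" for X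
  proof -
    have "s1 * s2 = t\<^sup>2 * D" using pos by (simp add: s1_def s2_def power2_eq_square)
    then have "sqrt s1 * sqrt s2 = t * sqrt D" using t by (simp add: real_sqrt_mult[symmetric]) (simp add: real_sqrt_mult)
    then show ?thesis by (simp flip: of_real_mult mult.assoc)
  qed
  finally show ?thesis .
qed

lemma holomorphic_eq_from_reals:
  fixes f g :: "complex \<Rightarrow> complex"
  assumes "f holomorphic_on S" "g holomorphic_on S" "open S" "connected S"
    and "of_real a \<in> S" and eq: "\<And>x::real. of_real x \<in> S \<Longrightarrow> f (of_real x) = g (of_real x)" and "z \<in> S"
  shows "f z = g z"
proof -
  have lim: "of_real a islimpt (S \<inter> range complex_of_real)"
  proof (rule islimptI)
    fix T :: "complex set" assume T: "of_real a \<in> T" "open T"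
    obtain e where e: "e > 0" "ball (of_real a) e \<subseteq> S \<inter> T"
      using openE[OF open_Int[OF \<open>open S\<close> T(2)]] assms(5) T(1) by (metis IntI)
    have "complex_of_real (a + e / 2) \<in> ball (of_real a) e" using e by (simp add: dist_norm)
    then show "\<exists>y\<in>S \<inter> range complex_of_real. y \<in> T \<and> y \<noteq> of_real a"
      using e by (intro bexI[of _ "complex_of_real (a + e / 2)"]) (auto simp del: of_real_add)
  qed
  have "f z - g z = 0"
    by (rule analytic_continuation[OF _ assms(3,4) _ assms(5) lim])
       (use assms eq in \<open>auto intro!: holomorphic_intros\<close>)
  then show ?thesis by simp
qed

text \<open>Absolute convergence at the real point Re z0 / 2 dominates the whole disc of radius Re
  z0 / 2 around z0.\<close>

lemma theta_series_holomorphic: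
  fixes q :: "'i::countable \<Rightarrow> real" and c :: "'i \<Rightarrow> complex"
  assumes q: "\<And>i. q i \<ge> 0" and int: "\<And>s. s > 0 \<Longrightarrow> integrable (count_space UNIV) (\<lambda>i. exp (- (s * q i)))"
    and c: "\<And>i. norm (c i) \<le> K"
  shows "(\<lambda>t. \<integral>i. c i * exp (- t * of_real (q i)) \<partial>count_space UNIV) holomorphic_on {t. Re t > 0}"
proof (rule holomorphic_on_lebesgue_integral)
  show "open {t::complex. Re t > 0}" by (rule open_halfspace_Re_gt)
  fix z0 :: complex assume "z0 \<in> {t. Re t > 0}"
  then have z0: "Re z0 > 0" by simp
  show "\<exists>r>0. \<exists>D. integrable (count_space UNIV) D \<and> (\<forall>x\<in>space (count_space UNIV). \<forall>z\<in>{t. 0 < Re t} \<inter> cball z0 r. norm (c x * exp (- z * of_real (q x))) \<le> D x)"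
  proof (intro exI conjI ballI)
    show "Re z0 / 2 > 0" using z0 by simp
    show "integrable (count_space UNIV) (\<lambda>i. K * exp (- (Re z0 / 2 * q i)))" using int[of "Re z0 / 2"] z0 by simp
    fix i :: 'i and z assume "z \<in> {t. 0 < Re t} \<inter> cball z0 (Re z0 / 2)"
    then have "norm (z0 - z) \<le> Re z0 / 2" by (simp add: dist_norm)
    then have "Re z \<ge> Re z0 / 2" using complex_Re_le_cmod[of "z0 - z"] by simp
    then have "exp (- (Re z * q i)) \<le> exp (- (Re z0 / 2 * q i))" using mult_right_mono[OF _ q[of i], of "Re z0 / 2" "Re z"] by simp
    then show "norm (c i * exp (- z * of_real (q i))) \<le> K * exp (- (Re z0 / 2 * q i))"
      using c[of i] order_trans[OF norm_ge_zero c[of i]] by (auto simp: norm_mult intro!: mult_mono)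
  qed
qed (auto intro!: holomorphic_intros)

lemma pos_def_form_nonneg: "pos_def_form A B C \<Longrightarrow> quad_form A B C x y \<ge> 0"
  by (cases "(x, y) = (0, 0)") (auto simp: pos_def_form_def quad_form_def intro: less_imp_le)

text \<open>Both sides are holomorphic in the right half-plane and agree on the positive axis by
  \<open>theta_transform_real\<close>. Complex t is needed because the cusp is approached from
  complex directions.\<close>

lemma theta_transform:
  fixes a1 a2 :: real and t :: complex
  assumes pd: "pos_def_form A B C" and t: "Re t > 0"
  defines "D \<equiv> real_of_int (form_disc A B C)"
  shows "(\<integral>u. exp (- t * of_real (2 * pi * quad_form A B C (of_int (fst u) + a1) (of_int (snd u) + a2))) \<partial>count_space (UNIV :: (int \<times> int) set))
       = 1 / (t * of_real (sqrt D)) *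
         (\<integral>v. exp (2 * pi * \<i> * of_real (of_int (fst v) * a1 + of_int (snd v) * a2)) *
               exp (- (1 / t) * of_real (2 * pi / D * quad_form C (- B) A (of_int (fst v)) (of_int (snd v))))
           \<partial>count_space (UNIV :: (int \<times> int) set))"
    (is "?L t = ?R t")
proof (rule holomorphic_eq_from_reals[where S = "{t. Re t > 0}" and a = 1 and f = ?L and g = ?R])
  have D: "D > 0" using pos_def_formD[OF pd] by (simp add: D_def)
  have nn: "quad_form A B C x y \<ge> 0" "quad_form C (- B) A x y \<ge> 0" for x y
    by (intro pos_def_form_nonneg pd quad_form_dual_pos_def)+
  show "?L holomorphic_on {t. Re t > 0}"
    using theta_series_holomorphic[where c = "\<lambda>_. 1" and K = 1 and q = "\<lambda>u::int\<times>int. 2 * pi * quad_form A B C (of_int (fst u) + a1) (of_int (snd u) + a2)"]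
      theta_integrable[OF pd, of "_ * (2 * pi)" a1 a2] nn
    by (simp add: mult.assoc)
  have h: "(\<lambda>t. \<integral>v. exp (2 * pi * \<i> * of_real (of_int (fst v) * a1 + of_int (snd v) * a2)) *
               exp (- t * of_real (2 * pi / D * quad_form C (- B) A (of_int (fst v)) (of_int (snd v)))) \<partial>count_space (UNIV :: (int \<times> int) set))
     holomorphic_on {t. Re t > 0}"
  proof (rule theta_series_holomorphic)
    fix s :: real assume "s > 0"
    then show "integrable (count_space UNIV) (\<lambda>v::int\<times>int. exp (- (s * (2 * pi / D * quad_form C (- B) A (of_int (fst v)) (of_int (snd v))))))"
      using theta_integrable[OF quad_form_dual_pos_def[OF pd], of "s * (2 * pi / D)" 0 0] D by (simp add: mult.assoc)
  next
    show "norm (exp (2 * pi * \<i> * of_real (of_int (fst v) * a1 + of_int (snd v) * a2))) \<le> 1" for v :: "int \<times> int"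
      by simp
  qed (use nn D in auto)
  have "(\<lambda>t::complex. 1 / t) ` {t. Re t > 0} \<subseteq> {t. Re t > 0}"
    by (auto simp: Re_divide complex_eq_iff cmod_power2[symmetric] intro!: divide_pos_pos)
  then have "((\<lambda>t. \<integral>v. exp (2 * pi * \<i> * of_real (of_int (fst v) * a1 + of_int (snd v) * a2)) *
               exp (- t * of_real (2 * pi / D * quad_form C (- B) A (of_int (fst v)) (of_int (snd v)))) \<partial>count_space (UNIV :: (int \<times> int) set)) \<circ> (\<lambda>t. 1 / t))
     holomorphic_on {t. Re t > 0}"
    by (intro holomorphic_on_compose_gen[OF _ h]) (auto intro!: holomorphic_intros)
  then have "(\<lambda>t. \<integral>v. exp (2 * pi * \<i> * of_real (of_int (fst v) * a1 + of_int (snd v) * a2)) *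
               exp (- (1 / t) * of_real (2 * pi / D * quad_form C (- B) A (of_int (fst v)) (of_int (snd v)))) \<partial>count_space (UNIV :: (int \<times> int) set))
     holomorphic_on {t. Re t > 0}" by (simp add: o_def)
  then show "?R holomorphic_on {t. Re t > 0}"
    using D by (intro holomorphic_on_mult holomorphic_on_divide) (auto intro!: holomorphic_intros)
  show "open {t::complex. Re t > 0}" by (rule open_halfspace_Re_gt)
  show "connected {t::complex. Re t > 0}" by (simp add: convex_connected convex_halfspace_Re_gt)
  show "?L (of_real x) = ?R (of_real x)" if "of_real x \<in> {t. Re t > 0}" for x
  proof -
    have x: "x > 0" using that by simp
    have 1: "exp (- of_real x * of_real (2 * pi * y)) = complex_of_real (exp (- (2 * pi * x * y)))" for y
      by (simp add: exp_of_real[symmetric] mult_ac)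
    have 2: "exp (- (1 / of_real x) * of_real (2 * pi / D * y)) = complex_of_real (exp (- (2 * pi / (D * x) * y)))" for y
      by (simp add: exp_of_real[symmetric] mult_ac)
    show ?thesis unfolding 1 2
      using theta_transform_real[OF pd x, of a1 a2] by (simp add: D_def mult.commute)
  qed
qed (use t in auto)

section \<open>The theta function of the form and its inversion\<close>

locale epstein_form =
  fixes A B C k :: int
  assumes pd: "pos_def_form A B C" and k_pos: "k > 0" and k_disc: "k\<^sup>2 = form_disc A B C" and k_mod: "k mod 4 = 2"
begin

definition q :: "int \<times> int \<Rightarrow> int" where
  "q u = A * (fst u)\<^sup>2 + B * fst u * snd u + C * (snd u)\<^sup>2"

lemma of_int_q: "real_of_int (q u) = quad_form A B C (of_int (fst u)) (of_int (snd u))"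
  by (simp add: q_def quad_form_def)

lemma q_nonneg: "q u \<ge> 0" and q_ge_1: "u \<noteq> (0, 0) \<Longrightarrow> q u \<ge> 1"
proof -
  show 1: "q u \<ge> 1" if "u \<noteq> (0, 0)" for u
  proof -
    have "real_of_int (q u) > 0"
      using pd that unfolding of_int_q pos_def_form_def by (cases u) auto
    then show ?thesis by simp
  qed
  show "q u \<ge> 0" using 1[of u] by (cases "u = (0,0)") (auto simp: q_def)
qed

lemma q_integrable: "(s::real) > 0 \<Longrightarrow> integrable (count_space UNIV) (\<lambda>u. exp (- (s * of_int (q u))))"
  unfolding of_int_q using theta_integrable[OF pd, of s 0 0] by simp

text \<open>With the factor 2 pi / k = 2 pi / sqrt Delta the inversion is x -> 1/x with multiplier x
  and no further constant, and the Mellin transform produces the power of 2 pi / sqrt Delta of the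
  completed zeta function.\<close>

definition theta :: "complex \<Rightarrow> complex" where
  "theta x = (\<integral>u. exp (- x * of_real (2 * pi / of_int k * of_int (q u))) \<partial>count_space UNIV)"

lemma q_integrable': "(s::real) > 0 \<Longrightarrow> (r::real) > 0 \<Longrightarrow> integrable (count_space UNIV) (\<lambda>u. exp (- (s * (r * of_int (q u)))))"
  using q_integrable[of "s * r"] by (simp add: mult.assoc)

lemma k_pos': "real_of_int k > 0" using k_pos by simp

lemma sqrt_disc: "sqrt (real_of_int (form_disc A B C)) = of_int k"
  using k_pos unfolding k_disc[symmetric] by simp

lemma theta_holomorphic: "theta holomorphic_on {x. Re x > 0}"
proof -
  have "(\<lambda>x. \<integral>u. 1 * exp (- x * of_real (2 * pi / of_int k * of_int (q u))) \<partial>count_space UNIV) holomorphic_on {x. Re x > 0}"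
  proof (rule theta_series_holomorphic[where K = 1])
    show "integrable (count_space UNIV) (\<lambda>u. exp (- (s * (2 * pi / of_int k * of_int (q u)))))" if "s > 0" for s :: real
      by (rule q_integrable') (use that k_pos' in auto)
  qed (use q_nonneg k_pos' in auto)
  then show ?thesis unfolding theta_def[abs_def] mult_1 .
qed

text \<open>The quarter turn (m, n) -> (n, -m) identifies the adjugate form with Q itself, so the
  dual theta series is again that of Q.\<close>

lemma dual_reindex:
  fixes f :: "int \<times> int \<Rightarrow> complex"
  shows "(\<integral>v. f v \<partial>count_space UNIV) = (\<integral>v. f (snd v, - fst v) \<partial>count_space UNIV)"
    and "quad_form C (- B) A (of_int (snd v)) (of_int (- fst v)) = of_int (q v)"
proof -
  have "infsetsum f UNIV = infsetsum (\<lambda>v. f (snd v, - fst v)) UNIV"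
    by (rule infsetsum_reindex_bij_betw[where g = "\<lambda>v::int\<times>int. (snd v, - fst v)", symmetric])
       (rule bij_betwI[where g = "\<lambda>v. (- snd v, fst v)"]; simp)
  then show "(\<integral>v. f v \<partial>count_space UNIV) = (\<integral>v. f (snd v, - fst v) \<partial>count_space UNIV)"
    by (simp add: infsetsum_def)
  show "quad_form C (- B) A (of_int (snd v)) (of_int (- fst v)) = of_int (q v)"
    by (simp add: of_int_q quad_form_def algebra_simps)
qed

lemma shifted_theta:
  assumes t: "Re t > 0"
  shows "(\<integral>u. exp (- t * of_real (2 * pi * quad_form A B C (of_int (fst u) + a1) (of_int (snd u) + a2))) \<partial>count_space (UNIV :: (int \<times> int) set))
       = 1 / (t * of_int k) *
         (\<integral>v. exp (2 * pi * \<i> * of_real (of_int (snd v) * a1 - of_int (fst v) * a2)) *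
               exp (- (1 / t) * of_real (2 * pi / (of_int k)\<^sup>2 * of_int (q v)))
           \<partial>count_space UNIV)"
  unfolding theta_transform[OF pd t] sqrt_disc k_disc[symmetric]
  using k_pos by (subst dual_reindex(1)) (simp add: dual_reindex(2)[simplified])

lemma theta_inversion:
  assumes x: "Re x > 0"
  shows "theta (1 / x) = x * theta x"
proof -
  have x0: "x \<noteq> 0" using x by auto
  have "theta x = (\<integral>u. exp (- (x / of_int k) * of_real (2 * pi * quad_form A B C (of_int (fst u) + 0) (of_int (snd u) + 0))) \<partial>count_space (UNIV :: (int \<times> int) set))"
    by (simp add: theta_def of_int_q)
  also have "\<dots> = 1 / (x / of_int k * of_int k) *
         (\<integral>v. exp (2 * pi * \<i> * of_real (of_int (snd v) * 0 - of_int (fst v) * 0)) *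
               exp (- (1 / (x / of_int k)) * of_real (2 * pi / (of_int k)\<^sup>2 * of_int (q v)))
           \<partial>count_space UNIV)"
    by (rule shifted_theta) (use x k_pos' Re_divide_of_real[of x "of_int k"] in simp)
  also have "\<dots> = 1 / x * theta (1 / x)"
    using k_pos by (simp add: theta_def power2_eq_square mult_ac)
  finally show ?thesis using x0 by (simp add: field_simps)
qed

section \<open>Gauss sums and the expansion at the cusp i\<close>

definition residues :: "(int \<times> int) set" where "residues = {0..<k} \<times> {0..<k}"

lemma sum_over_residues:
  fixes f :: "int \<times> int \<Rightarrow> complex"
  assumes f: "integrable (count_space UNIV) f"
  shows "(\<integral>u. f u \<partial>count_space UNIV) = (\<Sum>r\<in>residues. \<integral>l. f (fst r + k * fst l, snd r + k * snd l) \<partial>count_space UNIV)"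
proof -
  define I where "I = (\<lambda>r u. if (fst u mod k, snd u mod k) = r then f u else 0)"
  have Ii: "integrable (count_space UNIV) (I r)" for r
    by (rule Bochner_Integration.integrable_bound[OF f]) (auto simp: I_def)
  have fs: "f u = (\<Sum>r\<in>residues. I r u)" for u
  proof -
    have "(\<Sum>r\<in>residues. I r u) = (\<Sum>r\<in>residues. if r = (fst u mod k, snd u mod k) then f u else 0)"
      by (intro sum.cong) (auto simp: I_def)
    also have "\<dots> = f u" using k_pos by (subst sum.delta) (auto simp: residues_def)
    finally show ?thesis ..
  qed
  have "(\<integral>u. I r u \<partial>count_space UNIV) = (\<integral>l. f (fst r + k * fst l, snd r + k * snd l) \<partial>count_space UNIV)" if r: "r \<in> residues" for r
  proof -
    define g where "g = (\<lambda>l::int\<times>int. (fst r + k * fst l, snd r + k * snd l))"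
    have "infsetsum (I r) UNIV = infsetsum f (range g)"
    proof (rule infsetsum_cong_neutral)
      fix u assume u: "u \<in> UNIV - range g"
      have "u = g (fst u div k, snd u div k)" if "(fst u mod k, snd u mod k) = r"
        using that by (cases u) (auto simp: g_def)
      then show "I r u = 0" using u by (auto simp: I_def)
    next
      fix u assume "u \<in> UNIV \<inter> range g"
      then show "I r u = f u" using r by (auto simp: I_def g_def residues_def)
    qed auto
    also have "\<dots> = infsetsum (\<lambda>l. f (g l)) UNIV"
      by (rule infsetsum_reindex) (use k_pos in \<open>auto simp: inj_on_def g_def prod_eq_iff\<close>)
    finally show ?thesis by (simp add: infsetsum_def g_def)
  qed
  then show ?thesis unfolding fs by (subst Bochner_Integration.integral_sum) (use Ii in auto)
qed

text \<open>The Gauss sum of Q modulo k twisted by a character of frequency v; v = (0, 0) gives the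
  constant term of the expansion at i. The alternating pairing of v and r is a consequence of the
  quarter turn in \<open>dual_reindex\<close>.\<close>

definition gauss_coeff :: "int \<times> int \<Rightarrow> complex" where
  "gauss_coeff v = (\<Sum>r\<in>residues. exp (- (2 * pi * \<i> * of_int (q r) / of_int k)) *
       exp (2 * pi * \<i> * of_int (snd v * fst r - fst v * snd r) / of_int k))"

lemma gauss_coeff_bound: "norm (gauss_coeff v) \<le> (of_int k)\<^sup>2"
proof -
  have "norm (gauss_coeff v) \<le> (\<Sum>r\<in>residues. 1)"
    unfolding gauss_coeff_def by (rule sum_norm_le) (simp add: norm_mult)
  also have "\<dots> = (of_int k)\<^sup>2" using k_pos by (simp add: residues_def card_cartesian_product power2_eq_square)
  finally show ?thesis .
qed


lemma k_half: obtains h where "k = 2 * h" "odd h"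
proof -
  have "k = 2 * (k div 2)" "odd (k div 2)" using k_mod by presburger+
  then show ?thesis using that by blast
qed

lemma even_B: "even B"
proof -
  have "even (k\<^sup>2)" using k_mod by (simp add: even_power) presburger
  then show ?thesis unfolding k_disc form_disc_def by auto
qed

text \<open>With A = 2 a, C = 2 c, B = 2 b and k = 2 h the relation k^2 = 4 A C - B^2 would read b^2
  + h^2 = 4 a c. As h is odd, the left side is 1 or 2 modulo 4.\<close>

lemma odd_A_or_C: "odd A \<or> odd C"
proof (rule ccontr)
  assume "\<not> (odd A \<or> odd C)"
  then obtain a c where ac: "A = 2 * a" "C = 2 * c" by (auto elim!: evenE)
  obtain b where b: "B = 2 * b" using even_B by (elim evenE)
  obtain h where h: "k = 2 * h" "odd h" by (rule k_half)
  obtain m where m: "h = 2 * m + 1" using h(2) by (elim oddE)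
  have "4 * h\<^sup>2 = 4 * (4 * (a * c) - b\<^sup>2)"
    using k_disc unfolding form_disc_def ac b h(1) by (simp add: power2_eq_square algebra_simps)
  then have eq: "b\<^sup>2 + (2 * m + 1)\<^sup>2 = 4 * (a * c)" by (simp add: m)
  obtain n where "b = 2 * n \<or> b = 2 * n + 1" by (metis evenE oddE)
  then show False
  proof
    assume "b = 2 * n"
    then have "2 * (2 * (n * n) + 2 * (m * m) + 2 * m) + 1 = 2 * (2 * (a * c))"
      using eq by (simp add: power2_eq_square algebra_simps)
    then show False by presburger
  next
    assume "b = 2 * n + 1"
    then have "4 * (n * n + n + m * m + m) + 2 = 4 * (a * c)"
      using eq by (simp add: power2_eq_square algebra_simps)
    then show False by presburger
  qed
qed

definition qexp :: "int \<times> int \<Rightarrow> complex" where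
  "qexp r = exp (- (2 * pi * \<i> * of_int (q r) / of_int k))"

lemma qexp_cong: assumes "k dvd q r - q r'" shows "qexp r = qexp r'"
proof -
  obtain m where "q r - q r' = k * m" using assms by (elim dvdE)
  then have m: "q r = q r' + k * m" by simp
  have "- (2 * pi * \<i> * of_int (q r) / of_int k) = - (2 * pi * \<i> * of_int (q r') / of_int k) + \<i> * (of_int (- m) * (of_real pi * 2))"
    using k_pos by (simp add: m field_simps)
  then have "qexp r = qexp r' * exp (\<i> * (of_int (- m) * (of_real pi * 2)))"
    unfolding qexp_def by (simp only: exp_add)
  also have "exp (\<i> * (of_int (- m) * (of_real pi * 2))) = 1"
    using exp_integer_2pi[of "of_int (- m)"] by (simp add: mult_ac)
  finally show ?thesis by simp
qed

lemma qexp_periodic: "qexp (fst r + k * m, snd r + k * n) = qexp r"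
proof (rule qexp_cong)
  have "q (fst r + k * m, snd r + k * n) - q r = k * (A * m * (2 * fst r + k * m) +
      B * (fst r * n + m * snd r + k * m * n) + C * n * (2 * snd r + k * n))"
    by (simp add: q_def power2_eq_square algebra_simps)
  then show "k dvd q (fst r + k * m, snd r + k * n) - q r" by simp
qed

lemma qexp_residue: "qexp (m mod k, n mod k) = qexp (m, n)"
  using qexp_periodic[of "(m mod k, n mod k)" "m div k" "n div k"] by simp

text \<open>Modulo k the shift changes q by A h^2, as B is even and k = 2 h. For A and h odd this is
  h modulo k, and exp(-2 pi i h / k) = -1. The second coordinate is treated alike, with C in place
  of A.\<close>

lemma qexp_half_shift:
  assumes "k = 2 * h" "odd h"
  shows "odd A \<Longrightarrow> qexp (m + h, n) = - qexp (m, n)" and "odd C \<Longrightarrow> qexp (m, n + h) = - qexp (m, n)"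
proof -
  obtain b where b: "B = 2 * b" using even_B by (elim evenE)
  obtain h' where h': "h = 2 * h' + 1" using assms(2) by (elim oddE)
  have *: "qexp r = - qexp r'" if "q r = q r' + k * j + h" for r r' j
  proof -
    have "- (2 * pi * \<i> * of_int (q r) / of_int k) = - (2 * pi * \<i> * of_int (q r') / of_int k) + \<i> * (of_int (- j) * (of_real pi * 2)) + - (\<i> * of_real pi)"
      using k_pos unfolding that assms(1) by (simp add: field_simps)
    then have "qexp r = qexp r' * exp (\<i> * (of_int (- j) * (of_real pi * 2))) * exp (- (\<i> * of_real pi))"
      unfolding qexp_def by (simp only: exp_add)
    also have "exp (\<i> * (of_int (- j) * (of_real pi * 2))) = 1"
      using exp_integer_2pi[of "of_int (- j)"] by (simp add: mult_ac)
    also have "exp (- (\<i> * of_real pi)) = -1"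
      by (simp add: exp_minus mult.commute)
    finally show ?thesis by simp
  qed
  show "qexp (m + h, n) = - qexp (m, n)" if A: "odd A"
  proof -
    obtain a where a: "A = 2 * a + 1" using A by (elim oddE)
    have "q (m + h, n) = q (m, n) + k * (A * m + b * n + a * h + h') + h"
      unfolding q_def by (simp add: a b assms(1) h' power2_eq_square algebra_simps)
    then show ?thesis by (rule *)
  qed
  show "qexp (m, n + h) = - qexp (m, n)" if C: "odd C"
  proof -
    obtain c where c: "C = 2 * c + 1" using C by (elim oddE)
    have "q (m, n + h) = q (m, n) + k * (C * n + b * m + c * h + h') + h"
      unfolding q_def by (simp add: c b assms(1) h' power2_eq_square algebra_simps)
    then show ?thesis by (rule *)
  qed
qed

lemma bij_betw_add_mod: "bij_betw (\<lambda>m. (m + h) mod k) {0..<k} {0..<k}"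
  by (rule bij_betwI[where g = "\<lambda>m. (m - h) mod k"]) (use k_pos in \<open>auto simp: mod_simps\<close>)

text \<open>Shifting one coordinate with odd leading coefficient by \<open>k / 2\<close> changes the sign of every
  term; this is where the congruence condition on \<open>\<surd>\<Delta>\<close> enters.\<close>

lemma gauss_coeff_0: "gauss_coeff (0, 0) = 0"
proof -
  obtain h where h: "k = 2 * h" "odd h" by (rule k_half)
  have G: "gauss_coeff (0, 0) = (\<Sum>m\<in>{0..<k}. \<Sum>n\<in>{0..<k}. qexp (m, n))"
    by (simp add: gauss_coeff_def qexp_def residues_def sum.cartesian_product)
  have "gauss_coeff (0, 0) = - gauss_coeff (0, 0)"
    using odd_A_or_C
  proof
    assume A: "odd A"
    have "(\<Sum>m\<in>{0..<k}. \<Sum>n\<in>{0..<k}. qexp (m, n)) = (\<Sum>m\<in>{0..<k}. \<Sum>n\<in>{0..<k}. qexp ((m + h) mod k, n))"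
      by (rule sum.reindex_bij_betw[OF bij_betw_add_mod, symmetric])
    also have "\<dots> = (\<Sum>m\<in>{0..<k}. \<Sum>n\<in>{0..<k}. - qexp (m, n))"
      using qexp_residue[of "_ + h"] qexp_half_shift(1)[OF h A] by (intro sum.cong refl) (metis qexp_residue mod_pos_pos_trivial atLeastLessThan_iff)
    finally show ?thesis unfolding G by (simp add: sum_negf)
  next
    assume C: "odd C"
    have "(\<Sum>n\<in>{0..<k}. qexp (m, n)) = (\<Sum>n\<in>{0..<k}. qexp (m, (n + h) mod k))" for m
      by (rule sum.reindex_bij_betw[OF bij_betw_add_mod, symmetric])
    then have "(\<Sum>m\<in>{0..<k}. \<Sum>n\<in>{0..<k}. qexp (m, n)) = (\<Sum>m\<in>{0..<k}. \<Sum>n\<in>{0..<k}. qexp (m, (n + h) mod k))"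
      by simp
    also have "\<dots> = (\<Sum>m\<in>{0..<k}. \<Sum>n\<in>{0..<k}. - qexp (m, n))"
      using qexp_half_shift(2)[OF h C] by (intro sum.cong refl) (metis qexp_residue mod_pos_pos_trivial atLeastLessThan_iff)
    finally show ?thesis unfolding G by (simp add: sum_negf)
  qed
  then show ?thesis by simp
qed

text \<open>At i + e the factor exp(-2 pi i q / k) depends only on u modulo k. Each residue class is
  a shifted theta series at t = k e, to which \<open>shifted_theta\<close> applies; its exponent 2
  pi / (k^2 t) becomes 2 pi / (k^3 e), and the phases summed over the classes form
  \<open>gauss_coeff\<close>.\<close>

lemma theta_cusp:
  assumes e: "Re e > 0"
  shows "theta (\<i> + e) = 1 / ((of_int k)\<^sup>2 * e) *
    (\<integral>v. gauss_coeff v * exp (- (1 / e) * of_real (2 * pi / (of_int k) ^ 3 * of_int (q v))) \<partial>count_space UNIV)"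
proof -
  define f where "f = (\<lambda>u. exp (- (\<i> + e) * of_real (2 * pi / of_int k * of_int (q u))))"
  define W where "W = (\<lambda>v. exp (- (1 / e) * of_real (2 * pi / (of_int k) ^ 3 * of_int (q v))))"
  have kc: "(of_int k :: complex) \<noteq> 0" using k_pos by simp
  have fi: "integrable (count_space UNIV) f"
    by (rule Bochner_Integration.integrable_bound[OF q_integrable'[OF e, of "2 * pi / of_int k"]])
       (use k_pos' in \<open>auto simp: f_def\<close>)
  have term_eq: "f (fst r + k * fst l, snd r + k * snd l) = qexp r *
     exp (- (of_int k * e) * of_real (2 * pi * quad_form A B C (of_int (fst l) + of_int (fst r) / of_int k) (of_int (snd l) + of_int (snd r) / of_int k)))" for r l
  proof -
    define u where "u = (fst r + k * fst l, snd r + k * snd l)"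
    have "real_of_int (q u) = (of_int k)\<^sup>2 * quad_form A B C (of_int (fst l) + of_int (fst r) / of_int k) (of_int (snd l) + of_int (snd r) / of_int k)"
      using k_pos' by (simp add: of_int_q u_def quad_form_def field_simps power2_eq_square)
    then have "complex_of_real (2 * pi / of_int k * of_int (q u)) * (- e) =
       - (of_int k * e) * of_real (2 * pi * quad_form A B C (of_int (fst l) + of_int (fst r) / of_int k) (of_int (snd l) + of_int (snd r) / of_int k))"
      using kc by (simp add: power2_eq_square)
    moreover have "f u = qexp u * exp (complex_of_real (2 * pi / of_int k * of_int (q u)) * (- e))"
      unfolding f_def qexp_def exp_add[symmetric]
      by (rule arg_cong[of _ _ exp]) (simp add: algebra_simps add_divide_distrib diff_divide_distrib)
    ultimately show ?thesis using qexp_periodic[of r "fst l" "snd l"] by (simp only: u_def)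
  qed
  have ek: "Re (of_int k * e) > 0" using e k_pos by simp
  have Wi: "integrable (count_space UNIV) W"
  proof -
    have "Re (1 / e) > 0" using e by (auto simp: Re_divide complex_eq_iff intro!: divide_pos_pos add_pos_nonneg)
    moreover have "Re (w * of_real y) = Re w * y" for w y by simp
    then have "norm (W v) = exp (- (Re (1 / e) * (2 * pi / (of_int k) ^ 3 * of_int (q v))))" for v
      by (simp only: W_def norm_exp_eq_Re uminus_complex.sel mult_minus_left)
    ultimately show ?thesis
      by (intro Bochner_Integration.integrable_bound[OF q_integrable'[of "Re (1 / e)" "2 * pi / (of_int k) ^ 3"]])
         (use k_pos' in auto)
  qed
  have "theta (\<i> + e) = (\<integral>u. f u \<partial>count_space UNIV)" by (simp add: theta_def f_def)
  also have "\<dots> = (\<Sum>r\<in>residues. \<integral>l. f (fst r + k * fst l, snd r + k * snd l) \<partial>count_space UNIV)"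
    by (rule sum_over_residues[OF fi])
  also have "\<dots> = (\<Sum>r\<in>residues. qexp r * (1 / (of_int k * e * of_int k) *
     (\<integral>v. exp (2 * pi * \<i> * of_real (of_int (snd v) * (of_int (fst r) / of_int k) - of_int (fst v) * (of_int (snd r) / of_int k))) *
               exp (- (1 / (of_int k * e)) * of_real (2 * pi / (of_int k)\<^sup>2 * of_int (q v)))
           \<partial>count_space UNIV)))"
    unfolding term_eq integral_mult_right_zero shifted_theta[OF ek] ..
  also have "\<dots> = (\<Sum>r\<in>residues. 1 / ((of_int k)\<^sup>2 * e) * (\<integral>v. qexp r * exp (2 * pi * \<i> * of_int (snd v * fst r - fst v * snd r) / of_int k) * W v \<partial>count_space UNIV))"
  proof (intro sum.cong refl)
    fix r assume "r \<in> residues"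
    have "exp (2 * pi * \<i> * of_real (of_int (snd v) * (of_int (fst r) / of_int k) - of_int (fst v) * (of_int (snd r) / of_int k))) *
               exp (- (1 / (of_int k * e)) * of_real (2 * pi / (of_int k)\<^sup>2 * of_int (q v)))
       = exp (2 * pi * \<i> * of_int (snd v * fst r - fst v * snd r) / of_int k) * W v" for v
      using k_pos by (simp add: W_def diff_divide_distrib power2_eq_square power3_eq_cube algebra_simps)
    then show "qexp r * (1 / (of_int k * e * of_int k) *
     (\<integral>v. exp (2 * pi * \<i> * of_real (of_int (snd v) * (of_int (fst r) / of_int k) - of_int (fst v) * (of_int (snd r) / of_int k))) *
               exp (- (1 / (of_int k * e)) * of_real (2 * pi / (of_int k)\<^sup>2 * of_int (q v)))
           \<partial>count_space UNIV)) = 1 / ((of_int k)\<^sup>2 * e) * (\<integral>v. qexp r * exp (2 * pi * \<i> * of_int (snd v * fst r - fst v * snd r) / of_int k) * W v \<partial>count_space UNIV)"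
      by (simp add: mult.assoc) (simp add: power2_eq_square mult_ac)
  qed
  also have "\<dots> = 1 / ((of_int k)\<^sup>2 * e) * (\<integral>v. (\<Sum>r\<in>residues. qexp r * exp (2 * pi * \<i> * of_int (snd v * fst r - fst v * snd r) / of_int k) * W v) \<partial>count_space UNIV)"
    unfolding sum_distrib_left[symmetric]
  proof (subst Bochner_Integration.integral_sum)
    fix r
    show "integrable (count_space UNIV) (\<lambda>v. qexp r * exp (2 * pi * \<i> * of_int (snd v * fst r - fst v * snd r) / of_int k) * W v)"
      by (rule Bochner_Integration.integrable_bound[OF Wi]) (auto simp: norm_mult qexp_def)
  qed simp
  also have "(\<lambda>v. \<Sum>r\<in>residues. qexp r * exp (2 * pi * \<i> * of_int (snd v * fst r - fst v * snd r) / of_int k) * W v) = (\<lambda>v. gauss_coeff v * W v)"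
    by (simp add: gauss_coeff_def qexp_def sum_distrib_right)
  finally show ?thesis by (simp only: W_def)
qed

section \<open>Decay of \<open>theta\<close> on the positive axis and at the cusp\<close>

definition psi :: "real \<Rightarrow> real" where
  "psi s = (\<integral>u. indicator (- {(0, 0)}) u * exp (- (s * (2 * pi / of_int k * of_int (q u)))) \<partial>count_space UNIV)"

lemma tail_integrable:
  "(s::real) > 0 \<Longrightarrow> r > 0 \<Longrightarrow> integrable (count_space UNIV) (\<lambda>u. indicator (- {(0, 0)}) u * exp (- (s * (r * of_int (q u)))) :: real)"
  by (rule Bochner_Integration.integrable_bound[OF q_integrable'[of s r]]) (auto simp: indicator_def)

text \<open>Away from the origin q is at least 1, so each unit of s beyond 1 gains a factor exp(-r).
  The scale r is left free: it is 2 pi / k on the positive axis and 2 pi / k^3 at the cusp.\<close>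

lemma tail_decay:
  assumes r: "r > 0" and s: "s \<ge> (1::real)"
  shows "(\<integral>u. indicator (- {(0, 0)}) u * exp (- (s * (r * of_int (q u)))) \<partial>count_space UNIV)
     \<le> exp (- r * (s - 1)) * (\<integral>u. indicator (- {(0, 0)}) u * exp (- (1 * (r * of_int (q u)))) \<partial>count_space UNIV)"
  unfolding integral_mult_right_zero[symmetric]
proof (rule integral_mono)
  fix u :: "int \<times> int"
  show "indicator (- {(0, 0)}) u * exp (- (s * (r * of_int (q u)))) \<le> exp (- r * (s - 1)) * (indicator (- {(0, 0)}) u * exp (- (1 * (r * of_int (q u)))))"
  proof (cases "u = (0, 0)")
    case False
    have "r * (s - 1) * 1 \<le> r * (s - 1) * of_int (q u)"
      using q_ge_1[OF False] r s by (intro mult_left_mono) auto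
    then have "- (s * (r * of_int (q u))) \<le> - r * (s - 1) + - (1 * (r * of_int (q u)))" by (simp add: algebra_simps)
    then show ?thesis using False by (simp add: exp_add[symmetric])
  qed simp
next
  show "integrable (count_space UNIV) (\<lambda>u. indicator (- {(0, 0)}) u * exp (- (s * (r * of_int (q u)))))"
    by (rule tail_integrable) (use r s in auto)
  show "integrable (count_space UNIV) (\<lambda>u. exp (- r * (s - 1)) * (indicator (- {(0, 0)}) u * exp (- (1 * (r * of_int (q u))))))"
    using tail_integrable[of 1 r] r by simp
qed

lemma theta_minus_1:
  assumes "Re x > 0"
  shows "theta x - 1 = (\<integral>u. indicator (- {(0, 0)}) u *\<^sub>R exp (- x * of_real (2 * pi / of_int k * of_int (q u))) \<partial>count_space UNIV)"
proof -
  let ?f = "\<lambda>u. exp (- x * of_real (2 * pi / of_int k * of_int (q u)))"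
  have fi: "integrable (count_space UNIV) ?f"
    by (rule Bochner_Integration.integrable_bound[OF q_integrable'[OF assms, of "2 * pi / of_int k"]])
       (use k_pos' in auto)
  have fi': "integrable (count_space UNIV) (\<lambda>u. indicator (- {(0, 0)}) u *\<^sub>R ?f u)"
    by (rule Bochner_Integration.integrable_bound[OF fi]) (auto simp: indicator_def)
  have fi'': "integrable (count_space UNIV) (\<lambda>u. indicator {(0, 0)} u *\<^sub>R ?f u)"
    by (rule Bochner_Integration.integrable_bound[OF fi]) (auto simp: indicator_def)
  have "theta x = (\<integral>u. indicator (- {(0, 0)}) u *\<^sub>R ?f u + indicator {(0, 0)} u *\<^sub>R ?f u \<partial>count_space UNIV)"
    unfolding theta_def by (intro Bochner_Integration.integral_cong) (auto simp: indicator_def)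
  also have "\<dots> = (\<integral>u. indicator (- {(0, 0)}) u *\<^sub>R ?f u \<partial>count_space UNIV) + (\<integral>u. indicator {(0, 0)} u *\<^sub>R ?f u \<partial>count_space UNIV)"
    by (rule Bochner_Integration.integral_add[OF fi' fi''])
  also have "(\<integral>u. indicator {(0, 0)} u *\<^sub>R ?f u \<partial>count_space UNIV) = infsetsum (\<lambda>u. indicator {(0, 0)} u *\<^sub>R ?f u) UNIV"
    by (simp add: infsetsum_def)
  also have "\<dots> = infsetsum ?f {(0, 0)}" by (rule infsetsum_cong_neutral) auto
  also have "\<dots> = 1" by (simp add: q_def)
  finally show ?thesis by simp
qed

lemma theta_psi_bound: "Re x > 0 \<Longrightarrow> norm (theta x - 1) \<le> psi (Re x)"
  unfolding theta_minus_1 psi_def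
  by (rule order_trans[OF integral_norm_bound]) (simp add: indicator_def if_distrib cong: if_cong)

lemma theta_of_real: "s > 0 \<Longrightarrow> theta (of_real s) = of_real (1 + psi s)"
proof -
  assume s: "s > 0"
  have "theta (of_real s) - 1 = (\<integral>u. complex_of_real (indicator (- {(0, 0)}) u * exp (- (s * (2 * pi / of_int k * of_int (q u))))) \<partial>count_space UNIV)"
    using s by (subst theta_minus_1) (auto simp: scaleR_conv_of_real exp_of_real[symmetric])
  also have "\<dots> = of_real (psi s)" unfolding psi_def by (rule integral_complex_of_real)
  finally show ?thesis by (simp add: algebra_simps)
qed

lemma psi_nonneg: "psi s \<ge> 0"
  unfolding psi_def by (rule integral_nonneg_AE) auto

lemma psi_exp_decay: "s \<ge> 1 \<Longrightarrow> psi s \<le> psi 1 * exp (- (2 * pi / of_int k) * (s - 1))"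
  unfolding psi_def using tail_decay[of "2 * pi / of_int k" s] k_pos' by (simp add: mult.commute)

text \<open>For s \<ge> 1 exponential decay is more than enough; for s < 1 the inversion formula
  equates s (1 + psi s) with 1 + psi (1 / s), which is bounded. Through
  \<open>theta_psi_bound\<close> this also controls \<open>theta\<close> off the real axis.\<close>

lemma psi_inverse_bound: "\<exists>K. \<forall>s>0. psi s \<le> K / s"
proof -
  define c where "c = 2 * pi / of_int k"
  have c: "c > 0" using k_pos' by (simp add: c_def)
  define K where "K = (1 + psi 1) + psi 1 * (exp c / c)"
  have "psi s \<le> K / s" if s: "s > 0" for s
  proof (cases "s \<ge> 1")
    case True
    have "psi s \<le> psi 1 * exp (- c * (s - 1))" using psi_exp_decay[OF True] by (simp add: c_def)
    also have "\<dots> = psi 1 * (exp c * exp (- (c * s)))" by (simp add: exp_add[symmetric] algebra_simps)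
    also have "exp (- (c * s)) \<le> 1 / (c * s)"
    proof -
      have "c * s \<le> exp (c * s)" using exp_ge_add_one_self[of "c * s"] by linarith
      then show ?thesis using c s by (simp add: exp_minus field_simps)
    qed
    also have "psi 1 * (exp c * (1 / (c * s))) = psi 1 * (exp c / c) / s" by simp
    also have "\<dots> \<le> K / s" unfolding K_def using s psi_nonneg[of 1] by (intro divide_right_mono) auto
    finally show ?thesis using psi_nonneg[of 1] by (simp add: mult_left_mono)
  next
    case False
    have "theta (1 / of_real s) = of_real s * theta (of_real s)" by (rule theta_inversion) (use s in simp)
    then have "complex_of_real (1 + psi (1 / s)) = of_real (s * (1 + psi s))"
      using theta_of_real[of s] theta_of_real[of "1 / s"] s by simp
    then have "1 + psi (1 / s) = s * (1 + psi s)" by (simp only: of_real_eq_iff)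
    moreover have "psi (1 / s) \<le> psi 1"
    proof -
      have "psi (1 / s) \<le> psi 1 * exp (- (2 * pi / of_int k) * (1 / s - 1))"
        by (rule psi_exp_decay) (use s False in simp)
      also have "\<dots> \<le> psi 1 * 1"
        using s False k_pos' psi_nonneg[of 1] by (intro mult_left_mono) (auto intro!: mult_nonneg_nonneg)
      finally show ?thesis by simp
    qed
    ultimately have "s * psi s \<le> 1 + psi 1" using s by (simp add: algebra_simps)
    also have "\<dots> \<le> K" using psi_nonneg[of 1] c by (simp add: K_def)
    finally show ?thesis using s by (simp add: field_simps)
  qed
  then show ?thesis by blast
qed

text \<open>The constant term of \<open>theta_cusp\<close> drops out by
  \<open>gauss_coeff_0\<close>, and \<open>tail_decay\<close> applies to the rest with s = Re (1/e).
  The exponent is kept exact, since the admissible region for z depends on it.\<close>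

lemma theta_cusp_bound:
  "\<exists>K. \<forall>e. Re e > 0 \<longrightarrow> Re (1 / e) \<ge> 1 \<longrightarrow> norm (theta (\<i> + e)) \<le> K / norm e * exp (- (2 * pi / (of_int k) ^ 3) * Re (1 / e))"
proof -
  define r where "r = 2 * pi / (real_of_int k) ^ 3"
  have r: "r > 0" using k_pos' by (simp add: r_def)
  define P where "P = (\<integral>u. indicator (- {(0, 0)}) u * exp (- (1 * (r * of_int (q u)))) \<partial>count_space UNIV)"
  have "norm (theta (\<i> + e)) \<le> (P * exp r) / norm e * exp (- r * Re (1 / e))" if e: "Re e > 0" and e1: "Re (1 / e) \<ge> 1" for e
  proof -
    let ?g = "\<lambda>v. gauss_coeff v * exp (- (1 / e) * of_real (r * of_int (q v)))"
    have "Re (w * of_real y) = Re w * y" for w y by simp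
    then have ne: "norm (exp (- (1 / e) * of_real (r * of_int (q v)))) = exp (- (Re (1 / e) * (r * of_int (q v))))" for v
      by (simp only: norm_exp_eq_Re uminus_complex.sel mult_minus_left)
    have "norm (\<integral>v. ?g v \<partial>count_space UNIV) \<le> (\<integral>v. norm (?g v) \<partial>count_space UNIV)"
      by (rule integral_norm_bound)
    also have "\<dots> \<le> (\<integral>v. (of_int k)\<^sup>2 * (indicator (- {(0, 0)}) v * exp (- (Re (1 / e) * (r * of_int (q v))))) \<partial>count_space UNIV)"
    proof (rule integral_mono')
      show "integrable (count_space UNIV) (\<lambda>v. (of_int k)\<^sup>2 * (indicator (- {(0, 0)}) v * exp (- (Re (1 / e) * (r * of_int (q v))))))"
        using tail_integrable[of "Re (1 / e)" r] r e1 by simp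
      show "norm (?g v) \<le> (of_int k)\<^sup>2 * (indicator (- {(0, 0)}) v * exp (- (Re (1 / e) * (r * of_int (q v)))))" for v
        unfolding norm_mult ne using gauss_coeff_bound[of v] by (cases "v = (0, 0)") (auto simp: gauss_coeff_0)
    qed auto
    also have "\<dots> \<le> (of_int k)\<^sup>2 * (exp (- r * (Re (1 / e) - 1)) * P)"
      unfolding integral_mult_right_zero P_def by (intro mult_left_mono tail_decay r e1) auto
    finally have "norm (\<integral>v. ?g v \<partial>count_space UNIV) \<le> (of_int k)\<^sup>2 * (exp (- r * (Re (1 / e) - 1)) * P)" .
    moreover have "norm (theta (\<i> + e)) = 1 / ((of_int k)\<^sup>2 * norm e) * norm (\<integral>v. ?g v \<partial>count_space UNIV)"
      unfolding theta_cusp[OF e] r_def by (simp add: norm_mult norm_divide norm_power)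
    ultimately have "norm (theta (\<i> + e)) \<le> 1 / ((of_int k)\<^sup>2 * norm e) * ((of_int k)\<^sup>2 * (exp (- r * (Re (1 / e) - 1)) * P))"
      by (simp only:) (rule mult_left_mono, auto)
    also have "\<dots> = (exp (- r * (Re (1 / e) - 1)) * P) / norm e" using k_pos by simp
    also have "exp (- r * (Re (1 / e) - 1)) = exp r * exp (- r * Re (1 / e))"
      by (simp add: exp_add[symmetric] algebra_simps)
    finally show ?thesis by (simp add: mult_ac)
  qed
  then show ?thesis unfolding r_def by blast
qed

end

section \<open>Fourier transform of the theta function\<close>

lemma integrable_exp_abs:
  fixes c :: real
  assumes c: "c > 0"
  shows "integrable lborel (\<lambda>u. exp (- c * \<bar>u\<bar>))"
proof -
  have 1: "integrable lborel (\<lambda>u. indicator {0<..} u *\<^sub>R exp (- (u * c)))"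
    using integrable_I0i_exp_mscale[OF c] by (simp add: set_integrable_def)
  have 2: "integrable lborel (\<lambda>u. indicator {0<..} (- u) *\<^sub>R exp (- ((- u) * c)))"
    using lborel_integrable_real_affine[OF 1, of "-1" 0] by simp
  have 3: "integrable lborel (\<lambda>u::real. indicator {0} u :: real)" by (rule integrable_real_indicator) auto
  have "integrable lborel (\<lambda>u. indicator {0<..} u *\<^sub>R exp (- (u * c)) + indicator {0<..} (- u) *\<^sub>R exp (- ((- u) * c)) + indicator {0} u)"
    by (intro Bochner_Integration.integrable_add 1 2 3)
  also have "(\<lambda>u. indicator {0<..} u *\<^sub>R exp (- (u * c)) + indicator {0<..} (- u) *\<^sub>R exp (- ((- u) * c)) + indicator {0} u) = (\<lambda>u. exp (- c * \<bar>u\<bar>))"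
    by (auto simp: fun_eq_iff indicator_def abs_if mult.commute)
  finally show ?thesis .
qed

text \<open>Gaussian summation: a factor exp(- pi s t^2) is inserted, Fubini turns the double
  integral into an average of f against a Gaussian of width of order sqrt s, and s tends to 0. The
  value at 0 is enough, as other points are reached by translating f.\<close>

lemma fourier_inversion_at_0:
  fixes f :: "real \<Rightarrow> complex"
  assumes cont: "continuous_on UNIV f" and bd: "\<And>u. norm (f u) \<le> K" and int: "integrable lborel f"
    and inth: "integrable lborel (\<lambda>t. \<integral>u. exp (\<i> * of_real (t * u)) * f u \<partial>lborel)"
  shows "(\<integral>t. (\<integral>u. exp (\<i> * of_real (t * u)) * f u \<partial>lborel) \<partial>lborel) = 2 * pi * f 0"
proof -
  define fh where "fh = (\<lambda>t. \<integral>u. exp (\<i> * of_real (t * u)) * f u \<partial>lborel)"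
  have [measurable]: "f \<in> borel_measurable borel" using cont by (rule borel_measurable_continuous_onI)
  have fhm[measurable]: "fh \<in> borel_measurable lborel" using inth unfolding fh_def by (rule borel_measurable_integrable)
  have K: "K \<ge> 0" using bd[of 0] norm_ge_zero order_trans by blast
  define s where "s = (\<lambda>n. 1 / real (Suc n))"
  have s: "s n > 0" "s \<longlonglongrightarrow> 0" for n
    unfolding s_def by (simp, rule LIMSEQ_Suc[OF lim_const_over_n])
  define G where "G = (\<lambda>n t. complex_of_real (exp (- (pi * s n * t\<^sup>2))))"
  have A1: "(\<lambda>n. \<integral>t. G n t * fh t \<partial>lborel) \<longlonglongrightarrow> (\<integral>t. fh t \<partial>lborel)"
  proof (rule integral_dominated_convergence)
    show "integrable lborel (\<lambda>t. norm (fh t))" using inth by (simp add: fh_def)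
    show "AE t in lborel. (\<lambda>n. G n t * fh t) \<longlonglongrightarrow> fh t"
    proof (rule AE_I2)
      fix t
      have "(\<lambda>n. G n t * fh t) \<longlonglongrightarrow> complex_of_real (exp (- (pi * 0 * t\<^sup>2))) * fh t"
        unfolding G_def by (intro tendsto_intros s)
      then show "(\<lambda>n. G n t * fh t) \<longlonglongrightarrow> fh t" by simp
    qed
    show "AE t in lborel. norm (G n t * fh t) \<le> norm (fh t)" for n
      using s(1)[of n] by (auto simp: G_def norm_mult intro!: AE_I2 mult_left_le_one_le)
  qed (auto simp: G_def)
  have A2: "(\<integral>t. G n t * fh t \<partial>lborel) = (\<integral>v. of_real (exp (- (v\<^sup>2 / (4 * pi)))) * f (sqrt (s n) * v) \<partial>lborel)" for n
  proof -
    define H where "H = (\<lambda>t u. G n t * (exp (\<i> * of_real (t * u)) * f u))"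
    have Gi: "integrable lborel (\<lambda>t. exp (- (pi * s n * t\<^sup>2)))"
      using integrable_norm[OF gauss_fourier(1)[OF s(1)[of n], of 0]] by simp
    have Hint: "integrable (lborel \<Otimes>\<^sub>M lborel) (case_prod H)"
    proof (rule lborel_pair.Fubini_integrable)
      show "case_prod H \<in> borel_measurable (lborel \<Otimes>\<^sub>M lborel)"
        unfolding H_def G_def by measurable
      have "(\<integral>u. norm (case_prod H (t, u)) \<partial>lborel) = exp (- (pi * s n * t\<^sup>2)) * (\<integral>u. norm (f u) \<partial>lborel)" for t
        by (simp add: H_def G_def norm_mult)
      then show "integrable lborel (\<lambda>t. \<integral>u. norm (case_prod H (t, u)) \<partial>lborel)"
        using Gi by simp
      show "AE t in lborel. integrable lborel (\<lambda>u. case_prod H (t, u))"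
        using s(1)[of n] by (auto simp: H_def G_def norm_mult intro!: AE_I2 Bochner_Integration.integrable_bound[OF int] mult_left_le_one_le)
    qed
    have "(\<integral>t. G n t * fh t \<partial>lborel) = (\<integral>t. (\<integral>u. H t u \<partial>lborel) \<partial>lborel)"
      by (simp add: H_def fh_def)
    also have "\<dots> = (\<integral>u. (\<integral>t. H t u \<partial>lborel) \<partial>lborel)"
      by (rule lborel_pair.Fubini_integral[OF Hint, symmetric])
    also have "\<dots> = (\<integral>u. of_real (1 / sqrt (s n) * exp (- (u\<^sup>2 / (4 * pi * s n)))) * f u \<partial>lborel)"
    proof (intro Bochner_Integration.integral_cong refl)
      fix u
      have "(\<integral>t. H t u \<partial>lborel) = (\<integral>t. exp (- of_real (pi * s n * t\<^sup>2) + 2 * pi * \<i> * of_real (u / (2 * pi)) * of_real t) \<partial>lborel) * f u"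
      proof -
        have "2 * pi * \<i> * of_real (u / (2 * pi)) * of_real t = \<i> * of_real (t * u)" for t by simp
        then have "H t u = exp (- of_real (pi * s n * t\<^sup>2) + 2 * pi * \<i> * of_real (u / (2 * pi)) * of_real t) * f u" for t
          by (simp only: H_def G_def exp_add exp_of_real[symmetric] of_real_minus mult.assoc)
        then show ?thesis by (simp only: integral_mult_left_zero)
      qed
      also have "\<dots> = of_real (1 / sqrt (s n) * exp (- (u\<^sup>2 / (4 * pi * s n)))) * f u"
        unfolding gauss_fourier(2)[OF s(1)] by (simp add: power_divide power2_eq_square)
      finally show "(\<integral>t. H t u \<partial>lborel) = of_real (1 / sqrt (s n) * exp (- (u\<^sup>2 / (4 * pi * s n)))) * f u" .
    qed
    also have "\<dots> = sqrt (s n) *\<^sub>R (\<integral>v. of_real (1 / sqrt (s n) * exp (- ((0 + sqrt (s n) * v)\<^sup>2 / (4 * pi * s n)))) * f (0 + sqrt (s n) * v) \<partial>lborel)"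
      using s(1)[of n] by (subst lborel_integral_real_affine[of "sqrt (s n)" _ 0]) auto
    also have "\<dots> = (\<integral>v. of_real (exp (- (v\<^sup>2 / (4 * pi)))) * f (sqrt (s n) * v) \<partial>lborel)"
      unfolding integral_scaleR_right[symmetric]
      by (intro Bochner_Integration.integral_cong refl) (use s(1)[of n] in \<open>simp add: scaleR_conv_of_real power_mult_distrib\<close>)
    finally show ?thesis .
  qed
  \<comment> \<open>After rescaling, the Gaussian no longer depends on n; its mass 2 pi is the
    constant of the inversion formula.\<close>
  define P where "P = (\<lambda>v::real. exp (- (v\<^sup>2 / (4 * pi))))"
  have P: "integrable lborel P" "(\<integral>v. complex_of_real (P v) \<partial>lborel) = 2 * pi"
  proof -
    have s0: "(1 / (4 * pi\<^sup>2) :: real) > 0" by simp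
    have e: "exp (- of_real (pi * (1 / (4 * pi\<^sup>2)) * v\<^sup>2) + 2 * pi * \<i> * of_real 0 * of_real v) = complex_of_real (P v)" for v
      by (simp add: P_def exp_of_real[symmetric] power2_eq_square)
    have sq: "sqrt (1 / (4 * pi\<^sup>2)) = 1 / (2 * pi)" by (simp add: real_sqrt_divide real_sqrt_mult)
    show "integrable lborel P" using integrable_norm[OF gauss_fourier(1)[OF s0, of 0]] unfolding e by (simp add: P_def)
    show "(\<integral>v. complex_of_real (P v) \<partial>lborel) = 2 * pi"
      using gauss_fourier(2)[OF s0, of 0] unfolding e sq by simp
  qed
  have A3: "(\<lambda>n. \<integral>v. of_real (P v) * f (sqrt (s n) * v) \<partial>lborel) \<longlonglongrightarrow> (\<integral>v. of_real (P v) * f 0 \<partial>lborel)"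
  proof (rule integral_dominated_convergence)
    show "integrable lborel (\<lambda>v. P v * K)" using P(1) by simp
    show "AE v in lborel. (\<lambda>n. of_real (P v) * f (sqrt (s n) * v)) \<longlonglongrightarrow> of_real (P v) * f 0"
    proof (rule AE_I2)
      fix v
      have "(\<lambda>n. sqrt (s n) * v) \<longlonglongrightarrow> sqrt 0 * v" by (intro tendsto_intros s)
      then have "(\<lambda>n. sqrt (s n) * v) \<longlonglongrightarrow> 0" by simp
      moreover have "isCont f 0" using cont by (simp add: continuous_on_eq_continuous_at)
      ultimately show "(\<lambda>n. of_real (P v) * f (sqrt (s n) * v)) \<longlonglongrightarrow> of_real (P v) * f 0"
        by (intro tendsto_intros) (rule isCont_tendsto_compose)
    qed
    show "AE v in lborel. norm (of_real (P v) * f (sqrt (s n) * v)) \<le> P v * K" for n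
      using bd by (auto simp: P_def norm_mult intro!: AE_I2 mult_left_mono)
  qed (auto simp: P_def)
  have "(\<integral>t. fh t \<partial>lborel) = (\<integral>v. of_real (P v) * f 0 \<partial>lborel)"
    using A1 A3 unfolding A2 P_def by (rule LIMSEQ_unique)
  also have "\<dots> = 2 * pi * f 0" using P(2) by simp
  finally show ?thesis by (simp add: fh_def)
qed

text \<open>The strip around the real line that exp maps onto the right half-plane, the domain of
  \<open>theta\<close>.\<close>

definition strip :: "complex set" where "strip = {u. \<bar>Im u\<bar> < pi / 2}"

lemma strip_open: "open strip" and strip_connected: "connected strip"
proof -
  have eq: "strip = {u. Im u < pi / 2} \<inter> {u. Im u > - (pi / 2)}" by (auto simp: strip_def)
  show "open strip" unfolding eq by (intro open_Int open_halfspace_Im_lt open_halfspace_Im_gt)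
  show "connected strip" unfolding eq
    by (intro convex_connected convex_Int convex_halfspace_Im_lt convex_halfspace_Im_gt)
qed

lemma of_real_in_strip [simp]: "of_real u \<in> strip" by (simp add: strip_def)

lemma Re_exp_strip: "u \<in> strip \<Longrightarrow> Re (exp u) > 0"
  using cos_gt_zero_pi[of "Im u"] by (auto simp: strip_def Re_exp abs_less_iff)

section \<open>The Mellin integrand on the critical line and its Fourier transform\<close>

context epstein_form begin

text \<open>In x = exp u this is the Mellin integrand x^(1/2) theta(x) with x^(1/2) + x^(-1/2) taken
  away. These two terms are responsible for the poles at 0 and 1; without them the function is even
  and decays like exp(-|u| / 2) at both ends.\<close>

definition gs :: "complex \<Rightarrow> complex" where
  "gs u = exp (u / 2) * (theta (exp u) - 1) - exp (- (u / 2))"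

lemma gs_holomorphic: "gs holomorphic_on strip"
proof -
  have "(theta \<circ> exp) holomorphic_on strip"
    by (rule holomorphic_on_compose_gen[OF _ theta_holomorphic]) (auto intro!: holomorphic_intros Re_exp_strip)
  then show ?thesis unfolding gs_def[abs_def] o_def by (auto intro!: holomorphic_intros)
qed

lemma gs_even: assumes "u \<in> strip" shows "gs (- u) = gs u"
proof -
  have 1: "theta (exp (- u)) = exp u * theta (exp u)"
    using theta_inversion[OF Re_exp_strip[OF assms]] by (simp add: exp_minus field_simps)
  have 2: "exp u = exp (u / 2) * exp (u / 2)" "exp (- (u / 2)) * exp (u / 2) = 1" by (simp_all add: exp_add[symmetric])
  have "gs (- u) = exp (- (u / 2)) * exp (u / 2) * exp (u / 2) * theta (exp u) - exp (- (u / 2)) - exp (u / 2)"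
    unfolding gs_def 1 by (subst 2(1)) (simp add: algebra_simps)
  then show ?thesis unfolding 2(2) by (simp add: gs_def algebra_simps)
qed

text \<open>In the closed strip Re (exp u) is at least exp(Re u) cos a, so
  \<open>psi_inverse_bound\<close> gives the decay for Re u \<ge> 0, and evenness gives the other
  half. The constant involves 1 / cos a, hence the restriction to closed substrips.\<close>

lemma gs_bound:
  assumes a: "0 \<le> a" "a < pi / 2"
  shows "\<exists>K>0. \<forall>u. \<bar>Im u\<bar> \<le> a \<longrightarrow> norm (gs u) \<le> K * exp (- \<bar>Re u\<bar> / 2)"
proof -
  obtain K0 where K0: "\<And>s. s > 0 \<Longrightarrow> psi s \<le> K0 / s" using psi_inverse_bound by blast
  have K0': "K0 \<ge> 0" using K0[of 1] psi_nonneg[of 1] by simp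
  have ca: "cos a > 0" using a by (intro cos_gt_zero_pi) auto
  define K where "K = K0 / cos a + 1"
  have pos: "norm (gs u) \<le> K * exp (- \<bar>Re u\<bar> / 2)" if u: "\<bar>Im u\<bar> \<le> a" "Re u \<ge> 0" for u
  proof -
    have us: "u \<in> strip" using u a by (auto simp: strip_def)
    have cu: "cos a \<le> cos (Im u)"
      using cos_monotone_0_pi_le[of "\<bar>Im u\<bar>" a] u a by simp
    have "norm (theta (exp u) - 1) \<le> K0 / Re (exp u)"
      using theta_psi_bound[OF Re_exp_strip[OF us]] K0[OF Re_exp_strip[OF us]] by linarith
    also have "\<dots> \<le> K0 / (exp (Re u) * cos a)"
      unfolding Re_exp using K0' ca cu by (intro divide_left_mono mult_left_mono mult_pos_pos) auto
    finally have th: "norm (theta (exp u) - 1) \<le> K0 / (exp (Re u) * cos a)" .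
    have "norm (gs u) \<le> norm (exp (u / 2)) * norm (theta (exp u) - 1) + norm (exp (- (u / 2)))"
      unfolding gs_def norm_mult[symmetric] by (rule norm_triangle_ineq4)
    also have "\<dots> \<le> exp (Re u / 2) * (K0 / (exp (Re u) * cos a)) + exp (- (Re u / 2))"
    proof -
      have n: "norm (exp (u / 2)) = exp (Re u / 2)" "norm (exp (- (u / 2))) = exp (- (Re u / 2))" by simp_all
      show ?thesis unfolding n using th by (intro add_right_mono mult_left_mono) auto
    qed
    also have "exp (Re u / 2) * (K0 / (exp (Re u) * cos a)) = K0 / cos a * exp (- (Re u / 2))"
    proof -
      have "exp (Re u) = exp (Re u / 2) * exp (Re u / 2)" by (simp add: exp_add[symmetric])
      then show ?thesis by (simp add: exp_minus field_simps)
    qed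
    finally show ?thesis using u(2) by (simp add: K_def algebra_simps)
  qed
  have "norm (gs u) \<le> K * exp (- \<bar>Re u\<bar> / 2)" if u: "\<bar>Im u\<bar> \<le> a" for u
  proof (cases "Re u \<ge> 0")
    case False
    have "u \<in> strip" using u a by (auto simp: strip_def)
    then show ?thesis using pos[of "- u"] u False gs_even[of u] by simp
  qed (use pos u in auto)
  moreover have "K > 0" using K0' ca by (simp add: K_def add_nonneg_pos)
  ultimately show ?thesis by blast
qed

lemma gs_shift_bound:
  assumes "w \<in> strip"
  shows "\<exists>K>0. \<forall>u. norm (gs (of_real u + w)) \<le> K * exp (- (1/2) * \<bar>u\<bar>)"
proof -
  obtain K where K: "K > 0" "\<And>u. \<bar>Im u\<bar> \<le> \<bar>Im w\<bar> \<Longrightarrow> norm (gs u) \<le> K * exp (- \<bar>Re u\<bar> / 2)"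
    using gs_bound[of "\<bar>Im w\<bar>"] assms by (auto simp: strip_def)
  have "norm (gs (of_real u + w)) \<le> K * exp (\<bar>Re w\<bar> / 2) * exp (- (1/2) * \<bar>u\<bar>)" for u
  proof -
    have "norm (gs (of_real u + w)) \<le> K * exp (- \<bar>u + Re w\<bar> / 2)" using K(2)[of "of_real u + w"] by simp
    also have "\<dots> \<le> K * exp (\<bar>Re w\<bar> / 2 + - (1/2) * \<bar>u\<bar>)"
      using abs_triangle_ineq[of "u + Re w" "- Re w"] K(1) by (intro mult_left_mono exp_le_cancel_iff[THEN iffD2]) (auto simp: field_simps)
    finally show ?thesis by (simp only: exp_add mult.assoc)
  qed
  then show ?thesis using K(1) by (intro exI[of _ "K * exp (\<bar>Re w\<bar> / 2)"]) auto
qed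

lemma gs_continuous: "w \<in> strip \<Longrightarrow> continuous_on UNIV (\<lambda>u::real. gs (of_real u + w))"
  by (rule continuous_on_compose2[OF holomorphic_on_imp_continuous_on[OF gs_holomorphic]])
     (auto intro!: continuous_intros simp: strip_def)

lemma gs_measurable [measurable]: "w \<in> strip \<Longrightarrow> (\<lambda>u::real. gs (of_real u + w)) \<in> borel_measurable borel"
  by (rule borel_measurable_continuous_onI[OF gs_continuous])

lemma gs_integrable:
  assumes "w \<in> strip"
  shows "integrable lborel (\<lambda>u::real. gs (of_real u + w))"
proof -
  obtain K where K: "\<And>u. norm (gs (of_real u + w)) \<le> K * exp (- (1/2) * \<bar>u\<bar>)" using gs_shift_bound[OF assms] by blast
  show ?thesis
    by (rule Bochner_Integration.integrable_bound[OF integrable_mult_right[OF integrable_exp_abs[of "1/2"], of K]])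
       (use K gs_measurable[OF assms] in \<open>auto intro!: AE_I2 order_trans[OF K]\<close>)
qed

text \<open>The completed zeta function at 1/2 + i t, as \<open>epstein_zeta_critical\<close> shows.
  Taking the Fourier integral as the definition makes decay and inversion available before any
  continuation is discussed.\<close>

definition Lc :: "real \<Rightarrow> complex" where
  "Lc t = (\<integral>u. exp (\<i> * of_real (t * u)) * gs (of_real u) \<partial>lborel)"

text \<open>A contour shift by analytic continuation in the shift: the left side is holomorphic in
  w, and for real w it is constant by translation invariance, hence constant on the strip.\<close>

lemma Lc_shift:
  assumes "w \<in> strip"
  shows "(\<integral>u. exp (\<i> * of_real t * (of_real u + w)) * gs (of_real u + w) \<partial>lborel) = Lc t"
proof -
  define h where "h = (\<lambda>w. \<integral>u. exp (\<i> * of_real t * (of_real u + w)) * gs (of_real u + w) \<partial>lborel)"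
  have "h holomorphic_on strip" unfolding h_def
  proof (rule holomorphic_on_lebesgue_integral)
    show "open strip" by (rule strip_open)
    fix u :: real
    have "(gs \<circ> (\<lambda>w. of_real u + w)) holomorphic_on strip"
      by (rule holomorphic_on_compose_gen[OF _ gs_holomorphic]) (auto intro!: holomorphic_intros simp: strip_def)
    then show "(\<lambda>w. exp (\<i> * of_real t * (of_real u + w)) * gs (of_real u + w)) holomorphic_on strip"
      unfolding o_def by (intro holomorphic_intros)
  next
    fix w assume "w \<in> strip"
    then show "(\<lambda>u. exp (\<i> * of_real t * (of_real u + w)) * gs (of_real u + w)) \<in> borel_measurable lborel"
      by measurable
    define r where "r = (pi / 2 - \<bar>Im w\<bar>) / 2"
    define a where "a = (pi / 2 + \<bar>Im w\<bar>) / 2"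
    have r: "r > 0" and a: "0 \<le> a" "a < pi / 2" and ra: "\<bar>Im w\<bar> + r \<le> a"
      using \<open>w \<in> strip\<close> by (auto simp: r_def a_def strip_def field_simps)
    obtain K where K: "K > 0" "\<And>u. \<bar>Im u\<bar> \<le> a \<Longrightarrow> norm (gs u) \<le> K * exp (- \<bar>Re u\<bar> / 2)"
      using gs_bound[OF a] by blast
    show "\<exists>r>0. \<exists>D. integrable lborel D \<and> (\<forall>u\<in>space lborel. \<forall>z\<in>strip \<inter> cball w r.
        norm (exp (\<i> * of_real t * (of_real u + z)) * gs (of_real u + z)) \<le> D u)"
    proof (intro exI conjI ballI)
      show "r > 0" by (rule r)
      show "integrable lborel (\<lambda>u. exp (\<bar>t\<bar> * a) * (K * (exp ((norm w + r) / 2) * exp (- (1/2) * \<bar>u\<bar>))))"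
        by (intro integrable_mult_right integrable_exp_abs) simp
      fix u :: real and z assume z: "z \<in> strip \<inter> cball w r"
      have dz: "norm (z - w) \<le> r" using z by (simp add: dist_norm norm_minus_commute)
      have iz: "\<bar>Im z\<bar> \<le> a" using ra abs_Im_le_cmod[of "z - w"] dz by auto
      have rz: "\<bar>Re z\<bar> \<le> norm w + r" using abs_Re_le_cmod[of z] norm_triangle_sub[of z w] dz by linarith
      have "norm (exp (\<i> * of_real t * (of_real u + z))) \<le> exp (\<bar>t\<bar> * a)"
      proof -
        have "- (t * Im z) \<le> \<bar>t\<bar> * a"
          using mult_left_mono[OF iz, of "\<bar>t\<bar>"] abs_ge_minus_self[of "t * Im z"] by (simp add: abs_mult)
        then show ?thesis by simp
      qed
      moreover have "norm (gs (of_real u + z)) \<le> K * (exp ((norm w + r) / 2) * exp (- (1/2) * \<bar>u\<bar>))"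
      proof -
        have "norm (gs (of_real u + z)) \<le> K * exp (- \<bar>u + Re z\<bar> / 2)" using K(2)[of "of_real u + z"] iz by simp
        also have "\<dots> \<le> K * exp ((norm w + r) / 2 + - (1/2) * \<bar>u\<bar>)"
          using rz abs_triangle_ineq[of "u + Re z" "- Re z"] K(1) by (intro mult_left_mono exp_le_cancel_iff[THEN iffD2]) (auto simp: field_simps)
        finally show ?thesis by (simp only: exp_add)
      qed
      ultimately show "norm (exp (\<i> * of_real t * (of_real u + z)) * gs (of_real u + z)) \<le> exp (\<bar>t\<bar> * a) * (K * (exp ((norm w + r) / 2) * exp (- (1/2) * \<bar>u\<bar>)))"
        unfolding norm_mult by (intro mult_mono) auto
    qed
  qed
  then have h1: "h holomorphic_on strip" .
  have h2: "h (of_real y) = Lc t" for y :: real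
    using lborel_integral_real_affine[of 1 "\<lambda>u. exp (\<i> * of_real (t * u)) * gs (of_real u)" y]
    by (simp add: h_def Lc_def algebra_simps)
  have "h w = Lc t"
    by (rule holomorphic_eq_from_reals[OF h1 _ strip_open strip_connected of_real_in_strip[of 0] _ assms])
       (use h2 in \<open>auto intro!: holomorphic_intros\<close>)
  then show ?thesis by (simp add: h_def)
qed

text \<open>Shifting the line of integration by i a or - i a extracts exp(- a t) or exp(a t), one
  for each sign of t. Every a below pi / 2 is admissible, which is why weights exp((pi / 2 - b) t)
  with b > 0 can be used later.\<close>

lemma Lc_bound:
  assumes a: "0 \<le> a" "a < pi / 2"
  shows "\<exists>K>0. \<forall>t. norm (Lc t) \<le> K * exp (- a * \<bar>t\<bar>)"
proof -
  have bd: "\<exists>K>0. \<forall>t. norm (Lc t) \<le> K * exp (- a * (e * t))" if e: "e = 1 \<or> e = -1" for e :: real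
  proof -
    define w where "w = \<i> * of_real (a * e)"
    have w: "w \<in> strip" using a e by (auto simp: w_def strip_def)
    define K where "K = (\<integral>u. norm (gs (of_real u + w)) \<partial>lborel)"
    have "norm (Lc t) \<le> K * exp (- a * (e * t))" for t
    proof -
      have "norm (exp (\<i> * of_real t * (of_real u + w)) * gs (of_real u + w)) = exp (- a * (e * t)) * norm (gs (of_real u + w))" for u
        by (simp add: norm_mult w_def mult_ac)
      then show ?thesis
        unfolding Lc_shift[OF w, symmetric] K_def
        using integral_norm_bound[of lborel "\<lambda>u. exp (\<i> * of_real t * (of_real u + w)) * gs (of_real u + w)"]
        by (simp add: mult.commute)
    qed
    moreover have "K \<ge> 0" unfolding K_def by simp
    ultimately show ?thesis by (intro exI[of _ "K + 1"]) (smt (verit) exp_gt_zero mult_right_mono)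
  qed
  obtain K1 where K1: "K1 > 0" "\<And>t. norm (Lc t) \<le> K1 * exp (- a * (1 * t))" using bd[of 1] by blast
  obtain K2 where K2: "K2 > 0" "\<And>t. norm (Lc t) \<le> K2 * exp (- a * (-1 * t))" using bd[of "-1"] by blast
  have "norm (Lc t) \<le> max K1 K2 * exp (- a * \<bar>t\<bar>)" for t
  proof (cases "t \<ge> 0")
    case True
    have "norm (Lc t) \<le> K1 * exp (- a * \<bar>t\<bar>)" using K1(2)[of t] True by simp
    also have "\<dots> \<le> max K1 K2 * exp (- a * \<bar>t\<bar>)" by (intro mult_right_mono) auto
    finally show ?thesis .
  next
    case False
    have "norm (Lc t) \<le> K2 * exp (- a * \<bar>t\<bar>)" using K2(2)[of t] False by simp
    also have "\<dots> \<le> max K1 K2 * exp (- a * \<bar>t\<bar>)" by (intro mult_right_mono) auto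
    finally show ?thesis .
  qed
  then show ?thesis using K1(1) by (intro exI[of _ "max K1 K2"]) auto
qed

lemma gs_of_real_meas [measurable]: "(\<lambda>u::real. gs (of_real u)) \<in> borel_measurable borel"
  using gs_measurable[of 0] of_real_in_strip[of 0] by simp

lemma gs_of_real_int: "integrable lborel (\<lambda>u::real. gs (of_real u))"
  using gs_integrable[of 0] of_real_in_strip[of 0] by simp

lemma Lc_continuous: "continuous_on UNIV Lc"
proof -
  have "isCont Lc t" for t
    unfolding continuous_at_sequentially o_def
  proof (intro allI impI)
    fix X assume X: "X \<longlonglongrightarrow> t"
    show "(\<lambda>n. Lc (X n)) \<longlonglongrightarrow> Lc t" unfolding Lc_def
    proof (rule integral_dominated_convergence)
      show "integrable lborel (\<lambda>u. norm (gs (of_real u)))" using gs_of_real_int by simp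
      show "AE u in lborel. (\<lambda>n. exp (\<i> * of_real (X n * u)) * gs (of_real u)) \<longlonglongrightarrow> exp (\<i> * of_real (t * u)) * gs (of_real u)"
        by (intro AE_I2 tendsto_intros X)
    qed (auto simp: norm_mult)
  qed
  then show ?thesis by (simp add: continuous_on_eq_continuous_at)
qed

lemma Lc_measurable [measurable]: "Lc \<in> borel_measurable borel"
  by (rule borel_measurable_continuous_onI[OF Lc_continuous])

lemma gs_cnj: "cnj (gs (of_real u)) = gs (of_real u)"
proof -
  have "theta (exp (of_real u)) = of_real (1 + psi (exp u))"
    using theta_of_real[of "exp u"] by (simp add: exp_of_real)
  then show ?thesis by (simp add: gs_def exp_cnj)
qed

text \<open>The function \<open>gs\<close> is real and even on the real axis.\<close>

lemma Lc_real: "cnj (Lc t) = Lc t"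
proof -
  have "cnj (Lc t) = (\<integral>u. cnj (exp (\<i> * of_real (t * u)) * gs (of_real u)) \<partial>lborel)"
    unfolding Lc_def by (rule Bochner_Integration.integral_cnj[symmetric])
  also have "\<dots> = (\<integral>u. exp (\<i> * of_real (t * (- u))) * gs (of_real (- u)) \<partial>lborel)"
    using gs_even[OF of_real_in_strip] by (simp add: gs_cnj exp_cnj)
  also have "\<dots> = Lc t"
    using lborel_integral_real_affine[of "-1" "\<lambda>u. exp (\<i> * of_real (t * u)) * gs (of_real u)" 0]
    by (simp add: Lc_def)
  finally show ?thesis .
qed

lemma Lc_weighted_integrable:
  assumes "\<bar>Im w\<bar> < pi / 2"
  shows "integrable lborel (\<lambda>t. Lc t * exp (- \<i> * of_real t * w))"
proof -
  define a where "a = (pi / 2 + \<bar>Im w\<bar>) / 2"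
  have a: "0 \<le> a" "a < pi / 2" "a - \<bar>Im w\<bar> > 0" using assms by (auto simp: a_def field_simps)
  obtain K where K: "K > 0" "\<And>t. norm (Lc t) \<le> K * exp (- a * \<bar>t\<bar>)" using Lc_bound[OF a(1,2)] by blast
  show ?thesis
  proof (rule Bochner_Integration.integrable_bound[OF integrable_mult_right[OF integrable_exp_abs[OF a(3)], of K]])
    show "AE t in lborel. norm (Lc t * exp (- \<i> * of_real t * w)) \<le> norm (K * exp (- (a - \<bar>Im w\<bar>) * \<bar>t\<bar>))"
    proof (rule AE_I2)
      fix t
      have "t * Im w \<le> \<bar>Im w\<bar> * \<bar>t\<bar>"
        using abs_ge_self[of "t * Im w"] by (simp only: abs_mult mult.commute)
      then have "norm (Lc t * exp (- \<i> * of_real t * w)) \<le> (K * exp (- a * \<bar>t\<bar>)) * exp (\<bar>Im w\<bar> * \<bar>t\<bar>)"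
        unfolding norm_mult using K by (intro mult_mono) auto
      also have "\<dots> = K * exp (- (a - \<bar>Im w\<bar>) * \<bar>t\<bar>)"
        unfolding mult.assoc exp_add[symmetric] by (simp add: algebra_simps)
      also have "\<dots> \<le> norm (K * exp (- (a - \<bar>Im w\<bar>) * \<bar>t\<bar>))" unfolding real_norm_def by (rule abs_ge_self)
      finally show "norm (Lc t * exp (- \<i> * of_real t * w)) \<le> norm (K * exp (- (a - \<bar>Im w\<bar>) * \<bar>t\<bar>))" .
    qed
    have "continuous_on UNIV (\<lambda>t. Lc t * exp (- \<i> * of_real t * w))"
      by (intro continuous_intros Lc_continuous)
    then show "(\<lambda>t. Lc t * exp (- \<i> * of_real t * w)) \<in> borel_measurable lborel"
      by (simp only: measurable_lborel2 borel_measurable_continuous_onI)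
  qed
qed

text \<open>By \<open>Lc_shift\<close> the integrand is the Fourier transform of u -> gs (u + w), so
  inversion at the single point 0 gives the value at w.\<close>

lemma Lc_inversion:
  assumes w: "w \<in> strip"
  shows "(\<integral>t. Lc t * exp (- \<i> * of_real t * w) \<partial>lborel) = 2 * pi * gs w"
proof -
  have w': "\<bar>Im w\<bar> < pi / 2" using w by (simp add: strip_def)
  have eq: "Lc t * exp (- \<i> * of_real t * w) = (\<integral>u. exp (\<i> * of_real (t * u)) * gs (of_real u + w) \<partial>lborel)" for t
  proof -
    have e: "exp (\<i> * of_real t * (of_real u + w)) * exp (- \<i> * of_real t * w) = exp (\<i> * of_real (t * u))" for u
      unfolding exp_add[symmetric] by (rule arg_cong[of _ _ exp]) (simp add: algebra_simps)
    have "exp (\<i> * of_real t * (of_real u + w)) * gs (of_real u + w) * exp (- \<i> * of_real t * w) = exp (\<i> * of_real (t * u)) * gs (of_real u + w)" for u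
      using arg_cong[OF e[of u], of "\<lambda>x. x * gs (of_real u + w)"] by (simp only: mult_ac)
    then show ?thesis
      unfolding Lc_shift[OF w, of t, symmetric] integral_mult_left_zero[symmetric] by (simp only:)
  qed
  obtain K where K: "K > 0" "\<And>u. norm (gs (of_real u + w)) \<le> K * exp (- (1/2) * \<bar>u\<bar>)" using gs_shift_bound[OF w] by blast
  have Kb: "norm (gs (of_real u + w)) \<le> K" for u :: real
    by (rule order_trans[OF K(2)]) (use K(1) in \<open>simp add: mult_le_cancel_left1\<close>)
  show ?thesis
    unfolding eq using fourier_inversion_at_0[OF gs_continuous[OF w] Kb gs_integrable[OF w] Lc_weighted_integrable[OF w', unfolded eq]]
    by simp
qed

end

section \<open>Continuation of the Epstein zeta function\<close>

text \<open>The norms are summed before they are integrated, which suits series whose absolute sum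
  is known, such as \<open>psi\<close>. The summability of the integrals is what later yields
  convergence of the Dirichlet series.\<close>

lemma fubini_count_space_swap:
  fixes f :: "'i::countable \<Rightarrow> 'a \<Rightarrow> 'b::{banach, second_countable_topology}"
  assumes "sigma_finite_measure M" and meas: "\<And>i. f i \<in> borel_measurable M"
    and sum: "\<And>x. x \<in> space M \<Longrightarrow> integrable (count_space UNIV) (\<lambda>i. f i x)"
    and int: "integrable M (\<lambda>x. \<integral>i. norm (f i x) \<partial>count_space UNIV)"
  shows "(\<integral>x. (\<integral>i. f i x \<partial>count_space UNIV) \<partial>M) = (\<integral>i. (\<integral>x. f i x \<partial>M) \<partial>count_space UNIV)"
    and "integrable (count_space UNIV) (\<lambda>i. \<integral>x. f i x \<partial>M)"
proof -
  interpret M: sigma_finite_measure M by fact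
  interpret C: sigma_finite_measure "count_space (UNIV :: 'i set)"
    by (rule sigma_finite_measure_count_space)
  interpret P: pair_sigma_finite M "count_space (UNIV :: 'i set)" ..
  have I: "integrable (M \<Otimes>\<^sub>M count_space UNIV) (\<lambda>(x, i). f i x)"
  proof (rule P.Fubini_integrable)
    have "case_prod f \<in> borel_measurable (count_space UNIV \<Otimes>\<^sub>M M)"
      by (rule measurable_pair_measure_countable1) (use meas in auto)
    then show "(\<lambda>(x, i). f i x) \<in> borel_measurable (M \<Otimes>\<^sub>M count_space UNIV)"
      using measurable_pair_swap by fastforce
  qed (use int sum in auto)
  show "(\<integral>x. (\<integral>i. f i x \<partial>count_space UNIV) \<partial>M) = (\<integral>i. (\<integral>x. f i x \<partial>M) \<partial>count_space UNIV)"
    using P.Fubini_integral[of "\<lambda>x i. f i x"] I by simp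
  show "integrable (count_space UNIV) (\<lambda>i. \<integral>x. f i x \<partial>M)"
    using P.integrable_snd[of "\<lambda>x i. f i x"] I by simp
qed

text \<open>The additive form of splitting a Mellin integral at x = 1.\<close>

lemma integral_symmetrize:
  fixes F :: "real \<Rightarrow> complex"
  assumes F: "integrable lborel F"
  shows "(\<integral>u. F u \<partial>lborel) = (\<integral>u. indicator {0<..} u *\<^sub>R (F u + F (- u)) \<partial>lborel)"
proof -
  define P where "P = (\<lambda>u::real. indicator {0<..} u *\<^sub>R F u)"
  define N where "N = (\<lambda>u::real. indicator {..<0} u *\<^sub>R F u)"
  have i: "integrable lborel P" "integrable lborel N"
    unfolding P_def N_def by (intro integrable_mult_indicator F; simp)+
  have i': "integrable lborel (\<lambda>u. N (- u))" using lborel_integrable_real_affine[OF i(2), of "-1" 0] by simp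
  have "(\<integral>u. F u \<partial>lborel) = (\<integral>u. P u + N u \<partial>lborel)"
  proof (rule integral_cong_AE)
    show "AE u in lborel. F u = P u + N u"
      using AE_lborel_singleton[of "0::real"] by eventually_elim (auto simp: P_def N_def indicator_def)
  qed (use F i in auto)
  also have "\<dots> = (\<integral>u. P u \<partial>lborel) + (\<integral>u. N u \<partial>lborel)"
    by (rule Bochner_Integration.integral_add[OF i])
  also have "(\<integral>u. N u \<partial>lborel) = (\<integral>u. N (- u) \<partial>lborel)"
    using lborel_integral_real_affine[of "-1" N 0] by simp
  also have "(\<integral>u. P u \<partial>lborel) + (\<integral>u. N (- u) \<partial>lborel) = (\<integral>u. P u + N (- u) \<partial>lborel)"
    by (rule Bochner_Integration.integral_add[OF i(1) i', symmetric])
  also have "(\<lambda>u. P u + N (- u)) = (\<lambda>u. indicator {0<..} u *\<^sub>R (F u + F (- u)))"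
    by (auto simp: P_def N_def indicator_def fun_eq_iff)
  finally show ?thesis .
qed

lemma exp_half_line_integral:
  fixes z :: complex
  assumes z: "Re z > 0"
  shows "integrable lborel (\<lambda>u. indicator {0<..} u *\<^sub>R exp (- z * of_real u))"
    and "(\<integral>u. indicator {0<..} u *\<^sub>R exp (- z * of_real u) \<partial>lborel) = 1 / z"
proof -
  let ?f = "\<lambda>u. indicator {0<..} u *\<^sub>R exp (- z * of_real u)"
  have bound: "norm (?f u) \<le> exp (- Re z * \<bar>u\<bar>)" for u by (auto simp: indicator_def)
  show i: "integrable lborel ?f"
    by (rule Bochner_Integration.integrable_bound[OF integrable_exp_abs[OF z]]) (use bound in auto)
  have "(\<lambda>N. \<integral>u. indicator {0..real N} u *\<^sub>R exp (- z * of_real u) \<partial>lborel) \<longlonglongrightarrow> (\<integral>u. ?f u \<partial>lborel)"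
  proof (rule integral_dominated_convergence)
    show "AE u in lborel. (\<lambda>N. indicator {0..real N} u *\<^sub>R exp (- z * of_real u)) \<longlonglongrightarrow> ?f u"
      using AE_lborel_singleton[of "0::real"]
    proof eventually_elim
      fix u :: real assume u: "u \<noteq> 0"
      have "eventually (\<lambda>N. indicator {0..real N} u *\<^sub>R exp (- z * of_real u) = ?f u) sequentially"
        using eventually_ge_at_top[of "nat \<lceil>u\<rceil>"]
      proof eventually_elim
        fix N :: nat assume "nat \<lceil>u\<rceil> \<le> N"
        then have "u \<le> real N" by linarith
        then show "indicator {0..real N} u *\<^sub>R exp (- z * of_real u) = ?f u" using u by (auto simp: indicator_def)
      qed
      then show "(\<lambda>N. indicator {0..real N} u *\<^sub>R exp (- z * of_real u)) \<longlonglongrightarrow> ?f u" by (rule tendsto_eventually)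
    qed
    show "AE u in lborel. norm (indicator {0..real N} u *\<^sub>R exp (- z * of_real u)) \<le> exp (- Re z * \<bar>u\<bar>)" for N
      by (auto simp: indicator_def)
    show "integrable lborel (\<lambda>u. exp (- Re z * \<bar>u\<bar>))" by (rule integrable_exp_abs[OF z])
  qed auto
  moreover have "(\<integral>u. indicator {0..real N} u *\<^sub>R exp (- z * of_real u) \<partial>lborel) = 1 / z - exp (- z * of_nat N) / z" for N
  proof -
    have z0: "z \<noteq> 0" using z by auto
    have "(\<integral>u. indicator {0..real N} u *\<^sub>R exp (- z * of_real u) \<partial>lborel) = - exp (- z * of_real (real N)) / z - (- exp (- z * of_real 0) / z)"
    proof (rule integral_FTC_atLeastAtMost)
      show "((\<lambda>u. - exp (- z * of_real u) / z) has_vector_derivative exp (- z * of_real u)) (at u within {0..real N})" for u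
        using z0 by (intro has_vector_derivative_real_field) (auto intro!: derivative_eq_intros)
    qed (auto intro!: continuous_intros)
    then show ?thesis by simp
  qed
  ultimately have 1: "(\<lambda>N. 1 / z - exp (- z * of_nat N) / z) \<longlonglongrightarrow> (\<integral>u. ?f u \<partial>lborel)" by simp
  have "(\<lambda>N. exp (- Re z) ^ N) \<longlonglongrightarrow> 0" by (rule LIMSEQ_power_zero) (use z in simp)
  then have "(\<lambda>N. norm (exp (- z * of_nat N))) \<longlonglongrightarrow> 0"
    by (simp add: exp_of_nat_mult[symmetric] mult.commute)
  then have "(\<lambda>N. exp (- z * of_nat N)) \<longlonglongrightarrow> 0" by (simp only: tendsto_norm_zero_iff)
  then have 2: "(\<lambda>N. 1 / z - exp (- z * of_nat N) / z) \<longlonglongrightarrow> 1 / z - 0 / z"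
    by (intro tendsto_intros) (use z in auto)
  show "(\<integral>u. ?f u \<partial>lborel) = 1 / z" using LIMSEQ_unique[OF 1 2] by simp
qed

text \<open>Euler's integral under t = exp u. The change of variables is carried out for a
  real-valued image p of the integrand, with p the real and the imaginary part.\<close>

lemma gamma_exp_integral:
  fixes s :: complex
  assumes s: "Re s > 0"
  shows "integrable lborel (\<lambda>u. exp (s * of_real u - of_real (exp u)))"
    and "(\<integral>u. exp (s * of_real u - of_real (exp u)) \<partial>lborel) = Gamma s"
proof -
  let ?g = "\<lambda>t. complex_of_real t powr (s - 1) / of_real (exp t)"
  let ?h = "\<lambda>u. exp (s * of_real u - of_real (exp u))"
  have gh: "exp u *\<^sub>R ?g (exp u) = ?h u" for u
  proof -
    have "complex_of_real (exp u) powr (s - 1) = exp ((s - 1) * of_real u)"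
      by (simp add: powr_def Ln_of_real)
    moreover have "complex_of_real (exp u) * exp ((s - 1) * of_real u) = exp (s * of_real u)"
      unfolding exp_of_real[symmetric] exp_add[symmetric] by (rule arg_cong[of _ _ exp]) (simp add: algebra_simps)
    ultimately show ?thesis
      by (simp only: scaleR_conv_of_real exp_diff times_divide_eq_right exp_of_real)
  qed
  have cont: "continuous_on UNIV ?h" by (intro continuous_intros)
  have abs: "?g absolutely_integrable_on {0<..}" by (rule absolutely_integrable_Gamma_integral'[OF s])
  have hi: "(?g has_integral Gamma s) {0<..}" by (rule Gamma_integral_complex'[OF s])
  have part: "integrable lborel (\<lambda>u. p (?h u)) \<and> (\<integral>u. p (?h u) \<partial>lborel) = p (Gamma s)"
    if p: "bounded_linear p" for p :: "complex \<Rightarrow> real"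
  proof -
    interpret bounded_linear p by fact
    have a: "(p \<circ> ?g) absolutely_integrable_on {0<..}"
      by (rule absolutely_integrable_linear[OF abs p])
    have b: "integral {0<..} (p \<circ> ?g) = p (Gamma s)"
      using has_integral_linear[OF hi p] by (rule integral_unique)
    have r: "exp ` (UNIV :: real set) = {0<..}"
      by (auto simp: image_iff) (metis exp_ln)
    have iff: "(\<lambda>u. \<bar>exp u\<bar> * (p \<circ> ?g) (exp u)) absolutely_integrable_on UNIV \<and>
          integral UNIV (\<lambda>u. \<bar>exp u\<bar> * (p \<circ> ?g) (exp u)) = p (Gamma s) \<longleftrightarrow>
          (p \<circ> ?g) absolutely_integrable_on (exp ` UNIV) \<and> integral (exp ` UNIV) (p \<circ> ?g) = p (Gamma s)"
      by (rule has_absolute_integral_change_of_variables_1') (auto intro!: derivative_eq_intros simp: inj_on_def)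
    have "(\<lambda>u. \<bar>exp u\<bar> * (p \<circ> ?g) (exp u)) absolutely_integrable_on UNIV \<and>
          integral UNIV (\<lambda>u. \<bar>exp u\<bar> * (p \<circ> ?g) (exp u)) = p (Gamma s)"
      unfolding iff r using a b by (rule conjI)
    moreover have "(\<lambda>u. \<bar>exp u\<bar> * (p \<circ> ?g) (exp u)) = (\<lambda>u. p (?h u))"
      by (simp add: fun_eq_iff gh[symmetric] scaleR)
    ultimately have c: "(\<lambda>u. p (?h u)) absolutely_integrable_on UNIV" "integral UNIV (\<lambda>u. p (?h u)) = p (Gamma s)"
      by simp_all
    have pm: "(\<lambda>u. p (?h u)) \<in> borel_measurable lborel"
      using borel_measurable_continuous_onI[OF continuous_on[OF cont]] by simp
    have "integrable lebesgue (\<lambda>u. p (?h u))" using c(1) by (simp add: set_integrable_def)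
    then have d: "integrable lborel (\<lambda>u. p (?h u))" using integrable_completion[OF pm] by simp
    then show ?thesis using integral_lborel[OF d] c(2) by simp
  qed
  have R: "integrable lborel (\<lambda>u. Re (?h u))" "(\<integral>u. Re (?h u) \<partial>lborel) = Re (Gamma s)"
    using part[OF bounded_linear_Re] by auto
  have I: "integrable lborel (\<lambda>u. Im (?h u))" "(\<integral>u. Im (?h u) \<partial>lborel) = Im (Gamma s)"
    using part[OF bounded_linear_Im] by auto
  have e: "?h = (\<lambda>u. complex_of_real (Re (?h u)) + \<i> * complex_of_real (Im (?h u)))"
    by (rule ext) (rule complex_eq)
  show hint: "integrable lborel ?h"
    by (subst e) (intro Bochner_Integration.integrable_add integrable_mult_right integrable_of_real R I)
  show "(\<integral>u. ?h u \<partial>lborel) = Gamma s"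
    using integral_Re[OF hint] integral_Im[OF hint] R(2) I(2) by (simp add: complex_eq_iff)
qed

lemma gamma_scaled_exp_integral:
  fixes s :: complex
  assumes s: "Re s > 0" and y: "y > 0"
  shows "integrable lborel (\<lambda>u. exp (s * of_real u) * exp (- of_real (exp u * y)))"
    and "(\<integral>u. exp (s * of_real u) * exp (- of_real (exp u * y)) \<partial>lborel) = of_real y powr (- s) * Gamma s"
proof -
  let ?k = "\<lambda>u. exp (s * of_real u) * exp (- of_real (exp u * y))"
  let ?h = "\<lambda>u. exp (s * of_real u - of_real (exp u))"
  have e: "?k u = of_real y powr (- s) * ?h (ln y + 1 * u)" for u
  proof -
    have "of_real y powr (- s) = exp (- (s * of_real (ln y)))" using y by (simp add: powr_def Ln_of_real)
    moreover have "exp (ln y + u) = exp u * y" using y by (simp add: exp_add)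
    ultimately show ?thesis by (simp add: exp_add[symmetric] algebra_simps)
  qed
  show "integrable lborel ?k" unfolding e
    by (intro integrable_mult_right lborel_integrable_real_affine[OF gamma_exp_integral(1)[OF s]]) simp
  show "(\<integral>u. ?k u \<partial>lborel) = of_real y powr (- s) * Gamma s"
    unfolding e integral_mult_right_zero
    using lborel_integral_real_affine[of 1 ?h "ln y"] gamma_exp_integral(2)[OF s] by simp
qed

text \<open>After removal of its singularities the difference vanishes identically, so f and g agree
  in a punctured neighbourhood of every point. At the point itself the convention decides: value 0
  at poles, continuity elsewhere.\<close>

lemma nicely_meromorphic_eqI:
  assumes f: "f nicely_meromorphic_on UNIV" and g: "g nicely_meromorphic_on UNIV"
    and eq: "\<forall>s. Re s > a \<longrightarrow> f s = g s"
  shows "f = g"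
proof
  fix z
  define h where "h = (\<lambda>s. f s - g s)"
  have fm: "f meromorphic_on UNIV" and gm: "g meromorphic_on UNIV" using f g by (auto simp: nicely_meromorphic_on_def)
  have hm: "h meromorphic_on UNIV" unfolding h_def by (intro meromorphic_intros fm gm)
  have rn: "remove_sings h nicely_meromorphic_on UNIV" by (rule remove_sings_nicely_meromorphic[OF hm])
  have ev: "eventually (\<lambda>w. remove_sings h w = h w) (at x)" for x
    using hm meromorphic_on_isolated_singularity meromorphic_on_subset
    by (intro eventually_remove_sings_eq_at) blast
  define b where "b = complex_of_real (a + 1)"
  have "eventually (\<lambda>w. w \<in> {s. Re s > a}) (at b)"
    by (rule eventually_at_in_open') (auto simp: b_def open_halfspace_Re_gt)
  then have "eventually (\<lambda>w. remove_sings h w = 0) (at b)"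
    using ev[of b] by eventually_elim (use eq in \<open>auto simp: h_def\<close>)
  then have fr: "frequently (\<lambda>w. remove_sings h w = 0) (at b)"
    by (rule eventually_frequently[OF at_neq_bot])
  have r0: "remove_sings h w = 0" for w
    by (rule frequently_eq_meromorphic_imp_constant[OF fr rn open_UNIV connected_UNIV UNIV_I UNIV_I])
  have evz: "eventually (\<lambda>w. f w = g w) (at z)"
    using ev[of z] by eventually_elim (simp only: r0, simp add: h_def)
  show "f z = g z"
  proof (cases "is_pole f z")
    case True
    then have "is_pole g z" using is_pole_cong[OF evz refl] by simp
    moreover have "F z = 0" if "F nicely_meromorphic_on UNIV" "is_pole F z" for F
    proof -
      have "\<not> (F \<longlongrightarrow> F z) (at z)"
        using that(2) not_tendsto_and_filterlim_at_infinity[OF at_neq_bot] unfolding is_pole_def by blast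
      then show ?thesis using that(1) by (auto simp: nicely_meromorphic_on_def)
    qed
    ultimately have "f z = 0" "g z = 0" using True f g by auto
    then show ?thesis by simp
  next
    case False
    then have "\<not> is_pole g z" using is_pole_cong[OF evz refl] by simp
    with False f g have l: "(f \<longlongrightarrow> f z) (at z)" "(g \<longlongrightarrow> g z) (at z)" by (auto simp: nicely_meromorphic_on_def)
    have "(g \<longlongrightarrow> f z) (at z)" by (rule Lim_transform_eventually[OF l(1) evz])
    then show ?thesis using l(2) by (rule tendsto_unique[OF at_neq_bot])
  qed
qed

section \<open>The completed zeta function and its Mellin representations\<close>

context epstein_form begin

lemma psi_exp: "of_real (psi (exp u)) = theta (exp (of_real u)) - 1"
  using theta_of_real[of "exp u"] by (simp add: exp_of_real)

lemma psi_exp_continuous: "continuous_on UNIV (\<lambda>u. psi (exp u))"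
proof -
  have c: "continuous_on UNIV (\<lambda>u::real. theta (exp (of_real u)) - 1)"
    by (intro continuous_intros continuous_on_compose2[OF holomorphic_on_imp_continuous_on[OF theta_holomorphic]])
       (auto intro!: Re_exp_strip)
  have "(\<lambda>u. psi (exp u)) = (\<lambda>u. Re (theta (exp (of_real u)) - 1))"
    unfolding psi_exp[symmetric] by simp
  then show ?thesis using continuous_on_Re[OF c] by (simp only:)
qed

lemma psi_exp_measurable [measurable]: "(\<lambda>u. psi (exp u)) \<in> borel_measurable borel"
  by (rule borel_measurable_continuous_onI[OF psi_exp_continuous])

text \<open>Decay in exp u beats every exponential in u: exp u is at least u^2 / 2, and R u - c u^2
  / 2 is at most R^2 / (2 c). This makes the Mellin integral over u > 0 entire in s.\<close>

lemma psi_exp_superdecay: "\<exists>K\<ge>0. \<forall>u\<ge>0. psi (exp u) \<le> K * exp (- R * u)"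
proof -
  define c where "c = 2 * pi / of_int k"
  have c: "c > 0" using k_pos' by (simp add: c_def)
  have "psi (exp u) \<le> psi 1 * exp c * exp (R\<^sup>2 / (2 * c)) * exp (- R * u)" if u: "u \<ge> 0" for u
  proof -
    have "u\<^sup>2 / 2 \<le> exp u" using exp_lower_Taylor_quadratic[OF u] u by linarith
    then have "c * (u\<^sup>2 / 2) \<le> c * exp u" using c by (intro mult_left_mono) auto
    moreover have "R * u - c * (u\<^sup>2 / 2) \<le> R\<^sup>2 / (2 * c)"
      using zero_le_power2[of "c * u - R"] c by (simp add: field_simps power2_eq_square)
    ultimately have "- c * (exp u - 1) \<le> c + R\<^sup>2 / (2 * c) + - R * u" by (simp add: algebra_simps)
    then have "exp (- c * (exp u - 1)) \<le> exp c * exp (R\<^sup>2 / (2 * c)) * exp (- R * u)"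
      unfolding exp_add[symmetric] by simp
    then have "psi 1 * exp (- c * (exp u - 1)) \<le> psi 1 * (exp c * exp (R\<^sup>2 / (2 * c)) * exp (- R * u))"
      by (rule mult_left_mono[OF _ psi_nonneg])
    moreover have "psi (exp u) \<le> psi 1 * exp (- c * (exp u - 1))"
      using psi_exp_decay[of "exp u"] u by (simp add: c_def)
    ultimately show ?thesis by (simp add: mult.assoc)
  qed
  then show ?thesis using psi_nonneg[of 1] by (intro exI[of _ "psi 1 * exp c * exp (R\<^sup>2 / (2 * c))"]) auto
qed

lemma psi_reflect: "psi (exp (- u)) = exp u * psi (exp u) + exp u - 1"
proof -
  have "theta (1 / exp (of_real u)) = exp (of_real u) * theta (exp (of_real u))"
    by (rule theta_inversion) (simp add: Re_exp)
  then have "complex_of_real (psi (exp (- u)) + 1) = of_real (exp u * (psi (exp u) + 1))"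
    using psi_exp[of u] psi_exp[of "- u"] by (simp add: exp_minus inverse_eq_divide exp_of_real)
  then have "psi (exp (- u)) + 1 = exp u * (psi (exp u) + 1)" by (simp only: of_real_eq_iff)
  then show ?thesis by (simp add: algebra_simps)
qed

text \<open>The integrand of Riemann's splitting: the part below x = 1 has been reflected by the
  inversion formula, so the kernel is symmetric under s -> 1 - s and lives on u > 0 only.\<close>

definition mellin_kernel :: "real \<Rightarrow> complex \<Rightarrow> complex" where
  "mellin_kernel u s = indicator {0<..} u *\<^sub>R ((exp (s * of_real u) + exp ((1 - s) * of_real u)) * of_real (psi (exp u)))"

definition mellin_part :: "complex \<Rightarrow> complex" where
  "mellin_part s = (\<integral>u. mellin_kernel u s \<partial>lborel)"

lemma mellin_kernel_measurable: "(\<lambda>u. mellin_kernel u s) \<in> borel_measurable lborel"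
  unfolding mellin_kernel_def by measurable

lemma mellin_kernel_bound:
  "\<exists>K. \<forall>u s. norm s \<le> R \<longrightarrow> norm (mellin_kernel u s) \<le> K * exp (- 1 * \<bar>u\<bar>)"
proof -
  \<comment> \<open>The rate R + 2 leaves exp(-u) after multiplication by exp((R + 1) u).\<close>
  obtain K where K: "K \<ge> 0" "\<And>u. u \<ge> 0 \<Longrightarrow> psi (exp u) \<le> K * exp (- (R + 2) * u)" using psi_exp_superdecay by blast
  have "norm (mellin_kernel u s) \<le> 2 * K * exp (- 1 * \<bar>u\<bar>)" if s: "norm s \<le> R" for u s
  proof (cases "u > 0")
    case True
    have rs: "\<bar>Re s\<bar> \<le> R" using abs_Re_le_cmod[of s] s by linarith
    have "Re s * u \<le> (R + 1) * u" "(1 - Re s) * u \<le> (R + 1) * u" using True rs by (intro mult_right_mono; simp add: abs_le_iff)+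
    then have "norm (exp (s * of_real u)) \<le> exp ((R + 1) * u)" "norm (exp ((1 - s) * of_real u)) \<le> exp ((R + 1) * u)" by simp_all
    then have "norm (exp (s * of_real u) + exp ((1 - s) * of_real u)) \<le> 2 * exp ((R + 1) * u)"
      using norm_triangle_ineq[of "exp (s * of_real u)" "exp ((1 - s) * of_real u)"] by linarith
    then have "norm (mellin_kernel u s) \<le> (2 * exp ((R + 1) * u)) * (K * exp (- (R + 2) * u))"
      unfolding mellin_kernel_def using True K(2)[of u] psi_nonneg[of "exp u"] by (auto simp: norm_mult intro!: mult_mono)
    also have "\<dots> = 2 * K * (exp ((R + 1) * u) * exp (- (R + 2) * u))" by simp
    also have "exp ((R + 1) * u) * exp (- (R + 2) * u) = exp (- 1 * \<bar>u\<bar>)"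
      using True by (simp add: exp_add[symmetric] algebra_simps)
    finally show ?thesis .
  qed (use K in \<open>auto simp: mellin_kernel_def\<close>)
  then show ?thesis by blast
qed

lemma mellin_kernel_integrable: "integrable lborel (\<lambda>u. mellin_kernel u s)"
proof -
  obtain K where K: "\<And>u. norm (mellin_kernel u s) \<le> K * exp (- 1 * \<bar>u\<bar>)" using mellin_kernel_bound[of "norm s"] by blast
  show ?thesis
    by (rule Bochner_Integration.integrable_bound[OF integrable_mult_right[OF integrable_exp_abs[of 1], of K] mellin_kernel_measurable])
       (auto intro!: AE_I2 order_trans[OF K])
qed

lemma mellin_part_holomorphic: "mellin_part holomorphic_on UNIV"
  unfolding mellin_part_def[abs_def]
proof (rule holomorphic_on_lebesgue_integral)
  fix z0 :: complex
  obtain K where K: "\<And>u s. norm s \<le> norm z0 + 1 \<Longrightarrow> norm (mellin_kernel u s) \<le> K * exp (- 1 * \<bar>u\<bar>)"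
    using mellin_kernel_bound by blast
  show "\<exists>r>0. \<exists>D. integrable lborel D \<and> (\<forall>u\<in>space lborel. \<forall>z\<in>UNIV \<inter> cball z0 r. norm (mellin_kernel u z) \<le> D u)"
  proof (intro exI conjI ballI)
    show "integrable lborel (\<lambda>u. K * exp (- 1 * \<bar>u\<bar>))" by (intro integrable_mult_right integrable_exp_abs) simp
    fix u :: real and z assume "z \<in> UNIV \<inter> cball z0 1"
    then have "norm z \<le> norm z0 + 1" using norm_triangle_sub[of z z0] by (simp add: dist_norm norm_minus_commute)
    then show "norm (mellin_kernel u z) \<le> K * exp (- 1 * \<bar>u\<bar>)" by (rule K)
  qed simp
qed (auto simp: mellin_kernel_def intro!: holomorphic_intros borel_measurable_times mellin_kernel_measurable[unfolded mellin_kernel_def])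

text \<open>The completed zeta function: an entire part and the two polar terms left over by the
  reflection.\<close>

definition Lam :: "complex \<Rightarrow> complex" where
  "Lam s = mellin_part s + 1 / (s - 1) - 1 / s"

text \<open>Folding the Fourier integral at 0 gives the Mellin kernel minus two exponentials, whose
  half-line integrals are 1 / (1 - s) and 1 / s. Both converge because Re s = 1/2.\<close>

lemma Lam_critical: "Lam (1 / 2 + \<i> * of_real t) = Lc t"
proof -
  define s where "s = 1 / 2 + \<i> * complex_of_real t"
  define F where "F = (\<lambda>u. exp (\<i> * of_real (t * u)) * gs (of_real u))"
  have Fi: "integrable lborel F"
    unfolding F_def by (rule Bochner_Integration.integrable_bound[OF gs_of_real_int]) (auto simp: norm_mult)
  have g: "gs (of_real u) = exp (of_real u / 2) * of_real (psi (exp u)) - exp (- (of_real u / 2))" for u :: real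
    unfolding gs_def psi_exp[symmetric] ..
  have "F u + F (- u) = (exp (s * of_real u) + exp ((1 - s) * of_real u)) * of_real (psi (exp u)) - exp (- (1 - s) * of_real u) - exp (- s * of_real u)" for u
  proof -
    have e: "exp (s * of_real u) = exp (\<i> * of_real (t * u)) * exp (of_real u / 2)"
      "exp ((1 - s) * of_real u) = exp (\<i> * of_real (t * (- u))) * exp (of_real u / 2)"
      "exp (- (1 - s) * of_real u) = exp (\<i> * of_real (t * u)) * exp (- (of_real u / 2))"
      "exp (- s * of_real u) = exp (\<i> * of_real (t * (- u))) * exp (- (of_real u / 2))"
      unfolding exp_add[symmetric] by (rule arg_cong[of _ _ exp]; simp add: s_def algebra_simps)+
    have "gs (of_real (- u)) = gs (of_real u)" using gs_even[OF of_real_in_strip[of u]] by simp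
    then show ?thesis unfolding F_def e g by (simp only: g) (simp add: algebra_simps)
  qed
  then have F2: "indicator {0<..} u *\<^sub>R (F u + F (- u)) = mellin_kernel u s - indicator {0<..} u *\<^sub>R exp (- (1 - s) * of_real u) - indicator {0<..} u *\<^sub>R exp (- s * of_real u)" for u
    by (simp only: mellin_kernel_def scaleR_diff_right)
  have i: "integrable lborel (\<lambda>u. indicator {0<..} u *\<^sub>R exp (- (1 - s) * of_real u))" "integrable lborel (\<lambda>u. indicator {0<..} u *\<^sub>R exp (- s * of_real u))"
    by (rule exp_half_line_integral(1); simp add: s_def)+
  have "Lc t = (\<integral>u. F u \<partial>lborel)" by (simp add: Lc_def F_def)
  also have "\<dots> = mellin_part s - 1 / (1 - s) - 1 / s"
    unfolding integral_symmetrize[OF Fi] F2 mellin_part_def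
    using i mellin_kernel_integrable[of s] exp_half_line_integral(2)[of "1 - s"] exp_half_line_integral(2)[of s]
    by (simp add: s_def)
  also have "\<dots> = Lam s"
    by (simp add: Lam_def divide_minus_right[of 1 "1 - s", symmetric])
  finally show ?thesis by (simp add: s_def)
qed

text \<open>For u < 0 the bound psi x \<le> K / x leaves exp((Re s - 1) u), which is where Re s > 1
  enters; for u \<ge> 0 the superexponential decay suffices.\<close>

lemma psi_mellin_integrable:
  assumes s: "Re s > 1"
  shows "integrable lborel (\<lambda>u. exp (s * of_real u) * of_real (psi (exp u)))"
proof -
  obtain K where K: "\<And>s. s > 0 \<Longrightarrow> psi s \<le> K / s" using psi_inverse_bound by blast
  obtain K' where K': "K' \<ge> 0" "\<And>u. u \<ge> 0 \<Longrightarrow> psi (exp u) \<le> K' * exp (- (Re s + 1) * u)" using psi_exp_superdecay by blast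
  have K0: "K \<ge> 0" using K[of 1] psi_nonneg[of 1] by simp
  have bound: "norm (exp (s * of_real u) * of_real (psi (exp u))) \<le> K * exp (- (Re s - 1) * \<bar>u\<bar>) + K' * exp (- 1 * \<bar>u\<bar>)" for u
  proof (cases "u \<ge> 0")
    case True
    have "norm (exp (s * of_real u) * of_real (psi (exp u))) \<le> exp (Re s * u) * (K' * exp (- (Re s + 1) * u))"
      using K'(2)[OF True] psi_nonneg[of "exp u"] by (auto simp: norm_mult intro!: mult_left_mono)
    also have "\<dots> = K' * (exp (Re s * u) * exp (- (Re s + 1) * u))" by simp
    also have "exp (Re s * u) * exp (- (Re s + 1) * u) = exp (- 1 * \<bar>u\<bar>)"
      using True by (simp add: exp_add[symmetric] algebra_simps)
    also have "K' * exp (- 1 * \<bar>u\<bar>) \<le> K * exp (- (Re s - 1) * \<bar>u\<bar>) + K' * exp (- 1 * \<bar>u\<bar>)"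
      using K0 by simp
    finally show ?thesis .
  next
    case False
    have "norm (exp (s * of_real u) * of_real (psi (exp u))) = exp (Re s * u) * psi (exp u)"
      using psi_nonneg[of "exp u"] by (simp add: norm_mult)
    also have "\<dots> \<le> exp (Re s * u) * (K / exp u)"
      by (intro mult_left_mono K) auto
    also have "\<dots> = K * (exp (Re s * u) / exp u)" by simp
    also have "exp (Re s * u) / exp u = exp (- (Re s - 1) * \<bar>u\<bar>)"
      using False by (simp add: exp_diff[symmetric] algebra_simps)
    also have "K * exp (- (Re s - 1) * \<bar>u\<bar>) \<le> K * exp (- (Re s - 1) * \<bar>u\<bar>) + K' * exp (- 1 * \<bar>u\<bar>)"
      using K' by simp
    finally show ?thesis .
  qed
  show ?thesis
  proof (rule Bochner_Integration.integrable_bound)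
    show "integrable lborel (\<lambda>u. K * exp (- (Re s - 1) * \<bar>u\<bar>) + K' * exp (- 1 * \<bar>u\<bar>))"
      by (intro Bochner_Integration.integrable_add integrable_mult_right integrable_exp_abs) (use s in auto)
    have "continuous_on UNIV (\<lambda>u. exp (s * of_real u) * complex_of_real (psi (exp u)))"
      by (intro continuous_intros psi_exp_continuous)
    then show "(\<lambda>u. exp (s * of_real u) * complex_of_real (psi (exp u))) \<in> borel_measurable lborel"
      by (simp only: measurable_lborel2 borel_measurable_continuous_onI)
    show "AE u in lborel. norm (exp (s * of_real u) * complex_of_real (psi (exp u))) \<le> norm (K * exp (- (Re s - 1) * \<bar>u\<bar>) + K' * exp (- 1 * \<bar>u\<bar>))"
      by (rule AE_I2, rule order_trans[OF bound], unfold real_norm_def, rule abs_ge_self)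
  qed
qed

text \<open>The same folding in the half-plane of convergence, where \<open>psi_reflect\<close>
  supplies exponentials with half-line integrals 1 / (s - 1) and 1 / s. Together with
  \<open>Lam_critical\<close> this shows that one function \<open>Lam\<close> carries both the
  Dirichlet series and the Fourier integral.\<close>

lemma Lam_mellin:
  assumes s: "Re s > 1"
  shows "Lam s = (\<integral>u. exp (s * of_real u) * of_real (psi (exp u)) \<partial>lborel)"
proof -
  define F where "F = (\<lambda>u. exp (s * of_real u) * complex_of_real (psi (exp u)))"
  have Fi: "integrable lborel F" unfolding F_def by (rule psi_mellin_integrable[OF s])
  have "F u + F (- u) = (exp (s * of_real u) + exp ((1 - s) * of_real u)) * of_real (psi (exp u)) + exp (- (s - 1) * of_real u) - exp (- s * of_real u)" for u
  proof -
    have e: "exp ((1 - s) * of_real u) = exp (- s * of_real u) * exp (of_real u)"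
      "exp (- (s - 1) * of_real u) = exp (- s * of_real u) * exp (of_real u)"
      unfolding exp_add[symmetric] by (rule arg_cong[of _ _ exp]; simp add: algebra_simps)+
    have "F (- u) = exp (- s * of_real u) * (exp (of_real u) * of_real (psi (exp u)) + exp (of_real u) - 1)"
      by (simp add: F_def psi_reflect exp_of_real)
    then show ?thesis unfolding e by (simp add: F_def algebra_simps)
  qed
  then have F2: "indicator {0<..} u *\<^sub>R (F u + F (- u)) = mellin_kernel u s + indicator {0<..} u *\<^sub>R exp (- (s - 1) * of_real u) - indicator {0<..} u *\<^sub>R exp (- s * of_real u)" for u
    by (simp only: mellin_kernel_def scaleR_diff_right scaleR_add_right)
  have i: "integrable lborel (\<lambda>u. indicator {0<..} u *\<^sub>R exp (- (s - 1) * of_real u))" "integrable lborel (\<lambda>u. indicator {0<..} u *\<^sub>R exp (- s * of_real u))"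
    by (rule exp_half_line_integral(1); use s in simp)+
  have "(\<integral>u. F u \<partial>lborel) = Lam s"
    unfolding integral_symmetrize[OF Fi] F2 Lam_def mellin_part_def
    using i mellin_kernel_integrable[of s] exp_half_line_integral(2)[of "s - 1"] exp_half_line_integral(2)[of s] s
    by simp
  then show ?thesis by (simp add: F_def)
qed

text \<open>Termwise Mellin transform: every lattice point other than the origin contributes Gamma s
  times a power of 2 pi q / k.\<close>

lemma Lam_series:
  assumes s: "Re s > 1"
  shows "Lam s = of_real (2 * pi / of_int k) powr (- s) * Gamma s * epstein_series A B C s"
proof -
  define r where "r = 2 * pi / real_of_int k"
  have r: "r > 0" using k_pos' by (simp add: r_def)
  define f where "f = (\<lambda>u x. indicator (- {(0, 0)}) u *\<^sub>R (exp (s * of_real x) * exp (- complex_of_real (exp x * (r * of_int (q u))))))"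
  have nf: "norm (f u x) = exp (Re s * x) * (indicator (- {(0, 0)}) u * exp (- (exp x * (r * of_int (q u)))))" for u x
    by (simp add: f_def norm_mult)
  have fi: "integrable (count_space UNIV) (\<lambda>u. f u x)" for x
    by (rule Bochner_Integration.integrable_bound[OF integrable_mult_right[OF tail_integrable[of "exp x" r], of "exp (Re s * x)"]])
       (use r in \<open>auto simp: nf\<close>)
  have psi_r: "psi x = (\<integral>u. indicator (- {(0, 0)}) u * exp (- (x * (r * of_int (q u)))) \<partial>count_space UNIV)" for x
    by (simp add: psi_def r_def)
  have nfi: "(\<integral>u. norm (f u x) \<partial>count_space UNIV) = exp (Re s * x) * psi (exp x)" for x
    unfolding nf psi_r by (rule integral_mult_right_zero)
  have nint: "integrable lborel (\<lambda>x. \<integral>u. norm (f u x) \<partial>count_space UNIV)"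
    unfolding nfi using integrable_norm[OF psi_mellin_integrable[OF s]] psi_nonneg by (simp add: norm_mult)
  have meas: "f u \<in> borel_measurable lborel" for u
    unfolding f_def by measurable
  note sw = fubini_count_space_swap[of lborel f, OF sigma_finite_lborel meas fi nint]
  have inner: "(\<integral>u. f u x \<partial>count_space UNIV) = exp (s * of_real x) * of_real (psi (exp x))" for x
  proof -
    have "f u x = exp (s * of_real x) * of_real (indicator (- {(0, 0)}) u * exp (- (exp x * (r * of_int (q u)))))" for u
      by (simp add: f_def scaleR_conv_of_real exp_of_real[symmetric])
    then show ?thesis unfolding psi_r by (simp only: integral_mult_right_zero integral_complex_of_real)
  qed
  have outer: "(\<integral>x. f u x \<partial>lborel) = indicator (- {(0, 0)}) u *\<^sub>R (of_real r powr (- s) * Gamma s * of_int (q u) powr (- s))" for u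
  proof (cases "u = (0, 0)")
    case False
    have y: "r * of_int (q u) > 0" using r q_ge_1[OF False] by simp
    have "(\<integral>x. f u x \<partial>lborel) = of_real (r * of_int (q u)) powr (- s) * Gamma s"
      using gamma_scaled_exp_integral(2)[OF _ y, of s] s False by (simp add: f_def)
    also have "complex_of_real (r * of_int (q u)) powr (- s) = of_real r powr (- s) * of_int (q u) powr (- s)"
      using r q_ge_1[OF False] by (simp add: powr_times_real)
    finally show ?thesis using False by simp
  qed (simp add: f_def)
  \<comment> \<open>The common factor must be non-zero so that summability of the series itself can
    be recovered from that of the integrated terms.\<close>
  have G0: "of_real r powr (- s) * Gamma s \<noteq> 0"
    using r s by (auto simp: Gamma_eq_zero_iff elim!: nonpos_Ints_cases)
  let ?g = "\<lambda>u. indicator (- {(0, 0)}) u *\<^sub>R (of_int (q u) powr (- s) :: complex)"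
  have "integrable (count_space UNIV) (\<lambda>u. (of_real r powr (- s) * Gamma s) * ?g u)"
    using sw(2) unfolding outer by (simp add: mult_ac)
  then have "integrable (count_space UNIV) (\<lambda>u. 1 / (of_real r powr (- s) * Gamma s) * ((of_real r powr (- s) * Gamma s) * ?g u))"
    by (rule integrable_mult_right)
  moreover have "1 / c * (c * x) = x" if "c \<noteq> 0" for c x :: complex using that by simp
  ultimately have gi: "integrable (count_space UNIV) ?g" by (simp only: G0 simp_thms)
  have "epstein_series A B C s = (\<integral>u. ?g u \<partial>count_space UNIV)"
  proof -
    have t: "(\<lambda>(m, n). complex_of_real (quad_form A B C (of_int m) (of_int n)) powr (- s)) = (\<lambda>u. of_int (q u) powr (- s))"
    proof -
      have "quad_form A B C (of_int m) (of_int n) = of_int (q (m, n))" for m n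
        using of_int_q[of "(m, n)"] by simp
      then show ?thesis by (simp add: fun_eq_iff)
    qed
    \<comment> \<open>\<open>epstein_series\<close> is an unordered \<open>infsum\<close>; absolute
      summability identifies it with the integral over \<open>count_space\<close>.\<close>
    have ab: "Infinite_Set_Sum.abs_summable_on (\<lambda>u. of_int (q u) powr (- s) :: complex) (UNIV - {(0, 0)})"
      unfolding abs_summable_on_altdef set_integrable_def using gi by (simp add: Compl_eq_Diff_UNIV)
    have "epstein_series A B C s = infsetsum (\<lambda>u. of_int (q u) powr (- s)) (UNIV - {(0, 0)})"
      unfolding epstein_series_def t by (rule infsetsum_infsum[OF ab, symmetric])
    also have "\<dots> = (\<integral>u. ?g u \<partial>count_space UNIV)"
      unfolding infsetsum_altdef set_lebesgue_integral_def by (simp add: Compl_eq_Diff_UNIV)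
    finally show ?thesis .
  qed
  moreover have "Lam s = (of_real r powr (- s) * Gamma s) * (\<integral>u. ?g u \<partial>count_space UNIV)"
  proof -
    have "Lam s = (\<integral>u. (\<integral>x. f u x \<partial>lborel) \<partial>count_space UNIV)"
      unfolding Lam_mellin[OF s] inner[symmetric] by (rule sw(1))
    then show ?thesis unfolding outer integral_mult_right_zero[symmetric] by (simp only: mult_scaleR_right)
  qed
  ultimately show ?thesis by (simp add: r_def)
qed

text \<open>As \<open>rGamma\<close> is entire, no division by Gamma occurs and only the points 0
  and 1 can be singular; the values there are repaired by \<open>remove_sings\<close>.\<close>

definition zeta0 :: "complex \<Rightarrow> complex" where
  "zeta0 s = of_real (2 * pi / of_int k) powr s * rGamma s * Lam s"

lemma powr_neg_cancel: "of_real (2 * pi / of_int k) powr s * of_real (2 * pi / of_int k) powr (- s) = (1 :: complex)"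
  using k_pos by (simp add: powr_minus)

lemma zeta0_series: assumes "Re s > 1" shows "zeta0 s = epstein_series A B C s"
proof -
  have "s \<notin> \<int>\<^sub>\<le>\<^sub>0" using assms by (auto elim!: nonpos_Ints_cases)
  then have "rGamma s * Gamma s = 1" by (simp add: rGamma_inverse_Gamma Gamma_eq_zero_iff)
  moreover have "zeta0 s = (of_real (2 * pi / of_int k) powr s * of_real (2 * pi / of_int k) powr (- s)) * (rGamma s * Gamma s) * epstein_series A B C s"
    unfolding zeta0_def Lam_series[OF assms] by (simp only: mult_ac)
  ultimately show ?thesis unfolding powr_neg_cancel by simp
qed

lemma zeta0_analytic: assumes "s \<noteq> 0" "s \<noteq> 1" shows "zeta0 analytic_on {s}"
proof -
  have "zeta0 holomorphic_on (UNIV - {0, 1})"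
    unfolding zeta0_def[abs_def] Lam_def
    using k_pos by (intro holomorphic_intros holomorphic_on_subset[OF mellin_part_holomorphic]) auto
  moreover have "open (UNIV - {0, 1 :: complex})" by (intro open_Diff open_UNIV finite_imp_closed) auto
  ultimately show ?thesis using assms unfolding analytic_at by blast
qed

lemma zeta0_meromorphic: "zeta0 meromorphic_on UNIV"
proof -
  have "mellin_part analytic_on UNIV" "rGamma analytic_on (UNIV :: complex set)"
    "(\<lambda>s. of_real (2 * pi / of_int k) powr s) analytic_on (UNIV :: complex set)"
    using mellin_part_holomorphic k_pos by (auto simp: analytic_on_open intro!: holomorphic_intros)
  then have "mellin_part meromorphic_on UNIV" "rGamma meromorphic_on (UNIV :: complex set)"
    "(\<lambda>s. of_real (2 * pi / of_int k) powr s) meromorphic_on (UNIV :: complex set)"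
    by (auto intro: analytic_on_imp_meromorphic_on)
  then show ?thesis unfolding zeta0_def[abs_def] Lam_def
    by (intro meromorphic_intros)
qed

lemma epstein_zeta_eq: "epstein_zeta A B C = remove_sings zeta0"
  unfolding epstein_zeta_def
proof (rule the_equality)
  have n: "remove_sings zeta0 nicely_meromorphic_on UNIV"
    by (rule remove_sings_nicely_meromorphic[OF zeta0_meromorphic])
  have e: "remove_sings zeta0 s = epstein_series A B C s" if "Re s > 1" for s
  proof -
    have "s \<noteq> 0" "s \<noteq> 1" using that by auto
    then show ?thesis using zeta0_analytic zeta0_series[OF that] by simp
  qed
  show "remove_sings zeta0 nicely_meromorphic_on UNIV \<and> (\<forall>s. Re s > 1 \<longrightarrow> remove_sings zeta0 s = epstein_series A B C s)"
    using n e by blast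
  fix f assume f: "f nicely_meromorphic_on UNIV \<and> (\<forall>s. Re s > 1 \<longrightarrow> f s = epstein_series A B C s)"
  show "f = remove_sings zeta0"
    by (rule nicely_meromorphic_eqI[where a = 1]) (use f n e in auto)
qed

theorem epstein_zeta_critical:
  defines "s t \<equiv> 1 / 2 + \<i> * complex_of_real t"
  shows "complex_of_real (2 * pi / sqrt (of_int (form_disc A B C))) powr (- s t) * Gamma (s t) * epstein_zeta A B C (s t) = Lc t"
proof -
  have s0: "s t \<noteq> 0" "s t \<noteq> 1" by (auto simp: s_def complex_eq_iff)
  have "s t \<notin> \<int>\<^sub>\<le>\<^sub>0" by (auto simp: s_def complex_eq_iff elim!: nonpos_Ints_cases)
  then have "rGamma (s t) * Gamma (s t) = 1" by (simp add: rGamma_inverse_Gamma Gamma_eq_zero_iff)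
  moreover have "complex_of_real (2 * pi / of_int k) powr (- s t) * Gamma (s t) * zeta0 (s t)
      = (of_real (2 * pi / of_int k) powr (s t) * of_real (2 * pi / of_int k) powr (- s t)) * (rGamma (s t) * Gamma (s t)) * Lam (s t)"
    unfolding zeta0_def by (simp only: mult_ac)
  moreover have "Lam (s t) = Lc t" unfolding s_def by (rule Lam_critical)
  ultimately show ?thesis
    unfolding epstein_zeta_eq remove_sings_at_analytic[OF zeta0_analytic[OF s0]] sqrt_disc powr_neg_cancel by simp
qed

end

section \<open>Kummer's function as a contour integral\<close>

text \<open>Since (1 - 1/v)^(-a) is the sum of (a)_n / n! v^(-n), the contour integral of this
  kernel collects the series of 1F1(a; 1; w). For |v| > 1 the number 1 - 1/v lies in the right
  half-plane, so the principal logarithm is holomorphic there.\<close>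

definition hyp_kernel :: "complex \<Rightarrow> complex \<Rightarrow> complex \<Rightarrow> complex" where
  "hyp_kernel a w v = exp (w * v) * exp (- a * Ln (1 - 1 / v)) / v"

lemma Re_one_minus_inverse: "norm v > 1 \<Longrightarrow> Re (1 - 1 / v) > 0"
proof -
  assume v: "norm v > 1"
  have "Re (1 / v) \<le> norm (1 / v)" by (rule complex_Re_le_cmod)
  also have "\<dots> < 1" using v by (simp add: norm_divide divide_less_eq)
  finally show ?thesis by simp
qed

lemma hyp_kernel_holomorphic: "hyp_kernel a w holomorphic_on {v. norm v > 1}"
proof -
  have "1 - 1 / v \<notin> \<real>\<^sub>\<le>\<^sub>0" "v \<noteq> 0" if "norm v > 1" for v :: complex
    using Re_one_minus_inverse[OF that] that by (auto simp: complex_nonpos_Reals_iff)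
  then show ?thesis unfolding hyp_kernel_def[abs_def] by (auto intro!: holomorphic_intros)
qed

lemma hypergeo_1F1_series: "hypergeo_1F1 a 1 w = (\<Sum>n. pochhammer a n / (fact n * fact n) * w ^ n)"
  by (simp add: hypergeo_1F1_def eval_fps_def pochhammer_fact[symmetric])

text \<open>The binomial series is integrated term by term; the integral of exp(w v) / v^(n + 1) is
  given by the n-th derivative of exp(w v) at 0, which supplies the second factorial.\<close>

lemma hypergeo_contour:
  assumes R: "R > 1"
  shows "contour_integral (circlepath 0 R) (hyp_kernel a w) = 2 * pi * \<i> * hypergeo_1F1 a 1 w"
proof -
  define b where "b = (\<lambda>n. pochhammer a n / fact n :: complex)"
  have b: "(- a gchoose n) * z ^ n = b n * (- z) ^ n" for n z
    by (simp add: b_def gbinomial_pochhammer power_minus[of z] mult_ac)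
  have sums: "(\<lambda>n. b n * y ^ n) sums exp (- a * Ln (1 - y))" if "norm y < 1" for y
  proof -
    have "1 - y \<noteq> 0" using that by auto
    then show ?thesis using gen_binomial_complex[of "- y" "- a"] that unfolding b by (simp add: powr_def)
  qed
  define f where "f = (\<lambda>n v. exp (w * v) * b n / v ^ Suc n)"
  have f_sums: "(\<lambda>n. f n v) sums hyp_kernel a w v" if v: "norm v > 1" for v
  proof -
    have "norm (1 / v) < 1" using v by (simp add: norm_divide divide_less_eq)
    from sums[OF this] have "(\<lambda>n. exp (w * v) / v * (b n * (1 / v) ^ n)) sums (exp (w * v) / v * exp (- a * Ln (1 - 1 / v)))"
      by (rule sums_mult)
    then show ?thesis by (simp add: f_def hyp_kernel_def power_divide mult_ac)
  qed
  define M where "M = (\<lambda>n. exp (norm w * R) / R * norm (b n * (1 / of_real R) ^ n))"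
  have M: "summable M"
  proof -
    \<comment> \<open>A radius strictly between 1 / R and 1: convergence there yields absolute
      convergence at 1 / R.\<close>
    define R' where "R' = (1 + 1 / R) / 2"
    have R': "1 / R < R'" "R' < 1" using R by (auto simp: R'_def field_simps)
    have "summable (\<lambda>n. b n * (of_real R') ^ n)"
      by (rule sums_summable[OF sums]) (use R' R in \<open>auto simp: abs_if\<close>, smt (verit) zero_less_divide_1_iff)
    then have "summable (\<lambda>n. norm (b n * (1 / of_real R) ^ n))"
      by (rule powser_insidea) (use R' R in \<open>auto simp: norm_divide\<close>)
    then show ?thesis unfolding M_def by (rule summable_mult)
  qed
  have fM: "norm (f n v) \<le> M n" if v: "v \<in> sphere 0 R" for n v
  proof -
    have nv: "norm v = R" using v by simp
    have "Re (w * v) \<le> norm w * R" using complex_Re_le_cmod[of "w * v"] nv by (simp add: norm_mult)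
    then have "exp (Re (w * v)) * (norm (b n) / R ^ Suc n) \<le> exp (norm w * R) * (norm (b n) / R ^ Suc n)"
      using R by (intro mult_right_mono) auto
    then show ?thesis using nv R by (simp add: f_def M_def norm_mult norm_divide norm_power power_divide mult_ac)
  qed
  have ci: "(f n has_contour_integral 2 * pi * \<i> * (b n * w ^ n / fact n)) (circlepath 0 R)" for n
  proof -
    have hd: "(deriv ^^ n) (\<lambda>v. exp (w * v)) = (\<lambda>v. w ^ n * exp (w * v))"
    proof (induction n)
      case (Suc n)
      have "deriv (\<lambda>v. w ^ n * exp (w * v)) = (\<lambda>v. w ^ Suc n * exp (w * v))"
        by (rule ext, rule DERIV_imp_deriv) (auto intro!: derivative_eq_intros)
      then show ?case by (simp add: Suc)
    qed simp
    have "((\<lambda>u. exp (w * u) / (u - 0) ^ Suc n) has_contour_integral 2 * pi * \<i> / fact n * (deriv ^^ n) (\<lambda>v. exp (w * v)) 0) (circlepath 0 R)"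
      by (rule Cauchy_has_contour_integral_higher_derivative_circlepath)
         (use R in \<open>auto intro!: holomorphic_intros continuous_intros\<close>)
    from has_contour_integral_lmul[OF this, of "b n"] show ?thesis
      unfolding f_def hd by (simp add: mult_ac)
  qed
  have ul: "uniform_limit (sphere 0 R) (\<lambda>N v. \<Sum>n<N. f n v) (hyp_kernel a w) sequentially"
  proof -
    have "uniform_limit (sphere 0 R) (\<lambda>N v. \<Sum>n<N. f n v) (\<lambda>v. suminf (\<lambda>n. f n v)) sequentially"
      by (rule Weierstrass_m_test[OF fM M])
    then show ?thesis
      by (rule uniform_limit_cong'[THEN iffD1, rotated -1]) (use f_sums R in \<open>auto simp: sums_iff\<close>)
  qed
  have Sci: "((\<lambda>v. \<Sum>n<N. f n v) has_contour_integral (\<Sum>n<N. 2 * pi * \<i> * (b n * w ^ n / fact n))) (circlepath 0 R)" for N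
    by (rule has_contour_integral_sum) (use ci in auto)
  have "(\<lambda>N. contour_integral (circlepath 0 R) (\<lambda>v. \<Sum>n<N. f n v)) \<longlonglongrightarrow> contour_integral (circlepath 0 R) (hyp_kernel a w)"
  proof (rule contour_integral_uniform_limit_circlepath(2)[OF _ ul])
    show "\<forall>\<^sub>F N in sequentially. (\<lambda>v. \<Sum>n<N. f n v) contour_integrable_on circlepath 0 R"
      by (rule always_eventually) (use Sci in \<open>auto intro: has_contour_integral_integrable\<close>)
  qed (use R in auto)
  then have "(\<lambda>n. 2 * pi * \<i> * (b n * w ^ n / fact n)) sums contour_integral (circlepath 0 R) (hyp_kernel a w)"
    unfolding sums_def contour_integral_unique[OF Sci] .
  then have "contour_integral (circlepath 0 R) (hyp_kernel a w) = (\<Sum>n. 2 * pi * \<i> * (b n * w ^ n / fact n))"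
    by (rule sums_unique)
  moreover have "summable (\<lambda>n. b n * w ^ n / fact n)"
  proof -
    have "summable (\<lambda>n. 2 * pi * \<i> * (b n * w ^ n / fact n))" using \<open>_ sums _\<close> by (rule sums_summable)
    then show ?thesis by (subst (asm) summable_cmult_iff) auto
  qed
  ultimately have "contour_integral (circlepath 0 R) (hyp_kernel a w) = 2 * pi * \<i> * (\<Sum>n. b n * w ^ n / fact n)"
    by (simp only: suminf_mult)
  also have "(\<lambda>n. b n * w ^ n / fact n) = (\<lambda>n. pochhammer a n / (fact n * fact n) * w ^ n)"
    by (simp add: b_def)
  finally show ?thesis unfolding hypergeo_1F1_series .
qed

section \<open>Representation on off-centre circles and growth in the parameter\<close>

definition circ :: "complex \<Rightarrow> real \<Rightarrow> real \<Rightarrow> complex" where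
  "circ c R x = c + of_real R * exp (2 * pi * \<i> * of_real x)"

lemma circ_norm_gt_1: "R - norm c > 1 \<Longrightarrow> norm (circ c R x) > 1"
proof -
  assume R: "R - norm c > 1"
  have "norm (of_real R * exp (2 * pi * \<i> * of_real x) :: complex) = R"
    using R norm_ge_zero[of c] by (simp add: norm_mult del: norm_ge_zero)
  then have "R \<le> norm (circ c R x) + norm c"
    using norm_triangle_ineq4[of "circ c R x" c] by (simp add: circ_def)
  then show ?thesis using R by simp
qed

lemma circ_continuous: "continuous_on A (circ c R)"
  unfolding circ_def[abs_def] by (intro continuous_intros)

text \<open>The condition R - |c| > 1 puts the closed unit disc inside the circle, so the linear
  homotopy to a centred circle stays in |v| > 1. The factor \<open>circ c R x - c\<close> is dv / (2
  pi i dx). The freedom to choose c is exploited at the cusp.\<close>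

lemma hypergeo_integral:
  assumes R: "R - norm c > 1"
  shows "hypergeo_1F1 a 1 w = (LINT x:{0..1}|lborel. hyp_kernel a w (circ c R x) * (circ c R x - c))"
proof -
  have R0: "R > 1" using R norm_ge_zero[of c] by linarith
  have op: "open {v::complex. norm v > 1}" by (intro open_Collect_less continuous_intros)
  have "contour_integral (circlepath c R) (hyp_kernel a w) = contour_integral (circlepath 0 R) (hyp_kernel a w)"
  proof (rule Cauchy_theorem_homotopic_loops[OF _ op hyp_kernel_holomorphic])
    show "homotopic_loops {v. 1 < norm v} (circlepath c R) (circlepath 0 R)"
    proof (rule homotopic_loops_linear)
      fix t :: real
      show "closed_segment (circlepath c R t) (circlepath 0 R t) \<subseteq> {v. 1 < norm v}"
      proof
        fix v assume "v \<in> closed_segment (circlepath c R t) (circlepath 0 R t)"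
        then obtain u where u: "0 \<le> u" "u \<le> 1" "v = (1 - u) *\<^sub>R circlepath c R t + u *\<^sub>R circlepath 0 R t"
          unfolding closed_segment_def by blast
        have "v = circ (of_real (1 - u) * c) R t"
          using u(3) by (simp add: circlepath circ_def scaleR_conv_of_real algebra_simps)
        moreover have "norm (of_real (1 - u) * c) \<le> norm c"
          unfolding norm_mult norm_of_real using u by (intro mult_left_le_one_le) auto
        ultimately show "v \<in> {v. 1 < norm v}" using circ_norm_gt_1[of R "of_real (1 - u) * c" t] R by simp
      qed
    qed auto
  qed auto
  also have "\<dots> = 2 * pi * \<i> * hypergeo_1F1 a 1 w" by (rule hypergeo_contour[OF R0])
  finally have 1: "contour_integral (circlepath c R) (hyp_kernel a w) = 2 * pi * \<i> * hypergeo_1F1 a 1 w" .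
  let ?g = "\<lambda>x. hyp_kernel a w (circ c R x) * (circ c R x - c)"
  have "continuous_on {0..1} ?g"
    by (intro continuous_intros circ_continuous continuous_on_compose2[OF holomorphic_on_imp_continuous_on[OF hyp_kernel_holomorphic]])
       (use circ_norm_gt_1[OF R] in auto)
  then have si: "set_integrable lborel {0..1} ?g" by (rule borel_integrable_atLeastAtMost')
  have "contour_integral (circlepath c R) (hyp_kernel a w) = integral {0..1} (\<lambda>x. 2 * pi * \<i> * ?g x)"
    unfolding contour_integral_integral vector_derivative_circlepath
    by (rule arg_cong2[of _ _ _ _ integral]) (simp_all add: circlepath circ_def mult_ac)
  also have "\<dots> = 2 * pi * \<i> * integral {0..1} ?g" by (rule integral_mult_right)
  also have "integral {0..1} ?g = (LINT x:{0..1}|lborel. ?g x)"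
    by (rule set_borel_integral_eq_integral(2)[OF si, symmetric])
  finally show ?thesis unfolding 1 by simp
qed

text \<open>The values at parameters 1 and 0 come up when the exponential terms of \<open>gs\<close>
  are integrated separately.\<close>

lemma hypergeo_1F1_1: "hypergeo_1F1 1 1 w = exp w"
proof -
  have "(\<lambda>n. pochhammer 1 n / (fact n * fact n) * w ^ n) = (\<lambda>n. w ^ n /\<^sub>R fact n)"
    by (simp add: fun_eq_iff pochhammer_fact[symmetric] scaleR_conv_of_real field_simps)
  then show ?thesis unfolding hypergeo_1F1_series exp_def by simp
qed

lemma hypergeo_1F1_0: "hypergeo_1F1 0 1 w = 1"
proof -
  have "(\<Sum>n. pochhammer 0 n / (fact n * fact n) * w ^ n) = (\<Sum>n\<in>{0}. pochhammer 0 n / (fact n * fact n) * w ^ n)"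
    by (rule suminf_finite) (auto simp: pochhammer_0_left)
  then show ?thesis unfolding hypergeo_1F1_series by simp
qed

text \<open>On a circle of radius R the logarithm of 1 - 1/v is at most 2 / R in modulus, so t
  enters with the exponential rate 2 / R, which can be made arbitrarily small. Multiplying
  \<open>Lc\<close> by 1F1 therefore keeps every decay rate below pi / 2.\<close>

lemma hypergeo_1F1_critical_growth:
  assumes d: "d > 0"
  shows "\<exists>K>0. \<forall>t. norm (hypergeo_1F1 (1 / 2 - \<i> * of_real t) 1 w) \<le> K * exp (d * \<bar>t\<bar>)"
proof -
  \<comment> \<open>R > 2 is the range in which \<open>norm_Ln_le\<close> applies to 1/v, and 2 / R
    \<le> d gives the rate.\<close>
  define R where "R = 3 + 2 / d"
  have R: "R > 2" "2 / R \<le> d" using d by (auto simp: R_def field_simps)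
  define K where "K = exp (norm w * R) * exp (1 / R)"
  have "norm (hypergeo_1F1 (1 / 2 - \<i> * of_real t) 1 w) \<le> K * exp (d * \<bar>t\<bar>)" for t
  proof -
    let ?a = "1 / 2 - \<i> * complex_of_real t"
    let ?g = "\<lambda>x. hyp_kernel ?a w (circ 0 R x) * (circ 0 R x - 0)"
    have b: "norm (?g x) \<le> K * exp (d * \<bar>t\<bar>)" for x
    proof -
      define v where "v = circ 0 R x"
      have nv: "norm v = R" using R by (simp add: v_def circ_def norm_mult)
      define L where "L = Ln (1 - 1 / v)"
      have L: "norm L \<le> 2 / R"
        using norm_Ln_le[of "- (1 / v)"] nv R by (simp add: L_def norm_divide)
      have "Re (- ?a * L) = - (Re L / 2) - t * Im L" by (simp add: algebra_simps)
      also have "\<dots> \<le> 1 / R + d * \<bar>t\<bar>"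
      proof -
        have "- Re L \<le> 2 / R" using abs_Re_le_cmod[of L] L by linarith
        moreover have "- (t * Im L) \<le> \<bar>t\<bar> * d"
        proof -
          have "- (t * Im L) \<le> \<bar>t\<bar> * \<bar>Im L\<bar>" using abs_ge_minus_self[of "t * Im L"] by (simp only: abs_mult)
          also have "\<dots> \<le> \<bar>t\<bar> * d" using abs_Im_le_cmod[of L] L R by (intro mult_left_mono) auto
          finally show ?thesis .
        qed
        ultimately show ?thesis by (simp add: mult.commute)
      qed
      finally have e: "norm (exp (- ?a * L)) \<le> exp (1 / R) * exp (d * \<bar>t\<bar>)" by (simp only: norm_exp_eq_Re exp_le_cancel_iff exp_add[symmetric])
      have "Re (w * v) \<le> norm w * R" using complex_Re_le_cmod[of "w * v"] nv by (simp add: norm_mult)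
      then have e2: "norm (exp (w * v)) \<le> exp (norm w * R)" by simp
      have "v \<noteq> 0" using nv R by auto
      then have g: "?g x = exp (w * v) * exp (- ?a * L)" by (simp add: hyp_kernel_def v_def L_def)
      have "norm (exp (w * v) * exp (- ?a * L)) \<le> exp (norm w * R) * (exp (1 / R) * exp (d * \<bar>t\<bar>))"
        unfolding norm_mult by (intro mult_mono e e2) simp_all
      then show ?thesis by (simp only: g K_def mult.assoc)
    qed
    have "hypergeo_1F1 ?a 1 w = (LINT x:{0..1}|lborel. ?g x)"
      by (rule hypergeo_integral) (use R in simp)
    also have "norm \<dots> \<le> (\<integral>x. norm (indicator {0..1} x *\<^sub>R ?g x) \<partial>lborel)"
      unfolding set_lebesgue_integral_def by (rule integral_norm_bound)
    also have "\<dots> \<le> (\<integral>x. indicator {0..1::real} x * (K * exp (d * \<bar>t\<bar>)) \<partial>lborel)"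
    proof (rule integral_mono')
      show "integrable lborel (\<lambda>x. indicator {0..1::real} x * (K * exp (d * \<bar>t\<bar>)))" by simp
      show "norm (indicator {0..1} x *\<^sub>R ?g x) \<le> indicator {0..1} x * (K * exp (d * \<bar>t\<bar>))" for x
        using b[of x] by (auto simp: indicator_def)
    qed (auto simp: K_def)
    also have "\<dots> = K * exp (d * \<bar>t\<bar>)" by simp
    finally show ?thesis .
  qed
  then show ?thesis by (intro exI[of _ K]) (auto simp: K_def)
qed

lemma hypergeo_1F1_holomorphic: "(\<lambda>a. hypergeo_1F1 a 1 w) holomorphic_on UNIV"
proof -
  let ?f = "\<lambda>x a. indicator {0..1::real} x *\<^sub>R (hyp_kernel a w (circ 0 3 x) * (circ 0 3 x - 0))"
  have "(\<lambda>a. \<integral>x. ?f x a \<partial>lborel) holomorphic_on UNIV"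
  proof (rule holomorphic_on_lebesgue_integral)
    fix a :: complex
    have c: "continuous_on {0..1} (\<lambda>x. hyp_kernel a w (circ 0 3 x) * (circ 0 3 x - 0))"
      by (intro continuous_intros circ_continuous continuous_on_compose2[OF holomorphic_on_imp_continuous_on[OF hyp_kernel_holomorphic]])
         (use circ_norm_gt_1[of 3 0] in auto)
    show "(\<lambda>x. ?f x a) \<in> borel_measurable lborel"
      using borel_measurable_continuous_on_indicator[OF _ c] by simp
    define D where "D = exp (norm w * 3) * exp ((norm a + 1) * (2 / 3))"
    show "\<exists>r>0. \<exists>D. integrable lborel D \<and> (\<forall>x\<in>space lborel. \<forall>z\<in>UNIV \<inter> cball a r. norm (?f x z) \<le> D x)"
    proof (intro exI conjI ballI)
      show "integrable lborel (\<lambda>x. indicator {0..1::real} x * D)" by simp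
      fix x z assume "z \<in> UNIV \<inter> cball a 1"
      then have z: "norm z \<le> norm a + 1" using norm_triangle_sub[of z a] by (simp add: dist_norm norm_minus_commute)
      define v where "v = circ 0 3 x"
      have nv: "norm v = 3" by (simp add: v_def circ_def norm_mult)
      have L: "norm (Ln (1 - 1 / v)) \<le> 2 / 3"
        using norm_Ln_le[of "- (1 / v)"] nv by (simp add: norm_divide)
      have "Re (- z * Ln (1 - 1 / v)) \<le> norm (- z * Ln (1 - 1 / v))" by (rule complex_Re_le_cmod)
      also have "\<dots> \<le> (norm a + 1) * (2 / 3)"
        unfolding norm_mult using z L by (intro mult_mono) auto
      finally have e: "norm (exp (- z * Ln (1 - 1 / v))) \<le> exp ((norm a + 1) * (2 / 3))" by simp
      have "Re (w * v) \<le> norm w * 3" using complex_Re_le_cmod[of "w * v"] nv by (simp add: norm_mult)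
      then have e2: "norm (exp (w * v)) \<le> exp (norm w * 3)" by simp
      have "v \<noteq> 0" using nv by auto
      then have "norm (hyp_kernel z w v * (v - 0)) \<le> D"
        unfolding D_def hyp_kernel_def using e e2 by (simp add: norm_mult mult_mono)
      then show "norm (?f x z) \<le> indicator {0..1} x * D" by (auto simp: v_def indicator_def)
    qed simp
  next
    fix x :: real
    have "norm (circ 0 3 x) = 3" by (simp add: circ_def norm_mult)
    then have "circ 0 3 x \<noteq> 0" by auto
    then show "?f x holomorphic_on UNIV"
      unfolding hyp_kernel_def scaleR_conv_of_real by (intro holomorphic_intros)
  qed simp
  moreover have "hypergeo_1F1 a 1 w = (\<integral>x. ?f x a \<partial>lborel)" for a
    using hypergeo_integral[of 3 0 a w] by (simp add: set_lebesgue_integral_def)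
  ultimately show ?thesis by simp
qed

lemma hypergeo_1F1_critical_continuous: "continuous_on UNIV (\<lambda>t::real. hypergeo_1F1 (1 / 2 - \<i> * of_real t) 1 w)"
  by (rule continuous_on_compose2[OF holomorphic_on_imp_continuous_on[OF hypergeo_1F1_holomorphic]])
     (auto intro!: continuous_intros)

section \<open>The weighted transform near the cusp\<close>

context epstein_form begin

text \<open>After insertion of the contour integral the t-integral becomes the Fourier inversion of
  \<open>Lc\<close> at u x, since (1 - 1/v)^(i t) exp(a t) = exp(- i t u). The hypothesis on u keeps
  these points in the strip where the inversion holds.\<close>

lemma critical_transform:
  fixes w c :: complex and R a :: real
  assumes R: "R - norm c > 1"
  defines "u \<equiv> \<lambda>x. \<i> * of_real a - Ln (1 - 1 / circ c R x)"
  assumes us: "\<And>x. x \<in> {0..1} \<Longrightarrow> u x \<in> strip"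
  shows "(\<integral>t. Lc t * hypergeo_1F1 (1 / 2 - \<i> * of_real t) 1 w * exp (of_real (a * t)) \<partial>lborel) =
    2 * pi * (LINT x:{0..1}|lborel. hyp_kernel (1 / 2) w (circ c R x) * (circ c R x - c) * gs (u x))"
proof -
  let ?v = "circ c R"
  have nv: "norm (?v x) > 1" for x by (rule circ_norm_gt_1[OF R])
  have v0: "?v x \<noteq> 0" for x using nv[of x] by auto
  define A where "A = (\<lambda>x. hyp_kernel (1 / 2) w (?v x) * (?v x - c))"
  have contA: "continuous_on {0..1} A" unfolding A_def
    by (intro continuous_intros circ_continuous continuous_on_compose2[OF holomorphic_on_imp_continuous_on[OF hyp_kernel_holomorphic]])
       (use nv in auto)
  have contu: "continuous_on {0..1} u" unfolding u_def
    using Re_one_minus_inverse[OF nv] v0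
    by (intro continuous_intros circ_continuous) (auto simp: complex_nonpos_Reals_iff not_le)
  \<comment> \<open>A maximum over the compact parameter interval turns |Im u| < pi / 2 into a
    uniform bound b < pi / 2, which provides the majorant for Fubini.\<close>
  have "\<exists>y\<in>{0..1::real}. \<forall>x\<in>{0..1}. \<bar>Im (u x)\<bar> \<le> \<bar>Im (u y)\<bar>"
    by (rule continuous_attains_sup) (auto intro!: continuous_intros contu)
  then obtain y where y: "y \<in> {0..1}" "\<And>x. x \<in> {0..1} \<Longrightarrow> \<bar>Im (u x)\<bar> \<le> \<bar>Im (u y)\<bar>" by blast
  define b where "b = \<bar>Im (u y)\<bar>"
  have b: "0 \<le> b" "b < pi / 2" using us[OF y(1)] by (auto simp: b_def strip_def)
  have "\<exists>y\<in>{0..1::real}. \<forall>x\<in>{0..1}. norm (A x) \<le> norm (A y)"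
    by (rule continuous_attains_sup) (auto intro!: continuous_intros contA)
  then obtain KA where KA: "\<And>x. x \<in> {0..1} \<Longrightarrow> norm (A x) \<le> KA" by blast
  have KA0: "KA \<ge> 0" using KA[of 0] norm_ge_zero[of "A 0"] by (simp del: norm_ge_zero)
  define A' where "A' = (\<lambda>x. indicator {0..1::real} x *\<^sub>R A x)"
  define u' where "u' = (\<lambda>x. indicator {0..1::real} x *\<^sub>R u x)"
  have [measurable]: "A' \<in> borel_measurable borel" "u' \<in> borel_measurable borel"
    unfolding A'_def u'_def by (intro borel_measurable_continuous_on_indicator contA contu; simp)+
  define H where "H = (\<lambda>x t. A' x * (Lc t * exp (- \<i> * of_real t * u' x)))"
  have Hm: "case_prod H \<in> borel_measurable (lborel \<Otimes>\<^sub>M lborel)"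
    unfolding H_def by measurable
  define B where "B = (\<lambda>t. norm (Lc t) * exp (b * \<bar>t\<bar>))"
  have Bi: "integrable lborel B"
  proof -
    obtain K where K: "K > 0" "\<And>t. norm (Lc t) \<le> K * exp (- ((b + pi / 2) / 2) * \<bar>t\<bar>)"
      using Lc_bound[of "(b + pi / 2) / 2"] b by auto
    show ?thesis
    proof (rule Bochner_Integration.integrable_bound[OF integrable_mult_right[OF integrable_exp_abs[of "(pi / 2 - b) / 2"], of K]])
      show "AE t in lborel. norm (B t) \<le> norm (K * exp (- ((pi / 2 - b) / 2) * \<bar>t\<bar>))"
      proof (rule AE_I2)
        fix t
        have "B t \<le> K * exp (- ((b + pi / 2) / 2) * \<bar>t\<bar>) * exp (b * \<bar>t\<bar>)"
          unfolding B_def by (intro mult_right_mono K(2)) simp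
        also have "\<dots> = K * exp (- ((pi / 2 - b) / 2) * \<bar>t\<bar>)"
          unfolding mult.assoc exp_add[symmetric] by (simp add: field_simps)
        finally show "norm (B t) \<le> norm (K * exp (- ((pi / 2 - b) / 2) * \<bar>t\<bar>))"
          using K(1) by (simp add: B_def abs_mult)
      qed
      have "continuous_on UNIV B" unfolding B_def by (intro continuous_intros Lc_continuous)
      then show "B \<in> borel_measurable lborel" by (simp only: measurable_lborel2 borel_measurable_continuous_onI)
    qed (use b in simp)
  qed
  have Hb: "norm (H x t) \<le> indicator {0..1} x * KA * B t" for x t
  proof (cases "x \<in> {0..1}")
    case True
    have "t * Im (u x) \<le> \<bar>t\<bar> * \<bar>Im (u x)\<bar>" using abs_ge_self[of "t * Im (u x)"] by (simp only: abs_mult)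
    also have "\<dots> \<le> b * \<bar>t\<bar>" using mult_left_mono[OF y(2)[OF True], of "\<bar>t\<bar>"] by (simp add: b_def mult.commute)
    finally have "norm (exp (- \<i> * of_real t * u x)) \<le> exp (b * \<bar>t\<bar>)" by simp
    then have "norm (A x * (Lc t * exp (- \<i> * of_real t * u x))) \<le> KA * (norm (Lc t) * exp (b * \<bar>t\<bar>))"
      unfolding norm_mult using KA[OF True] KA0 by (intro mult_mono) auto
    then show ?thesis using True by (simp add: H_def A'_def u'_def B_def)
  qed (simp add: H_def A'_def)
  have Hxi: "integrable lborel (\<lambda>t. H x t)" for x
  proof (rule Bochner_Integration.integrable_bound[OF integrable_mult_right[OF Bi, of "indicator {0..1} x * KA"]])
    show "(\<lambda>t. H x t) \<in> borel_measurable lborel" unfolding H_def by measurable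
    show "AE t in lborel. norm (H x t) \<le> norm (indicator {0..1} x * KA * B t)"
      by (rule AE_I2, rule order_trans[OF Hb], unfold real_norm_def, rule abs_ge_self)
  qed
  have Hint: "integrable (lborel \<Otimes>\<^sub>M lborel) (case_prod H)"
  proof (rule lborel_pair.Fubini_integrable[OF Hm])
    show "integrable lborel (\<lambda>x. \<integral>t. norm (case_prod H (x, t)) \<partial>lborel)"
    proof (rule Bochner_Integration.integrable_bound)
      show "integrable lborel (\<lambda>x. indicator {0..1::real} x * (KA * integral\<^sup>L lborel B))" by simp
      show "(\<lambda>x. \<integral>t. norm (case_prod H (x, t)) \<partial>lborel) \<in> borel_measurable lborel"
        using Hm by measurable
      show "AE x in lborel. norm (\<integral>t. norm (case_prod H (x, t)) \<partial>lborel) \<le> norm (indicator {0..1::real} x * (KA * integral\<^sup>L lborel B))"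
      proof (rule AE_I2)
        fix x :: real
        have "(\<integral>t. norm (H x t) \<partial>lborel) \<le> (\<integral>t. indicator {0..1} x * KA * B t \<partial>lborel)"
          by (rule integral_mono) (use Hxi Bi Hb in auto)
        also have "\<dots> = indicator {0..1} x * (KA * integral\<^sup>L lborel B)" by simp
        finally show "norm (\<integral>t. norm (case_prod H (x, t)) \<partial>lborel) \<le> norm (indicator {0..1::real} x * (KA * integral\<^sup>L lborel B))"
          using integral_nonneg_AE[of "\<lambda>t. norm (H x t)" lborel] by simp
      qed
    qed
    show "AE x in lborel. integrable lborel (\<lambda>t. case_prod H (x, t))" using Hxi by simp
  qed
  have "(\<integral>x. H x t \<partial>lborel) = Lc t * hypergeo_1F1 (1 / 2 - \<i> * of_real t) 1 w * exp (of_real (a * t))" for t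
  proof -
    have "H x t = Lc t * exp (of_real (a * t)) * (indicator {0..1} x *\<^sub>R (hyp_kernel (1 / 2 - \<i> * of_real t) w (?v x) * (?v x - c)))" for x
    proof (cases "x \<in> {0..1}")
      case True
      have e: "exp (- (1 / 2) * Ln (1 - 1 / ?v x)) * exp (- \<i> * of_real t * u x) = exp (of_real (a * t)) * exp (- (1 / 2 - \<i> * of_real t) * Ln (1 - 1 / ?v x))"
        unfolding exp_add[symmetric] by (rule arg_cong[of _ _ exp]) (simp add: u_def algebra_simps)
      have "H x t = (exp (w * ?v x) / ?v x * (?v x - c) * Lc t) * (exp (- (1 / 2) * Ln (1 - 1 / ?v x)) * exp (- \<i> * of_real t * u x))"
        using True by (simp add: H_def A'_def u'_def A_def hyp_kernel_def)
      then show ?thesis unfolding e using True by (simp add: hyp_kernel_def)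
    qed (simp add: H_def A'_def)
    then have "(\<integral>x. H x t \<partial>lborel) = Lc t * exp (of_real (a * t)) * (LINT x:{0..1}|lborel. hyp_kernel (1 / 2 - \<i> * of_real t) w (?v x) * (?v x - c))"
      unfolding set_lebesgue_integral_def by (simp only: integral_mult_right_zero)
    then show ?thesis unfolding hypergeo_integral[OF R, symmetric] by (simp add: mult_ac)
  qed
  then have "(\<integral>t. Lc t * hypergeo_1F1 (1 / 2 - \<i> * of_real t) 1 w * exp (of_real (a * t)) \<partial>lborel) = (\<integral>t. (\<integral>x. H x t \<partial>lborel) \<partial>lborel)"
    by simp
  also have "\<dots> = (\<integral>x. (\<integral>t. H x t \<partial>lborel) \<partial>lborel)"
    by (rule lborel_pair.Fubini_integral[OF Hint])
  also have "\<dots> = (\<integral>x. 2 * pi * (indicator {0..1} x *\<^sub>R (A x * gs (u x))) \<partial>lborel)"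
  proof (intro Bochner_Integration.integral_cong refl)
    fix x :: real
    show "(\<integral>t. H x t \<partial>lborel) = 2 * pi * (indicator {0..1} x *\<^sub>R (A x * gs (u x)))"
    proof (cases "x \<in> {0..1}")
      case True
      then show ?thesis unfolding H_def integral_mult_right_zero
        using Lc_inversion[OF us[OF True]] by (simp add: A'_def u'_def)
    qed (simp add: H_def A'_def)
  qed
  finally show ?thesis by (simp only: integral_mult_right_zero set_lebesgue_integral_def A_def)
qed

text \<open>The powers exp(u / 2) and exp(- u / 2) in \<open>gs\<close> combine with (1 -
  1/v)^(-1/2) into kernels with parameters 1 and 0. The two terms without \<open>theta\<close> are
  therefore values of 1F1, namely exp w and 1, and only the term with \<open>theta\<close> remains
  to be estimated.\<close>

lemma critical_transform_split:
  fixes w c :: complex and R a :: real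
  assumes R: "R - norm c > 1"
  defines "u \<equiv> \<lambda>x. \<i> * of_real a - Ln (1 - 1 / circ c R x)"
  assumes us: "\<And>x. x \<in> {0..1} \<Longrightarrow> u x \<in> strip"
  shows "(\<integral>t. Lc t * hypergeo_1F1 (1 / 2 - \<i> * of_real t) 1 w * exp (of_real (a * t)) \<partial>lborel) =
    2 * pi * exp (\<i> * of_real a / 2) * (LINT x:{0..1}|lborel. hyp_kernel 1 w (circ c R x) * (circ c R x - c) * theta (exp (u x)))
    - 2 * pi * (exp (\<i> * of_real a / 2) * exp w + exp (- (\<i> * of_real a / 2)))"
proof -
  let ?v = "circ c R"
  let ?g = "\<lambda>b x. hyp_kernel b w (?v x) * (?v x - c)"
  have nv: "norm (?v x) > 1" for x by (rule circ_norm_gt_1[OF R])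
  have v0: "?v x \<noteq> 0" for x using nv[of x] by auto
  have contu: "continuous_on {0..1} u" unfolding u_def
    using Re_one_minus_inverse[OF nv] v0
    by (intro continuous_intros circ_continuous) (auto simp: complex_nonpos_Reals_iff not_le)
  have contg: "continuous_on {0..1} (?g b)" for b
    by (intro continuous_intros circ_continuous continuous_on_compose2[OF holomorphic_on_imp_continuous_on[OF hyp_kernel_holomorphic]])
       (use nv in auto)
  have conth: "continuous_on {0..1} (\<lambda>x. theta (exp (u x)))"
    by (rule continuous_on_compose2[OF holomorphic_on_imp_continuous_on[OF theta_holomorphic] continuous_on_exp[OF contu]])
       (use us Re_exp_strip in auto)
  have i1: "set_integrable lborel {0..1} (?g b)" for b by (rule borel_integrable_atLeastAtMost'[OF contg])
  have i2: "set_integrable lborel {0..1} (\<lambda>x. ?g 1 x * theta (exp (u x)))"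
    by (rule borel_integrable_atLeastAtMost'[OF continuous_on_mult[OF contg conth]])
  let ?E = "exp (\<i> * complex_of_real a / 2)" and ?E' = "exp (- (\<i> * complex_of_real a / 2))"
  have e: "?g (1 / 2) x * gs (u x) = ?E * (?g 1 x * theta (exp (u x))) - ?E * ?g 1 x - ?E' * ?g 0 x" for x
  proof -
    let ?L = "Ln (1 - 1 / ?v x)"
    have e1: "exp (- (1 / 2) * ?L) * exp (u x / 2) = ?E * exp (- 1 * ?L)"
      "exp (- (1 / 2) * ?L) * exp (- (u x / 2)) = ?E' * exp (- 0 * ?L)"
      unfolding exp_add[symmetric] by (rule arg_cong[of _ _ exp]; simp add: u_def field_simps)+
    let ?q = "exp (w * ?v x) / ?v x * (?v x - c)"
    have g: "?g b x = ?q * exp (- b * ?L)" for b by (simp add: hyp_kernel_def)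
    have "q * X * (P * T - M) = q * (X * P) * T - q * (X * M)" for q X P T M :: complex
      by (simp add: algebra_simps)
    then have "?g (1 / 2) x * gs (u x) = ?q * (exp (- (1 / 2) * ?L) * exp (u x / 2)) * (theta (exp (u x)) - 1) - ?q * (exp (- (1 / 2) * ?L) * exp (- (u x / 2)))"
      unfolding g gs_def .
    moreover have "q * (E * Y) * (T - 1) - q * (E' * Z) = E * (q * Y * T) - E * (q * Y) - E' * (q * Z)" for q E Y T E' Z :: complex
      by (simp add: algebra_simps)
    ultimately show ?thesis unfolding e1 g by (simp only:)
  qed
  have "(LINT x:{0..1}|lborel. ?g (1 / 2) x * gs (u x)) =
     ?E * (LINT x:{0..1}|lborel. ?g 1 x * theta (exp (u x))) - ?E * (LINT x:{0..1}|lborel. ?g 1 x) - ?E' * (LINT x:{0..1}|lborel. ?g 0 x)"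
    unfolding e using i1 i2 by (simp add: set_integral_diff)
  also have "(LINT x:{0..1}|lborel. ?g 1 x) = exp w"
    using hypergeo_integral[OF R, of 1 w] by (simp add: hypergeo_1F1_1)
  also have "(LINT x:{0..1}|lborel. ?g 0 x) = 1"
    using hypergeo_integral[OF R, of 0 w] by (simp add: hypergeo_1F1_0)
  finally have f: "(LINT x:{0..1}|lborel. ?g (1 / 2) x * gs (u x)) = ?E * (LINT x:{0..1}|lborel. ?g 1 x * theta (exp (u x))) - ?E * exp w - ?E' * 1" .
  have J: "(\<integral>t. Lc t * hypergeo_1F1 (1 / 2 - \<i> * of_real t) 1 w * exp (of_real (a * t)) \<partial>lborel) =
     2 * pi * (LINT x:{0..1}|lborel. ?g (1 / 2) x * gs (u x))"
    unfolding u_def by (rule critical_transform[OF R]) (use us in \<open>simp add: u_def\<close>)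
  have gen: "q * (E * I - E * W - E' * 1) = q * E * I - q * (E * W + E')" for q E I W E' :: complex
    by (simp add: algebra_simps)
  show ?thesis unfolding J f by (rule gen)
qed

text \<open>The sharp exponent in the decay of \<open>theta\<close> at the cusp is
  \<open>2\<pi> / k^3\<close>; the choice \<open>r = \<surd>(kap / |w|)\<close> is the optimal one, and the
  square \<open>region_D\<close> is exactly the set of \<open>z\<close> for which it works.\<close>

lemma region_optimal_circle:
  fixes z :: complex and kap :: real
  assumes kap: "kap > 0" and x: "(Re z)\<^sup>2 < 2 * kap" and y: "(Im z)\<^sup>2 < 2 * kap"
  defines "w \<equiv> z\<^sup>2 / 4"
  shows "\<exists>r>1. \<exists>c0>0. \<forall>xi. norm xi = 1 \<longrightarrow>
           Re (w * of_real r * xi) + Re (\<i> * of_real kap / (of_real r * xi)) + Im w - kap \<le> - c0"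
proof -
  define X Y where "X = Re z" and "Y = Im z"
  have w: "Re w = (X\<^sup>2 - Y\<^sup>2) / 4" "Im w = X * Y / 2"
    by (simp_all add: w_def X_def Y_def Re_power2 Im_power2)
  have nw: "norm w = (X\<^sup>2 + Y\<^sup>2) / 4"
    by (simp add: w_def norm_power norm_divide X_def Y_def cmod_power2)
  have XY: "X\<^sup>2 < 2 * kap" "Y\<^sup>2 < 2 * kap" using x y by (auto simp: X_def Y_def)
  \<comment> \<open>For w = 0 there is nothing to balance and any r > 1 works; 2 is a default
    value.\<close>
  define r where "r = (if w = 0 then 2 else sqrt (kap / norm w))"
  define N where "N = norm (w * of_real r - \<i> * of_real (kap / r))"
  have r: "r > 1"
  proof (cases "w = 0")
    case False
    have "norm w < kap" using XY nw by simp
    then show ?thesis using False by (simp add: r_def)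
  qed (simp add: r_def)
  have pos: "kap - Im w > 0"
  proof -
    have "2 * (X * Y) \<le> X\<^sup>2 + Y\<^sup>2" using sum_squares_bound[of X Y] by simp
    then show ?thesis using XY w by simp
  qed
  have N2: "N < kap - Im w"
  proof (cases "w = 0")
    case True
    then show ?thesis using kap by (simp add: N_def r_def norm_mult)
  next
    case False
    have r2: "r\<^sup>2 * norm w = kap" "(kap / r)\<^sup>2 = kap * norm w"
    proof -
      show r1: "r\<^sup>2 * norm w = kap" using False kap by (simp add: r_def)
      have "(kap / r)\<^sup>2 * r\<^sup>2 = kap * norm w * r\<^sup>2" using r r1 by (simp add: power_divide power2_eq_square mult_ac)
      then show "(kap / r)\<^sup>2 = kap * norm w" using r by simp
    qed
    have "N\<^sup>2 = (Re w * r)\<^sup>2 + (Im w * r - kap / r)\<^sup>2" by (simp add: N_def cmod_power2)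
    also have "\<dots> = r\<^sup>2 * ((Re w)\<^sup>2 + (Im w)\<^sup>2) + (kap / r)\<^sup>2 - 2 * Im w * kap"
      using r by (simp add: power2_eq_square algebra_simps)
    also have "\<dots> = r\<^sup>2 * norm w * norm w + kap * norm w - 2 * Im w * kap"
      unfolding r2(2) cmod_power2[symmetric] by (simp add: power2_eq_square)
    also have "\<dots> = 2 * kap * (norm w - Im w)" unfolding r2 by (simp add: algebra_simps)
    \<comment> \<open>This factorisation produces the square: the two factors are positive by the
      bounds on Re z and Im z.\<close>
    also have "\<dots> = (kap - Im w)\<^sup>2 - (kap - X\<^sup>2 / 2) * (kap - Y\<^sup>2 / 2)"
      unfolding nw w by (simp add: power2_eq_square field_simps)
    also have "\<dots> < (kap - Im w)\<^sup>2"
      using XY by (simp add: mult_pos_pos)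
    finally have "N\<^sup>2 < (kap - Im w)\<^sup>2" .
    then show ?thesis using pos by (meson less_imp_le power_less_imp_less_base)
  qed
  have "Re (w * of_real r * xi) + Re (\<i> * of_real kap / (of_real r * xi)) \<le> N" if xi: "norm xi = 1" for xi
  proof -
    \<comment> \<open>On the unit circle 1 / xi is the conjugate of xi, so both terms become real
      parts of multiples of xi and their sum is at most N.\<close>
    have "xi * cnj xi = 1" using complex_norm_square[of xi] xi by simp
    moreover have "xi \<noteq> 0" using xi by auto
    ultimately have inv: "1 / xi = cnj xi" by (simp add: field_simps)
    have "\<i> * of_real kap / (of_real r * xi) = \<i> * of_real (kap / r) * (1 / xi)" by simp
    then have "\<i> * of_real kap / (of_real r * xi) = \<i> * of_real (kap / r) * cnj xi" unfolding inv .
    then have "Re (\<i> * of_real kap / (of_real r * xi)) = Re (- (\<i> * of_real (kap / r)) * xi)" by simp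
    then have "Re (w * of_real r * xi) + Re (\<i> * of_real kap / (of_real r * xi)) = Re ((w * of_real r - \<i> * of_real (kap / r)) * xi)"
      by (simp add: algebra_simps)
    also have "\<dots> \<le> norm ((w * of_real r - \<i> * of_real (kap / r)) * xi)" by (rule complex_Re_le_cmod)
    also have "\<dots> = N" using xi by (simp add: N_def norm_mult)
    finally show ?thesis .
  qed
  then show ?thesis using r N2
    by (intro exI[of _ r] conjI exI[of _ "kap - Im w - N"]) force+
qed


text \<open>With D = 2 sin (b / 2) and P = exp(i b / 2), the circle with centre - i P / D and radius
  r / D makes 1 / (exp u - i) an exact affine expression E in 1 / xi. Along it \<open>theta\<close>
  is bounded by exp(- kap Re E) up to the factor |E| and a constant, while exp(w v) has an exponent
  of the same order 1 / D; the hypothesis \<open>opt\<close> is the balance of the two in the limit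
  b -> 0.\<close>

lemma cusp_flat:
  fixes w :: complex and r c0 :: real
  defines "kap \<equiv> 2 * pi / (of_int k) ^ 3"
  assumes r: "r > 1" and c0: "c0 > 0"
    and opt: "\<And>xi. norm xi = 1 \<Longrightarrow> Re (w * of_real r * xi) + Re (\<i> * of_real kap / (of_real r * xi)) + Im w - kap \<le> - c0"
  shows "\<exists>K>0. \<exists>c1>0. \<forall>\<^sub>F b in at_right 0.
    norm ((\<integral>t. Lc t * hypergeo_1F1 (1 / 2 - \<i> * of_real t) 1 w * exp (of_real ((pi / 2 - b) * t)) \<partial>lborel)
      + 2 * pi * (exp (\<i> * of_real (pi / 2 - b) / 2) * exp w + exp (- (\<i> * of_real (pi / 2 - b) / 2)))) \<le> K * exp (- c1 / b)"
proof -
  have kap: "kap > 0" using k_pos' by (simp add: kap_def)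
  obtain K0 where K0: "\<And>e. Re e > 0 \<Longrightarrow> Re (1 / e) \<ge> 1 \<Longrightarrow> norm (theta (\<i> + e)) \<le> K0 / norm e * exp (- kap * Re (1 / e))"
    using theta_cusp_bound unfolding kap_def by blast
  define K2 where "K2 = 2 * r / (r - 1) * (\<bar>K0\<bar> * 2 * (4 / c0))"
  have K2: "K2 \<ge> 0" using r c0 by (simp add: K2_def)
  define S where "S = (\<lambda>b::real. 2 * sin (b / 2))"
  \<comment> \<open>Smallness of S keeps the circle clear of the unit disc, the condition with 1 / r
    makes Re E at least 1, and the last one bounds the effect of replacing P by 1 in the exponent by
    half of c0.\<close>
  have ev: "\<forall>\<^sub>F b in at_right 0. 0 < b \<and> b < pi / 2 \<and> S b < (r - 1) / 2 \<and> cos (b / 2) - 1 / r - S b > 0 \<and>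
     Re (- \<i> * w * exp (\<i> * of_real b / 2)) - Im w + kap - kap * cos (b / 2) < c0 / 2"
  proof (intro eventually_conj)
    show "\<forall>\<^sub>F b in at_right (0::real). 0 < b" by (rule eventually_at_right_less)
    show "\<forall>\<^sub>F b in at_right (0::real). b < pi / 2" by (intro order_tendstoD(2)[OF tendsto_ident_at]) simp
    have "(S \<longlongrightarrow> 2 * sin (0 / 2)) (at_right 0)" unfolding S_def by (intro tendsto_intros) auto
    then show "\<forall>\<^sub>F b in at_right 0. S b < (r - 1) / 2" by (rule order_tendstoD) (use r in simp)
    have "((\<lambda>b. cos (b / 2) - 1 / r - S b) \<longlongrightarrow> cos (0 / 2) - 1 / r - 2 * sin (0 / 2)) (at_right 0)"
      unfolding S_def by (intro tendsto_intros) auto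
    then show "\<forall>\<^sub>F b in at_right 0. cos (b / 2) - 1 / r - S b > 0" by (rule order_tendstoD) (use r in simp)
    have "((\<lambda>b. Re (- \<i> * w * exp (\<i> * of_real b / 2)) - Im w + kap - kap * cos (b / 2)) \<longlongrightarrow> Re (- \<i> * w * exp (\<i> * of_real 0 / 2)) - Im w + kap - kap * cos (0 / 2)) (at_right 0)"
      by (intro tendsto_intros) auto
    then show "\<forall>\<^sub>F b in at_right 0. Re (- \<i> * w * exp (\<i> * of_real b / 2)) - Im w + kap - kap * cos (b / 2) < c0 / 2"
      by (rule order_tendstoD) (use c0 in simp)
  qed
  have main: "norm ((\<integral>t. Lc t * hypergeo_1F1 (1 / 2 - \<i> * of_real t) 1 w * exp (of_real ((pi / 2 - b) * t)) \<partial>lborel)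
      + 2 * pi * (exp (\<i> * of_real (pi / 2 - b) / 2) * exp w + exp (- (\<i> * of_real (pi / 2 - b) / 2)))) \<le> (2 * pi * K2 + 1) * exp (- (c0 / 4) / b)"
    if b: "0 < b" "b < pi / 2" and Sb: "S b < (r - 1) / 2" and cS: "cos (b / 2) - 1 / r - S b > 0"
      and err: "Re (- \<i> * w * exp (\<i> * of_real b / 2)) - Im w + kap - kap * cos (b / 2) < c0 / 2" for b
  proof -
    define a where "a = pi / 2 - b"
    define D where "D = S b"
    have D: "D > 0" "D \<le> b" "2 * D < r - 1"
    proof -
      show "D > 0" unfolding D_def S_def using b by (auto intro!: sin_gt_zero)
      show "D \<le> b" unfolding D_def S_def using sin_x_le_x[of "b / 2"] b by simp
      show "2 * D < r - 1" using Sb by (simp add: D_def)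
    qed
    define P P' where "P = exp (\<i> * complex_of_real b / 2)" and "P' = exp (- (\<i> * complex_of_real b / 2))"
    have PP: "P * P' = 1" by (simp add: P_def P'_def exp_add[symmetric])
    have nP: "norm P = 1" and ReP: "Re P = cos (b / 2)"
      by (simp_all add: P_def Re_exp)
    have iD: "\<i> * of_real D = P - P'"
      by (simp add: P_def P'_def D_def S_def complex_eq_iff Re_exp Im_exp)
    have ea: "exp (\<i> * of_real a) = \<i> * P' * P'"
    proof -
      have "exp (\<i> * of_real a) = exp (\<i> * of_real pi / 2) * exp (- (\<i> * complex_of_real b / 2)) * exp (- (\<i> * complex_of_real b / 2))"
        unfolding exp_add[symmetric] by (rule arg_cong[of _ _ exp]) (simp add: a_def field_simps)
      moreover have "exp (\<i> * of_real pi / 2) = \<i>" by (simp add: complex_eq_iff Re_exp Im_exp)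
      ultimately show ?thesis by (simp add: P'_def)
    qed
    \<comment> \<open>Because i D = P - P', this centre turns (exp u - i) (v - 1) into the single
      term P' r xi.\<close>
    define c where "c = - \<i> * P / of_real D"
    define R where "R = r / D"
    have nc: "norm c = 1 / D" using D by (simp add: c_def norm_mult norm_divide nP)
    have R1: "R - norm c > 1" unfolding R_def nc using D by (simp add: field_simps)
    define u where "u = (\<lambda>x. \<i> * of_real a - Ln (1 - 1 / circ c R x))"
    define v where "v = circ c R"
    define xi where "xi = (\<lambda>x::real. exp (2 * pi * \<i> * of_real x))"
    have nxi: "norm (xi x) = 1" "xi x \<noteq> 0" for x by (simp_all add: xi_def)
    have vx: "v x = c + of_real R * xi x" for x by (simp add: v_def circ_def xi_def)
    have nv: "norm (v x) > 1" for x unfolding v_def by (rule circ_norm_gt_1[OF R1])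
    have v01: "v x \<noteq> 0" "v x \<noteq> 1" "1 - 1 / v x \<noteq> 0" for x
      using nv[of x] Re_one_minus_inverse[OF nv, of x] by auto
    define E where "E = (\<lambda>x. P / of_real D - \<i> / (of_real D * of_real r * xi x))"
    define e where "e = (\<lambda>x. exp (u x) - \<i>)"
    have eu: "exp (u x) = \<i> * P' * P' * v x / (v x - 1)" for x
      using v01[of x] by (simp add: u_def exp_diff ea v_def[symmetric] field_simps)
    have vm1: "v x - 1 = (of_real r * xi x - \<i> * P') / of_real D" for x
    proof -
      have "\<i> * P + of_real D = \<i> * P'" using arg_cong[OF iD, of "\<lambda>y. - \<i> * y"] by (simp add: algebra_simps)
      then show ?thesis using D by (simp add: vx c_def R_def field_simps)
    qed
    have eE: "e x * E x = 1" for x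
    proof -
      have "e x * (v x - 1) = (\<i> * P' * P' - \<i>) * v x + \<i>"
        using v01[of x] by (simp add: e_def eu field_simps)
      also have "\<i> * P' * P' - \<i> = of_real D * P'"
      proof -
        have "\<i> * P' * P' - \<i> = \<i> * P' * (P' - P)" using PP by (simp add: algebra_simps)
        also have "P' - P = - (\<i> * of_real D)" unfolding iD by simp
        finally show ?thesis by (simp add: algebra_simps)
      qed
      also have "of_real D * P' * v x + \<i> = P' * of_real r * xi x"
        using D PP by (simp add: vx c_def R_def field_simps)
      finally have 1: "e x * (v x - 1) = P' * of_real r * xi x" .
      have 2: "(v x - 1) = (of_real r * xi x) * P' * E x"
        unfolding vm1 E_def using D r nxi(2)[of x] PP by (simp add: field_simps)
      have "e x * E x * ((of_real r * xi x) * P') = e x * (v x - 1)" unfolding 2 by simp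
      also have "\<dots> = 1 * ((of_real r * xi x) * P')" unfolding 1 by simp
      finally show ?thesis using r nxi(2)[of x] PP by (auto simp: mult_cancel_right)
    qed
    have e0: "e x \<noteq> 0" for x using eE[of x] by auto
    have Einv: "1 / e x = E x" for x using eE[of x] e0[of x] by (simp add: divide_eq_eq mult.commute)
    have ReE: "Re (E x) = (cos (b / 2) - Re (\<i> / (of_real r * xi x))) / D" for x
    proof -
      have "E x = (P - \<i> / (of_real r * xi x)) / of_real D" by (simp add: E_def diff_divide_distrib)
      then show ?thesis by (simp add: ReP)
    qed
    have Rei: "Re (\<i> / (of_real r * xi x)) \<le> 1 / r" for x
      using complex_Re_le_cmod[of "\<i> / (of_real r * xi x)"] r nxi(1)[of x] by (simp add: norm_divide norm_mult)
    have E1: "Re (E x) \<ge> 1" for x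
    proof -
      have "D \<le> cos (b / 2) - Re (\<i> / (of_real r * xi x))" using cS Rei[of x] by (simp add: D_def)
      then show ?thesis unfolding ReE using D by (simp add: field_simps)
    qed
    have Ree: "Re (e x) > 0" for x
    proof -
      have E0: "E x \<noteq> 0" using eE[of x] by auto
      then have "e x = 1 / E x" using eE[of x] by (simp add: eq_divide_eq)
      with E0 show ?thesis using E1[of x] by (simp add: Re_divide' cmod_power2) (intro divide_pos_pos add_pos_nonneg; simp)
    qed
    \<comment> \<open>The logarithm alone gives only Im u < pi; positivity of Re (exp u) excludes
      the rest.\<close>
    have us: "u x \<in> strip" for x
    proof -
      have "\<bar>Im (Ln (1 - 1 / v x))\<bar> < pi / 2"
        using Re_Ln_pos_lt[OF v01(3)] Re_one_minus_inverse[OF nv] by blast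
      then have i: "- (pi / 2) < Im (u x)" "Im (u x) < pi"
        using b by (auto simp: u_def a_def v_def abs_less_iff)
      have "Re (exp (u x)) > 0" using Ree[of x] by (simp add: e_def)
      then have cp: "cos (Im (u x)) > 0" by (simp add: Re_exp zero_less_mult_iff)
      have "Im (u x) < pi / 2"
      proof (rule ccontr)
        assume "\<not> Im (u x) < pi / 2"
        then have "cos (Im (u x)) \<le> cos (pi / 2)" using i by (intro cos_monotone_0_pi_le) auto
        then show False using cp by simp
      qed
      then show ?thesis using i by (simp add: strip_def abs_less_iff)
    qed
    have bound: "norm (hyp_kernel 1 w (v x) * (v x - c) * theta (exp (u x))) \<le> K2 * exp (- (c0 / 4) / b)" for x
    proof -
      have "exp (- Ln (1 - 1 / v x)) = 1 / (1 - 1 / v x)" using v01[of x] by (simp add: exp_minus inverse_eq_divide)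
      then have "hyp_kernel 1 w (v x) = exp (w * v x) * (1 / (1 - 1 / v x)) / v x"
        by (simp only: hyp_kernel_def mult_minus_left mult_1_left)
      also have "\<dots> = exp (w * v x) / ((1 - 1 / v x) * v x)" by simp
      also have "(1 - 1 / v x) * v x = v x - 1" using v01[of x] by (simp add: field_simps)
      finally have hk: "hyp_kernel 1 w (v x) = exp (w * v x) / (v x - 1)" .
      have th: "norm (theta (exp (u x))) \<le> \<bar>K0\<bar> * norm (E x) * exp (- kap * Re (E x))"
      proof -
        have "norm (theta (\<i> + e x)) \<le> K0 / norm (e x) * exp (- kap * Re (1 / e x))"
          by (rule K0[OF Ree]) (use E1[of x] Einv[of x] in simp)
        also have "K0 / norm (e x) = K0 * norm (E x)" unfolding Einv[symmetric] by (simp add: norm_divide)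
        also have "K0 * norm (E x) * exp (- kap * Re (1 / e x)) \<le> \<bar>K0\<bar> * norm (E x) * exp (- kap * Re (E x))"
          unfolding Einv by (intro mult_right_mono) auto
        finally show ?thesis by (simp add: e_def)
      qed
      have nE: "norm (E x) \<le> 2 / D"
      proof -
        have "norm (E x) \<le> norm (P / of_real D) + norm (\<i> / (of_real D * of_real r * xi x))"
          unfolding E_def by (rule norm_triangle_ineq4)
        also have "\<dots> = 1 / D + 1 / (D * r)" using D r nxi(1)[of x] by (simp add: norm_divide norm_mult nP)
        also have "\<dots> \<le> 2 / D" using D r by (simp add: field_simps)
        finally show ?thesis .
      qed
      have ratio: "norm ((v x - c) / (v x - 1)) \<le> 2 * r / (r - 1)"
      proof -
        have n1: "norm (v x - c) = r / D" using D r nxi(1)[of x] by (simp add: vx R_def norm_mult norm_divide)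
        have "norm (v x - c) \<le> norm (v x - 1) + norm (1 - c)" using norm_triangle_ineq[of "v x - 1" "1 - c"] by simp
        moreover have "norm (1 - c) \<le> 1 + 1 / D" using norm_triangle_ineq4[of 1 c] nc by simp
        ultimately have "r / D - 1 - 1 / D \<le> norm (v x - 1)" using n1 by linarith
        moreover have "(r - 1) / (2 * D) \<le> r / D - 1 - 1 / D"
        proof -
          have "r / D - 1 - 1 / D - (r - 1) / (2 * D) = (r - 1 - 2 * D) / (2 * D)" using D by (simp add: field_simps)
          also have "\<dots> \<ge> 0" using D by simp
          finally show ?thesis by simp
        qed
        ultimately have n2: "(r - 1) / (2 * D) \<le> norm (v x - 1)" by linarith
        have "norm ((v x - c) / (v x - 1)) = (r / D) / norm (v x - 1)" by (simp add: norm_divide n1)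
        also have "\<dots> \<le> (r / D) / ((r - 1) / (2 * D))"
          using n2 D r v01(2)[of x] by (intro divide_left_mono mult_pos_pos) auto
        also have "\<dots> = 2 * r / (r - 1)" using D r by (simp add: field_simps)
        finally show ?thesis .
      qed
      \<comment> \<open>The gain c0 from \<open>opt\<close> minus the loss of at most c0 / 2 from P
        leaves half of c0.\<close>
      have expo: "Re (w * v x) - kap * Re (E x) \<le> - (c0 / 2) / D"
      proof -
        have "w * v x = (- \<i> * w * P + w * of_real r * xi x) / of_real D"
          using D by (simp add: vx c_def R_def field_simps)
        then have 1: "Re (w * v x) = (Re (- \<i> * w * P) + Re (w * of_real r * xi x)) / D" by simp
        have Rm: "Re (of_real kap * y) = kap * Re y" for y by simp
        have ik: "\<i> * of_real kap / (of_real r * xi x) = of_real kap * (\<i> / (of_real r * xi x))" by simp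
        have e2: "Re (\<i> * of_real kap / (of_real r * xi x)) = kap * Re (\<i> / (of_real r * xi x))" unfolding ik by (rule Rm)
        have 2: "Re (w * of_real r * xi x) + kap * Re (\<i> / (of_real r * xi x)) + Im w - kap \<le> - c0"
          using opt[OF nxi(1)[of x]] by (simp only: e2)
        have 3: "Re (- \<i> * w * P) - Im w + kap - kap * cos (b / 2) < c0 / 2" using err by (simp only: P_def)
        have "Re (w * v x) - kap * Re (E x) = (Re (- \<i> * w * P) + Re (w * of_real r * xi x) - kap * (cos (b / 2) - Re (\<i> / (of_real r * xi x)))) / D"
          unfolding 1 ReE by (simp add: diff_divide_distrib right_diff_distrib)
        also have "\<dots> \<le> (- (c0 / 2)) / D"
        proof (rule divide_right_mono)
          show "Re (- \<i> * w * P) + Re (w * of_real r * xi x) - kap * (cos (b / 2) - Re (\<i> / (of_real r * xi x))) \<le> - (c0 / 2)"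
            using 2 3 unfolding right_diff_distrib by linarith
        qed (use D in simp)
        finally show ?thesis .
      qed
      have "norm (hyp_kernel 1 w (v x) * (v x - c) * theta (exp (u x))) =
          exp (Re (w * v x)) * norm ((v x - c) / (v x - 1)) * norm (theta (exp (u x)))"
        unfolding hk by (simp add: norm_mult norm_divide)
      also have "\<dots> \<le> exp (Re (w * v x)) * (2 * r / (r - 1)) * (\<bar>K0\<bar> * (2 / D) * exp (- kap * Re (E x)))"
      proof (intro mult_mono ratio)
        have "\<bar>K0\<bar> * norm (E x) * exp (- kap * Re (E x)) \<le> \<bar>K0\<bar> * (2 / D) * exp (- kap * Re (E x))"
          by (intro mult_right_mono mult_left_mono nE) auto
        then show "norm (theta (exp (u x))) \<le> \<bar>K0\<bar> * (2 / D) * exp (- kap * Re (E x))" using th by linarith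
      qed (use r in auto)
      also have "\<dots> = 2 * r / (r - 1) * (\<bar>K0\<bar> * 2) * (exp (Re (w * v x) - kap * Re (E x)) / D)"
      proof -
        have "exp (p - q) = exp p * exp (- q)" for p q :: real by (simp add: exp_add[symmetric])
        then have ep: "exp (Re (w * v x) - kap * Re (E x)) = exp (Re (w * v x)) * exp (- kap * Re (E x))"
          by (simp only: mult_minus_left)
        have "p * a * (y * (2 / D) * q) = a * (y * 2) * (p * q / D)" for p a y q :: real by simp
        then show ?thesis unfolding ep .
      qed
      also have "\<dots> \<le> 2 * r / (r - 1) * (\<bar>K0\<bar> * 2) * (4 / c0 * exp (- (c0 / 4) / b))"
      proof (rule mult_left_mono)
        \<comment> \<open>Half of the remaining exponent absorbs the factor 1 / D contributed by
          |E|; then D \<le> b allows D to be replaced by b.\<close>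
        define X where "X = c0 / 4 / D"
        have X: "X > 0" using D c0 by (simp add: X_def)
        have "X \<le> exp X" using exp_ge_add_one_self[of X] by linarith
        then have "X * exp (- 2 * X) \<le> exp X * exp (- 2 * X)" by (intro mult_right_mono) auto
        then have XX: "X * exp (- 2 * X) \<le> exp (- X)" by (simp add: exp_add[symmetric])
        have "exp (Re (w * v x) - kap * Re (E x)) / D \<le> exp (- (c0 / 2) / D) / D"
          using expo D by (intro divide_right_mono) auto
        also have "\<dots> = 4 / c0 * (X * exp (- 2 * X))" using c0 by (simp add: X_def)
        also have "\<dots> \<le> 4 / c0 * exp (- X)" using XX c0 by (intro mult_left_mono) auto
        also have "\<dots> \<le> 4 / c0 * exp (- (c0 / 4) / b)"
          using D b c0 by (intro mult_left_mono) (auto simp: X_def intro!: divide_left_mono)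
        finally show "exp (Re (w * v x) - kap * Re (E x)) / D \<le> 4 / c0 * exp (- (c0 / 4) / b)" .
      qed (use r in auto)
      also have "\<dots> = K2 * exp (- (c0 / 4) / b)" by (simp add: K2_def)
      finally show ?thesis .
    qed
    define I where "I = (LINT x:{0..1}|lborel. hyp_kernel 1 w (v x) * (v x - c) * theta (exp (u x)))"
    have "norm I \<le> (\<integral>x. norm (indicator {0..1} x *\<^sub>R (hyp_kernel 1 w (v x) * (v x - c) * theta (exp (u x)))) \<partial>lborel)"
      unfolding I_def set_lebesgue_integral_def by (rule integral_norm_bound)
    also have "\<dots> \<le> (\<integral>x. indicator {0..1::real} x * (K2 * exp (- (c0 / 4) / b)) \<partial>lborel)"
    proof (rule integral_mono')
      show "integrable lborel (\<lambda>x. indicator {0..1::real} x * (K2 * exp (- (c0 / 4) / b)))" by simp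
      show "norm (indicator {0..1} x *\<^sub>R (hyp_kernel 1 w (v x) * (v x - c) * theta (exp (u x)))) \<le> indicator {0..1} x * (K2 * exp (- (c0 / 4) / b))" for x
        using bound[of x] by (auto simp: indicator_def)
      show "0 \<le> indicator {0..1} x * (K2 * exp (- (c0 / 4) / b))" for x :: real using K2 by simp
    qed
    also have "\<dots> = K2 * exp (- (c0 / 4) / b)" by simp
    finally have nI: "norm I \<le> K2 * exp (- (c0 / 4) / b)" .
    have "(\<integral>t. Lc t * hypergeo_1F1 (1 / 2 - \<i> * of_real t) 1 w * exp (of_real (a * t)) \<partial>lborel)
        = 2 * pi * exp (\<i> * of_real a / 2) * I - 2 * pi * (exp (\<i> * of_real a / 2) * exp w + exp (- (\<i> * of_real a / 2)))"
      unfolding I_def v_def u_def by (rule critical_transform_split[OF R1]) (use us in \<open>simp add: u_def\<close>)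
    then have "(\<integral>t. Lc t * hypergeo_1F1 (1 / 2 - \<i> * of_real t) 1 w * exp (of_real (a * t)) \<partial>lborel)
        + 2 * pi * (exp (\<i> * of_real a / 2) * exp w + exp (- (\<i> * of_real a / 2))) = 2 * pi * exp (\<i> * of_real a / 2) * I" by simp
    moreover have "norm (2 * pi * exp (\<i> * of_real a / 2) * I) = 2 * pi * norm I" by (simp add: norm_mult)
    moreover have "2 * pi * norm I \<le> (2 * pi * K2 + 1) * exp (- (c0 / 4) / b)"
    proof -
      have "2 * pi * norm I \<le> 2 * pi * (K2 * exp (- (c0 / 4) / b))" using nI by (intro mult_left_mono) auto
      also have "\<dots> \<le> (2 * pi * K2 + 1) * exp (- (c0 / 4) / b)" by (simp add: algebra_simps)
      finally show ?thesis .
    qed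
    ultimately show ?thesis unfolding a_def by (simp only:)
  qed
  show ?thesis
  proof (intro exI conjI)
    show "2 * pi * K2 + 1 > 0" using K2 by (simp add: add_nonneg_pos)
    show "c0 / 4 > 0" using c0 by simp
    show "\<forall>\<^sub>F b in at_right 0.
    norm ((\<integral>t. Lc t * hypergeo_1F1 (1 / 2 - \<i> * of_real t) 1 w * exp (of_real ((pi / 2 - b) * t)) \<partial>lborel)
      + 2 * pi * (exp (\<i> * of_real (pi / 2 - b) / 2) * exp w + exp (- (\<i> * of_real (pi / 2 - b) / 2)))) \<le> (2 * pi * K2 + 1) * exp (- (c0 / 4) / b)"
      using ev by eventually_elim (use main in blast)
  qed
qed

end

section \<open>Zeros of real functions with flat transforms\<close>

lemma norm_one_minus_exp: "norm (1 - exp z) \<le> norm z * exp (norm z)" for z :: complex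
proof -
  have "norm (exp z - exp 0) \<le> exp (norm z) * norm (z - 0)"
  proof (rule field_differentiable_bound[where S = "cball 0 (norm z)" and f' = exp])
    fix y :: complex assume "y \<in> cball 0 (norm z)"
    then have "norm y \<le> norm z" by simp
    then show "norm (exp y) \<le> exp (norm z)" using complex_Re_le_cmod[of y] by simp
  qed (auto intro!: derivative_eq_intros)
  then show ?thesis by (simp add: norm_minus_commute mult.commute)
qed

lemma abs_one_minus_exp: "\<bar>1 - exp x\<bar> \<le> \<bar>x\<bar> * exp \<bar>x\<bar>" for x :: real
proof -
  have "complex_of_real (1 - exp x) = 1 - exp (of_real x)" by (simp add: exp_of_real)
  then have "\<bar>1 - exp x\<bar> = norm (1 - exp (complex_of_real x))" by (metis norm_of_real)
  then show ?thesis using norm_one_minus_exp[of "of_real x"] by simp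
qed

lemma constant_sign_right:
  fixes F :: "real \<Rightarrow> real"
  assumes "continuous_on UNIV F" "\<And>t. t \<ge> T \<Longrightarrow> F t \<noteq> 0"
  shows "\<exists>s. (s = 1 \<or> s = -1) \<and> (\<forall>t\<ge>T. s * F t > 0)"
proof -
  define s where "s = sgn (F T)"
  have s: "s = 1 \<or> s = -1" using assms(2)[of T] by (auto simp: s_def sgn_if)
  have "s * F t > 0" if t: "t \<ge> T" for t
  proof (rule ccontr)
    assume neg: "\<not> s * F t > 0"
    have "s * F T > 0" using assms(2)[of T] by (simp add: s_def sgn_if)
    moreover have "continuous_on {T..t} (\<lambda>x. s * F x)"
      using assms(1) by (intro continuous_intros) (auto intro: continuous_on_subset)
    ultimately have "\<exists>x\<ge>T. x \<le> t \<and> s * F x = 0"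
      using IVT2'[of "\<lambda>x. s * F x" t 0 T] neg t by auto
    then show False using assms(2) s by auto
  qed
  then show ?thesis using s by blast
qed

text \<open>Near \<open>b = 0\<close> the transform of \<open>F\<close> is a sum of exponentials of bounded frequency plus a flat
  error. If \<open>F\<close> had constant signs near both ends, then for \<open>n\<close> of suitable parity the \<open>n\<close>-th
  moment of \<open>F(t) exp(\<pi>t/2)\<close>, realised below by \<open>n\<close>-th differences in \<open>b\<close>, would grow faster than
  any fixed geometric rate, while that of the exponential sum does not.\<close>

lemma infinitely_many_zeros_from_flat_transform:
  fixes Phi :: "real \<Rightarrow> real" and c lam :: "nat \<Rightarrow> real" and Q :: complex
  assumes cont: "continuous_on UNIV Phi"
    and decay: "\<And>a. 0 \<le> a \<Longrightarrow> a < pi / 2 \<Longrightarrow> \<exists>K>0. \<forall>t. \<bar>Phi t\<bar> \<le> K * exp (- a * \<bar>t\<bar>)"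
    and c: "summable (\<lambda>j. \<bar>c j\<bar>)" and lam: "\<And>j. \<bar>lam j\<bar> \<le> L"
    and flat: "K0 > 0" "c1 > 0" "\<forall>\<^sub>F b in at_right 0.
        \<bar>(\<integral>t. Phi t * exp ((pi / 2 - b) * t) \<partial>lborel) - Re (Q * exp (\<i> * of_real (pi / 2 - b) / 2))\<bar> \<le> K0 * exp (- c1 / b)"
  shows "infinite {t. (\<Sum>j. c j * Phi (t + lam j)) = 0}"
proof
  define F where "F = (\<lambda>t. \<Sum>j. c j * Phi (t + lam j))"
  assume "finite {t. (\<Sum>j. c j * Phi (t + lam j)) = 0}"
  then have fin: "finite {t. F t = 0}" by (simp add: F_def)
  have L: "L \<ge> 0" using lam[of 0] by linarith
  define C1 where "C1 = (\<Sum>j. \<bar>c j\<bar>)"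
  have C1: "C1 \<ge> 0" unfolding C1_def by (intro suminf_nonneg c) auto
  \<comment> \<open>A translation by \<open>lam j\<close> costs at most exp(a L), uniformly in
    j.\<close>
  have term_bound: "\<exists>K>0. \<forall>t j. \<bar>c j * Phi (t + lam j)\<bar> \<le> \<bar>c j\<bar> * (K * exp (- a * \<bar>t\<bar>))" if a: "0 \<le> a" "a < pi / 2" for a
  proof -
    obtain K where K: "K > 0" "\<And>t. \<bar>Phi t\<bar> \<le> K * exp (- a * \<bar>t\<bar>)" using decay[OF a] by blast
    have "\<bar>c j * Phi (t + lam j)\<bar> \<le> \<bar>c j\<bar> * ((K * exp (a * L)) * exp (- a * \<bar>t\<bar>))" for t j
    proof -
      have "\<bar>Phi (t + lam j)\<bar> \<le> K * exp (- a * \<bar>t + lam j\<bar>)" by (rule K(2))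
      also have "\<dots> \<le> K * exp (a * L + - a * \<bar>t\<bar>)"
      proof -
        have "\<bar>t\<bar> - L \<le> \<bar>t + lam j\<bar>" using lam[of j] by linarith
        then have "a * (\<bar>t\<bar> - L) \<le> a * \<bar>t + lam j\<bar>" using a by (intro mult_left_mono) auto
        then show ?thesis using K(1) by (simp add: algebra_simps)
      qed
      finally have "\<bar>Phi (t + lam j)\<bar> \<le> (K * exp (a * L)) * exp (- a * \<bar>t\<bar>)" by (simp only: exp_add mult.assoc)
      then show ?thesis unfolding abs_mult by (rule mult_left_mono) simp
    qed
    then show ?thesis using K(1) by (intro exI[of _ "K * exp (a * L)"]) auto
  qed
  have term_sum: "summable (\<lambda>j. \<bar>c j * Phi (t + lam j)\<bar>)" for t
  proof -
    obtain K where K: "\<And>t j. \<bar>c j * Phi (t + lam j)\<bar> \<le> \<bar>c j\<bar> * (K * exp (- 0 * \<bar>t\<bar>))" using term_bound[of 0] by auto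
    show ?thesis
      by (rule summable_comparison_test'[OF summable_mult2[OF c, of "K * exp (- 0 * \<bar>t\<bar>)"]]) (use K in simp)
  qed
  have F_bound: "\<exists>K>0. \<forall>t. \<bar>F t\<bar> \<le> K * exp (- a * \<bar>t\<bar>)" if a: "0 \<le> a" "a < pi / 2" for a
  proof -
    obtain K where K: "K > 0" "\<And>t j. \<bar>c j * Phi (t + lam j)\<bar> \<le> \<bar>c j\<bar> * (K * exp (- a * \<bar>t\<bar>))" using term_bound[OF a] by blast
    have "\<bar>F t\<bar> \<le> (C1 * K + 1) * exp (- a * \<bar>t\<bar>)" for t
    proof -
      have "\<bar>F t\<bar> \<le> (\<Sum>j. \<bar>c j * Phi (t + lam j)\<bar>)" unfolding F_def by (rule summable_rabs[OF term_sum])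
      also have "\<dots> \<le> (\<Sum>j. \<bar>c j\<bar> * (K * exp (- a * \<bar>t\<bar>)))"
        by (rule suminf_le[OF K(2) term_sum summable_mult2[OF c]])
      also have "\<dots> = C1 * (K * exp (- a * \<bar>t\<bar>))" unfolding C1_def by (rule suminf_mult2[OF c, symmetric])
      also have "\<dots> \<le> (C1 * K + 1) * exp (- a * \<bar>t\<bar>)" by (simp add: algebra_simps)
      finally show ?thesis .
    qed
    then show ?thesis using K(1) C1 by (intro exI[of _ "C1 * K + 1"]) (auto intro!: add_nonneg_pos)
  qed
  have F_cont: "continuous_on UNIV F"
  proof -
    obtain K where K: "\<And>t j. \<bar>c j * Phi (t + lam j)\<bar> \<le> \<bar>c j\<bar> * (K * exp (- 0 * \<bar>t\<bar>))" using term_bound[of 0] by auto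
    have "uniform_limit UNIV (\<lambda>n t. \<Sum>j<n. c j * Phi (t + lam j)) F sequentially"
      unfolding F_def by (rule Weierstrass_m_test[OF _ summable_mult2[OF c, of K]]) (use K in simp)
    then show ?thesis
    proof (rule uniform_limit_theorem[rotated])
      show "\<forall>\<^sub>F n in sequentially. continuous_on UNIV (\<lambda>t. \<Sum>j<n. c j * Phi (t + lam j))"
        by (intro always_eventually allI continuous_intros continuous_on_compose2[OF cont]) auto
    qed simp
  qed
  have Fm[measurable]: "F \<in> borel_measurable borel" by (rule borel_measurable_continuous_onI[OF F_cont])
  have Phim[measurable]: "Phi \<in> borel_measurable borel" by (rule borel_measurable_continuous_onI[OF cont])
  have weighted: "integrable lborel (\<lambda>t. f t * exp ((pi / 2 - b) * t))"
    if f: "f \<in> borel_measurable borel" and fb: "\<And>a. 0 \<le> a \<Longrightarrow> a < pi / 2 \<Longrightarrow> \<exists>K>0. \<forall>t. \<bar>f t\<bar> \<le> K * exp (- a * \<bar>t\<bar>)"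
      and b: "0 < b" "b < pi / 2" for f :: "real \<Rightarrow> real" and b
  proof -
    obtain K where K: "K > 0" "\<And>t. \<bar>f t\<bar> \<le> K * exp (- (pi / 2 - b / 2) * \<bar>t\<bar>)"
      using fb[of "pi / 2 - b / 2"] b by auto
    show ?thesis
    proof (rule Bochner_Integration.integrable_bound[OF integrable_mult_right[OF integrable_exp_abs[of "b / 2"], of K]])
      show "AE t in lborel. norm (f t * exp ((pi / 2 - b) * t)) \<le> norm (K * exp (- (b / 2) * \<bar>t\<bar>))"
      proof (rule AE_I2)
        fix t
        have "(pi / 2 - b) * t \<le> (pi / 2 - b) * \<bar>t\<bar>" using b by (intro mult_left_mono) auto
        then have "\<bar>f t\<bar> * exp ((pi / 2 - b) * t) \<le> (K * exp (- (pi / 2 - b / 2) * \<bar>t\<bar>)) * exp ((pi / 2 - b) * \<bar>t\<bar>)"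
          using K by (intro mult_mono) auto
        also have "\<dots> = K * exp (- (b / 2) * \<bar>t\<bar>)"
          unfolding mult.assoc exp_add[symmetric] by (simp add: algebra_simps)
        finally show "norm (f t * exp ((pi / 2 - b) * t)) \<le> norm (K * exp (- (b / 2) * \<bar>t\<bar>))"
          using K(1) by (simp add: abs_mult)
      qed
    qed (use f b in auto)
  qed
  have lam_exp: "exp (- (pi / 2 - b) * lam j) \<le> exp (pi / 2 * L)" if b: "0 < b" "b < pi / 2" for j b
  proof -
    have "- lam j \<le> L" using lam[of j] by linarith
    then have "(pi / 2 - b) * (- lam j) \<le> (pi / 2 - b) * L" using b by (intro mult_left_mono) auto
    also have "\<dots> \<le> pi / 2 * L" using b L by (intro mult_right_mono) auto
    finally show ?thesis unfolding exp_le_cancel_iff by (simp only: mult_minus_left mult_minus_right)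
  qed
  define H where "H = (\<lambda>b. \<integral>t. F t * exp ((pi / 2 - b) * t) \<partial>lborel)"
  define h where "h = (\<lambda>b. \<integral>t. Phi t * exp ((pi / 2 - b) * t) \<partial>lborel)"
  \<comment> \<open>Translating Phi by \<open>lam j\<close> multiplies its weighted transform by
    exp(- (pi / 2 - b) * lam j); absolute convergence allows the sum to be taken outside.\<close>
  have H_h: "H b = (\<Sum>j. c j * exp (- (pi / 2 - b) * lam j) * h b)" and H_sum: "summable (\<lambda>j. c j * exp (- (pi / 2 - b) * lam j) * h b)"
    if b: "0 < b" "b < pi / 2" for b
  proof -
    have Pi: "integrable lborel (\<lambda>t. Phi t * exp ((pi / 2 - b) * t))" by (rule weighted[OF Phim decay b])
    define f where "f = (\<lambda>j t. c j * Phi (t + lam j) * exp ((pi / 2 - b) * t))"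
    define e where "e = (\<lambda>j. exp (- (pi / 2 - b) * lam j))"
    have f_eq: "f j t = c j * e j * (Phi (lam j + 1 * t) * exp ((pi / 2 - b) * (lam j + 1 * t)))" for j t
    proof -
      have "e j * exp ((pi / 2 - b) * (lam j + t)) = exp ((pi / 2 - b) * t)"
        unfolding e_def exp_add[symmetric] by (simp add: algebra_simps)
      then show ?thesis by (simp add: f_def add.commute mult.assoc mult.left_commute[of "e j"])
    qed
    have fi: "integrable lborel (f j)" for j
      unfolding f_eq[abs_def] by (intro integrable_mult_right lborel_integrable_real_affine[OF Pi]) simp
    have fint: "(\<integral>t. f j t \<partial>lborel) = c j * e j * h b" for j
      unfolding f_eq integral_mult_right_zero h_def
      using lborel_integral_real_affine[of 1 "\<lambda>t. Phi t * exp ((pi / 2 - b) * t)" "lam j"] by simp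
    have fnint: "(\<integral>t. norm (f j t) \<partial>lborel) = \<bar>c j\<bar> * e j * (\<integral>t. norm (Phi t * exp ((pi / 2 - b) * t)) \<partial>lborel)" for j
    proof -
      have "norm (f j t) = \<bar>c j\<bar> * e j * norm (Phi (lam j + 1 * t) * exp ((pi / 2 - b) * (lam j + 1 * t)))" for t
        unfolding f_eq by (simp add: abs_mult e_def)
      then show ?thesis
        using lborel_integral_real_affine[of 1 "\<lambda>t. norm (Phi t * exp ((pi / 2 - b) * t))" "lam j"] by simp
    qed
    have ej: "e j \<le> exp (pi / 2 * L)" for j
      unfolding e_def by (rule lam_exp[OF b])
    have s1: "AE t in lborel. summable (\<lambda>j. norm (f j t))"
    proof (rule AE_I2)
      fix t
      show "summable (\<lambda>j. norm (f j t))"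
        using summable_mult2[OF term_sum[of t], of "exp ((pi / 2 - b) * t)"] by (simp add: f_def abs_mult)
    qed
    have s2: "summable (\<lambda>j. \<integral>t. norm (f j t) \<partial>lborel)"
    proof (rule summable_comparison_test')
      let ?N = "\<integral>t. norm (Phi t * exp ((pi / 2 - b) * t)) \<partial>lborel"
      show "summable (\<lambda>j. \<bar>c j\<bar> * (exp (pi / 2 * L) * ?N))" by (rule summable_mult2[OF c])
      show "norm (\<integral>t. norm (f j t) \<partial>lborel) \<le> \<bar>c j\<bar> * (exp (pi / 2 * L) * ?N)" if "j \<ge> 0" for j
      proof -
        have N: "?N \<ge> 0" by (rule integral_nonneg_AE) auto
        have "\<bar>c j\<bar> * e j * ?N \<le> \<bar>c j\<bar> * exp (pi / 2 * L) * ?N"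
          using ej[of j] N by (intro mult_right_mono mult_left_mono) auto
        moreover have "0 \<le> \<bar>c j\<bar> * e j * ?N" using N by (simp add: e_def)
        ultimately show ?thesis unfolding fnint by (simp add: mult.assoc)
      qed
    qed
    have "(\<Sum>j. f j t) = F t * exp ((pi / 2 - b) * t)" for t
      unfolding f_def F_def by (rule suminf_mult2[OF summable_rabs_cancel[OF term_sum], symmetric])
    then have "H b = (\<integral>t. (\<Sum>j. f j t) \<partial>lborel)" by (simp add: H_def)
    also have "\<dots> = (\<Sum>j. c j * e j * h b)" using integral_suminf[OF fi s1 s2] by (simp add: fint)
    finally show "H b = (\<Sum>j. c j * exp (- (pi / 2 - b) * lam j) * h b)" by (simp add: e_def)
    show "summable (\<lambda>j. c j * exp (- (pi / 2 - b) * lam j) * h b)"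
      using summable_integral[OF fi s1 s2] by (simp add: fint e_def)
  qed
  \<comment> \<open>The frequency of the j-th exponential: the translation gives - lam j, and the
    factor exp(i (pi / 2 - b) / 2) of the main term gives i / 2.\<close>
  define mu where "mu = (\<lambda>j. - of_real (lam j) + \<i> / 2)"
  define R where "R = L + 1"
  have R: "R > 0" and mu: "norm (mu j) \<le> R" for j
    using L norm_triangle_ineq[of "- complex_of_real (lam j)" "\<i> / 2"] lam[of j] by (auto simp: R_def mu_def norm_divide)
  define E where "E = (\<lambda>b. \<Sum>j. Re (of_real (c j) * Q * exp (mu j * of_real (pi / 2 - b))))"
  have E_bound: "\<bar>Re (of_real (c j) * Q * exp (mu j * of_real (pi / 2 - b)))\<bar> \<le> \<bar>c j\<bar> * (norm Q * exp (R * (pi / 2)))"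
    if b: "0 < b" "b < pi / 2" for j b
  proof -
    have "Re (mu j * of_real (pi / 2 - b)) \<le> norm (mu j * of_real (pi / 2 - b))" by (rule complex_Re_le_cmod)
    also have "\<dots> = norm (mu j) * (pi / 2 - b)" unfolding norm_mult norm_of_real using b by simp
    also have "\<dots> \<le> R * (pi / 2)" using mu[of j] b R by (intro mult_mono) auto
    finally have "norm (exp (mu j * of_real (pi / 2 - b))) \<le> exp (R * (pi / 2))" by simp
    then have "norm (of_real (c j) * Q * exp (mu j * of_real (pi / 2 - b))) \<le> \<bar>c j\<bar> * norm Q * exp (R * (pi / 2))"
      unfolding norm_mult norm_of_real by (intro mult_left_mono) auto
    then show ?thesis using abs_Re_le_cmod[of "of_real (c j) * Q * exp (mu j * of_real (pi / 2 - b))"] by (simp add: mult.assoc)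
  qed
  have E_sum: "summable (\<lambda>j. Re (of_real (c j) * Q * exp (mu j * of_real (pi / 2 - b))))" if b: "0 < b" "b < pi / 2" for b
    by (rule summable_comparison_test'[OF summable_mult2[OF c, of "norm Q * exp (R * (pi / 2))"]]) (use E_bound[OF b] in simp)
  define Gm where "Gm = C1 * exp (pi / 2 * L) * K0"
  have HE: "\<forall>\<^sub>F b in at_right 0. \<bar>H b - E b\<bar> \<le> Gm * exp (- c1 / b)"
  proof -
    have "\<forall>\<^sub>F b in at_right (0::real). 0 < b" by (rule eventually_at_right_less)
    moreover have "\<forall>\<^sub>F b in at_right (0::real). b < pi / 2" by (intro order_tendstoD(2)[OF tendsto_ident_at]) simp
    ultimately show ?thesis using flat(3)
    proof eventually_elim
      case (elim b)
      define D where "D = h b - Re (Q * exp (\<i> * of_real (pi / 2 - b) / 2))"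
      have D: "\<bar>D\<bar> \<le> K0 * exp (- c1 / b)" using elim(3) by (simp add: D_def h_def)
      have t: "c j * exp (- (pi / 2 - b) * lam j) * h b - Re (of_real (c j) * Q * exp (mu j * of_real (pi / 2 - b)))
          = c j * exp (- (pi / 2 - b) * lam j) * D" for j
      proof -
        have "exp (mu j * of_real (pi / 2 - b)) = of_real (exp (- (pi / 2 - b) * lam j)) * exp (\<i> * of_real (pi / 2 - b) / 2)"
          unfolding exp_of_real[symmetric] exp_add[symmetric] by (rule arg_cong[of _ _ exp]) (simp add: mu_def field_simps)
        then have "of_real (c j) * Q * exp (mu j * of_real (pi / 2 - b)) = of_real (c j * exp (- (pi / 2 - b) * lam j)) * (Q * exp (\<i> * of_real (pi / 2 - b) / 2))"
          by simp
        then have "Re (of_real (c j) * Q * exp (mu j * of_real (pi / 2 - b))) = c j * exp (- (pi / 2 - b) * lam j) * Re (Q * exp (\<i> * of_real (pi / 2 - b) / 2))"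
          by (simp only: Re_complex_of_real times_complex.sel Im_complex_of_real mult_zero_left diff_zero)
        then show ?thesis by (simp only: D_def right_diff_distrib)
      qed
      have ej: "exp (- (pi / 2 - b) * lam j) \<le> exp (pi / 2 * L)" for j
        by (rule lam_exp[OF elim(1,2)])
      have tb: "\<bar>c j * exp (- (pi / 2 - b) * lam j) * D\<bar> \<le> \<bar>c j\<bar> * (exp (pi / 2 * L) * \<bar>D\<bar>)" for j
        unfolding abs_mult mult.assoc using ej[of j] by (intro mult_left_mono mult_right_mono) auto
      have ts: "summable (\<lambda>j. \<bar>c j * exp (- (pi / 2 - b) * lam j) * D\<bar>)"
        by (rule summable_comparison_test'[OF summable_mult2[OF c, of "exp (pi / 2 * L) * \<bar>D\<bar>"]]) (use tb in simp)
      have "H b - E b = (\<Sum>j. c j * exp (- (pi / 2 - b) * lam j) * D)"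
        unfolding H_h[OF elim(1,2)] E_def suminf_diff[OF H_sum[OF elim(1,2)] E_sum[OF elim(1,2)]] t ..
      then have "\<bar>H b - E b\<bar> \<le> (\<Sum>j. \<bar>c j * exp (- (pi / 2 - b) * lam j) * D\<bar>)"
        using summable_rabs[OF ts] by simp
      also have "\<dots> \<le> (\<Sum>j. \<bar>c j\<bar> * (exp (pi / 2 * L) * \<bar>D\<bar>))"
        by (rule suminf_le[OF tb ts summable_mult2[OF c]])
      also have "\<dots> = C1 * (exp (pi / 2 * L) * \<bar>D\<bar>)" unfolding C1_def by (rule suminf_mult2[OF c, symmetric])
      also have "\<dots> \<le> C1 * (exp (pi / 2 * L) * (K0 * exp (- c1 / b)))" using C1 D by (intro mult_left_mono) auto
      finally show ?case by (simp add: Gm_def mult.assoc)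
    qed
  qed
  obtain T0 where T0: "\<And>t. F t = 0 \<Longrightarrow> \<bar>t\<bar> < T0"
  proof -
    have "bounded {t. F t = 0}" using fin by (rule finite_imp_bounded)
    then obtain B where "\<And>t. F t = 0 \<Longrightarrow> \<bar>t\<bar> \<le> B" by (auto simp: bounded_iff)
    then show ?thesis using that[of "B + 1"] by force
  qed
  define T where "T = max 1 T0"
  have T: "T > 0" by (simp add: T_def)
  have Fnz: "F t \<noteq> 0" if "\<bar>t\<bar> \<ge> T" for t using T0[of t] that by (auto simp: T_def)
  obtain s where s: "s = 1 \<or> s = -1" "\<And>t. t \<ge> T \<Longrightarrow> s * F t > 0"
    using constant_sign_right[OF F_cont, of T] Fnz by force
  have Fneg_cont: "continuous_on UNIV (\<lambda>t. F (- t))" by (rule continuous_on_compose2[OF F_cont]) (auto intro!: continuous_intros)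
  obtain s' where s': "s' = 1 \<or> s' = -1" "\<And>t. t \<ge> T \<Longrightarrow> s' * F (- t) > 0"
    using constant_sign_right[OF Fneg_cont, of T] Fnz by force
  \<comment> \<open>p selects the parity of n for which F(t) t^n has one and the same sign s near
    both ends.\<close>
  define p where "p = (if s = s' then 0 else 1 :: nat)"
  have sp: "s * (-1) ^ p = s'" using s(1) s'(1) by (auto simp: p_def)
  \<comment> \<open>In the application y is 1 - exp(- d t), which has the sign of t.\<close>
  have sign: "0 \<le> s * F t * y ^ n" if n: "even (n + p)" and t: "\<bar>t\<bar> \<ge> T" and y: "t > 0 \<Longrightarrow> y \<ge> 0" "t < 0 \<Longrightarrow> y \<le> 0" for n t y
  proof (cases "t > 0")
    case True
    then have "s * F t > 0" "y \<ge> 0" using s(2)[of t] t y(1) by auto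
    then show ?thesis by (intro mult_nonneg_nonneg[OF less_imp_le zero_le_power])
  next
    case False
    then have tn: "t < 0" using t T by auto
    have "s * F t * y ^ n = s * (-1) ^ n * F t * (- y) ^ n" by (simp add: power_minus[of y])
    also have "(-1 :: real) ^ n = (-1) ^ p" using n by (auto simp: minus_one_power_iff)
    also have "s * (-1) ^ p = s'" by (rule sp)
    finally have eq: "s * F t * y ^ n = s' * F t * (- y) ^ n" .
    have "s' * F t > 0" "- y \<ge> 0" using s'(2)[of "- t"] t tn y(2) by auto
    then show ?thesis unfolding eq by (intro mult_nonneg_nonneg[OF less_imp_le zero_le_power])
  qed
  obtain Fb where Fb: "Fb > 0" "\<And>t. \<bar>F t\<bar> \<le> Fb" using F_bound[of 0] by auto
  \<comment> \<open>X dominates the geometric ratios T and R of the upper bounds, and M exceeds it,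
    so the window [M, M + 1] produces a strictly larger ratio.\<close>
  define X where "X = max T R"
  define M where "M = X + 1"
  have M: "M > 0" "T < M" "R < M" "X > 0" "T \<le> X" "R \<le> X" using T R by (auto simp: M_def X_def)
  obtain m1 where m1: "m1 > 0" "\<And>t. t \<in> {M..M + 1} \<Longrightarrow> m1 \<le> \<bar>F t\<bar>"
  proof -
    have "\<exists>x\<in>{M..M + 1}. \<forall>y\<in>{M..M + 1}. \<bar>F x\<bar> \<le> \<bar>F y\<bar>"
      by (rule continuous_attains_inf) (auto intro!: continuous_intros continuous_on_subset[OF F_cont])
    then obtain x where "x \<in> {M..M + 1}" "\<And>y. y \<in> {M..M + 1} \<Longrightarrow> \<bar>F x\<bar> \<le> \<bar>F y\<bar>" by blast
    moreover have "F x \<noteq> 0" using \<open>x \<in> {M..M + 1}\<close> M by (intro Fnz) auto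
    ultimately show ?thesis using that[of "\<bar>F x\<bar>"] by auto
  qed
  define C2 where "C2 = C1 * (norm Q * exp (R * (pi / 2)))"
  define C3 where "C3 = Fb * exp (pi / 2 * T) * (2 * T)"
  have C23: "C2 \<ge> 0" "C3 \<ge> 0" using C1 Fb T by (auto simp: C2_def C3_def)
  \<comment> \<open>The left side comes from the window, T^n from the interval where the sign of F
    is unknown, and R^n from the exponential sum.\<close>
  have moment: "m1 * M ^ n \<le> C3 * T ^ n + C2 * R ^ n" if n: "even (n + p)" for n
  proof -
    define bin where "bin = (\<lambda>f :: nat \<Rightarrow> real. \<Sum>i\<le>n. (-1) ^ i * real (n choose i) * f i)"
    have bin_pow: "(\<Sum>i\<le>n. (-1) ^ i * of_nat (n choose i) * y ^ i) = (1 - y) ^ n" for y :: "'a :: comm_ring_1"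
      using binomial_ring[of "- y" 1 n] by (simp add: power_minus[of y] mult_ac)
    have ev1: "\<forall>\<^sub>F d in at_right 0. \<forall>i\<in>{..n}. \<bar>H (real (i + 1) * d) - E (real (i + 1) * d)\<bar> \<le> Gm * exp (- c1 / (real (i + 1) * d))"
    proof (rule eventually_ball_finite)
      show "\<forall>i\<in>{..n}. \<forall>\<^sub>F d in at_right 0. \<bar>H (real (i + 1) * d) - E (real (i + 1) * d)\<bar> \<le> Gm * exp (- c1 / (real (i + 1) * d))"
      proof
        fix i
        have "filterlim (\<lambda>d. real (i + 1) * d) (at_right 0) (at_right 0)" by real_asymp
        then show "\<forall>\<^sub>F d in at_right 0. \<bar>H (real (i + 1) * d) - E (real (i + 1) * d)\<bar> \<le> Gm * exp (- c1 / (real (i + 1) * d))"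
          by (rule eventually_compose_filterlim[OF HE])
      qed
    qed simp
    have ev2: "\<forall>\<^sub>F d in at_right (0::real). 0 < d" by (rule eventually_at_right_less)
    have ev3: "\<forall>\<^sub>F d in at_right (0::real). d < pi / 2 / real (n + 1)" by (intro order_tendstoD(2)[OF tendsto_ident_at]) simp
    \<comment> \<open>The two sides of the inequality for n-th differences, already divided by
      d^n.\<close>
    define lhs where "lhs = (\<lambda>d. m1 * (M * exp (- d * (M + 1))) ^ n)"
    define rhs where "rhs = (\<lambda>d. C3 * (T * exp (d * T)) ^ n + (C2 * (R * exp (R * d)) ^ n + 2 ^ n * \<bar>Gm\<bar> * (exp (- (c1 / real (n + 1)) / d) / d ^ n)))"
    have "\<forall>\<^sub>F d in at_right 0. lhs d \<le> rhs d"
      using ev1 ev2 ev3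
    proof eventually_elim
      case (elim d)
      have di: "0 < real (i + 1) * d" "real (i + 1) * d < pi / 2" if "i \<le> n" for i
      proof -
        show "0 < real (i + 1) * d" using elim(2) by simp
        have "real (i + 1) * d \<le> real (n + 1) * d" using that elim(2) by (intro mult_right_mono) auto
        also have "\<dots> < pi / 2" using elim(3) by (simp add: field_simps)
        finally show "real (i + 1) * d < pi / 2" .
      qed
      have d1: "0 < d" "d < pi / 2" using di[of 0] by auto
      define g where "g = (\<lambda>t. exp ((pi / 2 - d) * t) * (1 - exp (- d * t)) ^ n)"
      \<comment> \<open>By the binomial theorem; for small d the factor (1 - exp(- d t))^n plays the
        role of (d t)^n in the moment.\<close>
      have sumHi: "(\<Sum>i\<le>n. (-1) ^ i * real (n choose i) * (F t * exp ((pi / 2 - real (i + 1) * d) * t))) = F t * g t" for t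
      proof -
        have "exp ((pi / 2 - real (i + 1) * d) * t) = exp ((pi / 2 - d) * t) * exp (- d * t) ^ i" for i
          unfolding exp_of_nat_mult[symmetric] exp_add[symmetric] by (simp add: algebra_simps)
        then have "(\<Sum>i\<le>n. (-1) ^ i * real (n choose i) * (F t * exp ((pi / 2 - real (i + 1) * d) * t))) =
           (\<Sum>i\<le>n. (F t * exp ((pi / 2 - d) * t)) * ((-1) ^ i * of_nat (n choose i) * exp (- d * t) ^ i))"
          by (intro sum.cong refl) (simp only: mult_ac)
        then show ?thesis unfolding sum_distrib_left[symmetric] bin_pow by (simp add: g_def mult.assoc)
      qed
      have Fgi: "integrable lborel (\<lambda>t. F t * g t)" and binH: "bin (\<lambda>i. H (real (i + 1) * d)) = (\<integral>t. F t * g t \<partial>lborel)"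
      proof -
        have i: "integrable lborel (\<lambda>t. F t * exp ((pi / 2 - real (i + 1) * d) * t))" if "i \<le> n" for i
          by (rule weighted[OF Fm F_bound di[OF that]])
        show "integrable lborel (\<lambda>t. F t * g t)" unfolding sumHi[symmetric]
          by (intro Bochner_Integration.integrable_sum integrable_mult_right i) simp
        show "bin (\<lambda>i. H (real (i + 1) * d)) = (\<integral>t. F t * g t \<partial>lborel)"
        proof -
          have "(\<integral>t. (\<Sum>i\<le>n. (-1) ^ i * real (n choose i) * (F t * exp ((pi / 2 - real (i + 1) * d) * t))) \<partial>lborel)
             = (\<Sum>i\<le>n. \<integral>t. (-1) ^ i * real (n choose i) * (F t * exp ((pi / 2 - real (i + 1) * d) * t)) \<partial>lborel)"
            by (rule Bochner_Integration.integral_sum) (intro integrable_mult_right i, simp)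
          then show ?thesis unfolding sumHi by (simp only: integral_mult_right_zero bin_def H_def)
        qed
      qed
      \<comment> \<open>The difference turns each exponential into W (1 - exp(- mu d))^n, and |mu|
        \<le> R bounds the power by (R d exp(R d))^n.\<close>
      have binE: "\<bar>bin (\<lambda>i. E (real (i + 1) * d))\<bar> \<le> C2 * (R * d * exp (R * d)) ^ n"
      proof -
        define W where "W = (\<lambda>j. of_real (c j) * Q * exp (mu j * of_real (pi / 2 - d)))"
        have We: "of_real (c j) * Q * exp (mu j * of_real (pi / 2 - real (i + 1) * d)) = W j * exp (- (mu j * of_real d)) ^ i" for i j
        proof -
          have "exp (mu j * of_real (pi / 2 - real (i + 1) * d)) = exp (mu j * of_real (pi / 2 - d)) * exp (- (mu j * of_real d)) ^ i"
            unfolding exp_of_nat_mult[symmetric] exp_add[symmetric] by (rule arg_cong[of _ _ exp]) (simp add: algebra_simps)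
          then show ?thesis by (simp only: W_def mult.assoc)
        qed
        have sumW: "(\<Sum>i\<le>n. (-1) ^ i * real (n choose i) * Re (W j * exp (- (mu j * of_real d)) ^ i)) = Re (W j * (1 - exp (- (mu j * of_real d))) ^ n)" for j
        proof -
          have "W j * (1 - exp (- (mu j * of_real d))) ^ n = (\<Sum>i\<le>n. of_real ((-1) ^ i * real (n choose i)) * (W j * exp (- (mu j * of_real d)) ^ i))"
            unfolding bin_pow[symmetric] sum_distrib_left by (intro sum.cong refl) (simp add: mult_ac)
          then show ?thesis by (simp add: Re_sum)
        qed
        have E_i: "(\<lambda>j. (-1) ^ i * real (n choose i) * Re (W j * exp (- (mu j * of_real d)) ^ i)) sums ((-1) ^ i * real (n choose i) * E (real (i + 1) * d))" if "i \<le> n" for i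
          using summable_sums[OF E_sum[OF di[OF that]]] unfolding E_def We by (rule sums_mult)
        have "(\<lambda>j. \<Sum>i\<le>n. (-1) ^ i * real (n choose i) * Re (W j * exp (- (mu j * of_real d)) ^ i)) sums bin (\<lambda>i. E (real (i + 1) * d))"
          unfolding bin_def by (rule sums_sum) (use E_i in auto)
        then have sE: "(\<lambda>j. Re (W j * (1 - exp (- (mu j * of_real d))) ^ n)) sums bin (\<lambda>i. E (real (i + 1) * d))"
          unfolding sumW .
        have Wb: "\<bar>Re (W j * (1 - exp (- (mu j * of_real d))) ^ n)\<bar> \<le> \<bar>c j\<bar> * ((norm Q * exp (R * (pi / 2))) * (R * d * exp (R * d)) ^ n)" for j
        proof -
          have "norm (W j) \<le> \<bar>c j\<bar> * (norm Q * exp (R * (pi / 2)))"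
          proof -
            have "Re (mu j * of_real (pi / 2 - d)) \<le> norm (mu j * of_real (pi / 2 - d))" by (rule complex_Re_le_cmod)
            also have "\<dots> = norm (mu j) * (pi / 2 - d)" unfolding norm_mult norm_of_real using d1 by simp
            also have "\<dots> \<le> R * (pi / 2)" using mu[of j] d1 R by (intro mult_mono) auto
            finally have "norm (exp (mu j * of_real (pi / 2 - d))) \<le> exp (R * (pi / 2))" by simp
            then show ?thesis unfolding W_def norm_mult norm_of_real mult.assoc by (intro mult_left_mono) auto
          qed
          moreover have "norm (1 - exp (- (mu j * of_real d))) \<le> R * d * exp (R * d)"
          proof -
            have nm: "norm (- (mu j * of_real d)) \<le> R * d" using mu[of j] d1 by (simp add: norm_mult mult_right_mono)
            have "norm (1 - exp (- (mu j * of_real d))) \<le> norm (- (mu j * of_real d)) * exp (norm (- (mu j * of_real d)))"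
              by (rule norm_one_minus_exp)
            also have "\<dots> \<le> (R * d) * exp (R * d)" using nm R d1 by (intro mult_mono) auto
            finally show ?thesis .
          qed
          ultimately have "norm (W j * (1 - exp (- (mu j * of_real d))) ^ n) \<le> (\<bar>c j\<bar> * (norm Q * exp (R * (pi / 2)))) * (R * d * exp (R * d)) ^ n"
            unfolding norm_mult norm_power by (intro mult_mono power_mono) auto
          then show ?thesis using abs_Re_le_cmod[of "W j * (1 - exp (- (mu j * of_real d))) ^ n"] by (simp add: mult.assoc)
        qed
        have Ws: "summable (\<lambda>j. \<bar>Re (W j * (1 - exp (- (mu j * of_real d))) ^ n)\<bar>)"
          by (rule summable_comparison_test'[OF summable_mult2[OF c, of "(norm Q * exp (R * (pi / 2))) * (R * d * exp (R * d)) ^ n"]]) (use Wb in simp)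
        have "\<bar>bin (\<lambda>i. E (real (i + 1) * d))\<bar> \<le> (\<Sum>j. \<bar>Re (W j * (1 - exp (- (mu j * of_real d))) ^ n)\<bar>)"
          unfolding sums_unique[OF sE] by (rule summable_rabs[OF Ws])
        also have "\<dots> \<le> (\<Sum>j. \<bar>c j\<bar> * ((norm Q * exp (R * (pi / 2))) * (R * d * exp (R * d)) ^ n))"
          by (rule suminf_le[OF Wb Ws summable_mult2[OF c]])
        also have "\<dots> = C1 * ((norm Q * exp (R * (pi / 2))) * (R * d * exp (R * d)) ^ n)"
          unfolding C1_def by (rule suminf_mult2[OF c, symmetric])
        finally show ?thesis by (simp add: C2_def mult.assoc)
      qed
      \<comment> \<open>The largest node (n + 1) d gives the weakest of the flat errors, and the
        binomial coefficients sum to 2^n.\<close>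
      have binHE: "\<bar>bin (\<lambda>i. H (real (i + 1) * d)) - bin (\<lambda>i. E (real (i + 1) * d))\<bar> \<le> 2 ^ n * (\<bar>Gm\<bar> * exp (- (c1 / real (n + 1)) / d))"
      proof -
        have "bin (\<lambda>i. H (real (i + 1) * d)) - bin (\<lambda>i. E (real (i + 1) * d)) = (\<Sum>i\<le>n. (-1) ^ i * real (n choose i) * (H (real (i + 1) * d) - E (real (i + 1) * d)))"
          by (simp add: bin_def sum_subtractf right_diff_distrib)
        also have "\<bar>\<dots>\<bar> \<le> (\<Sum>i\<le>n. \<bar>(-1) ^ i * real (n choose i) * (H (real (i + 1) * d) - E (real (i + 1) * d))\<bar>)" by (rule sum_abs)
        also have "\<dots> \<le> (\<Sum>i\<le>n. real (n choose i) * (\<bar>Gm\<bar> * exp (- (c1 / real (n + 1)) / d)))"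
        proof (rule sum_mono)
          fix i assume i: "i \<in> {..n}"
          have "real (i + 1) * d \<le> real (n + 1) * d" using i d1 by (intro mult_right_mono) auto
          moreover have "0 < real (i + 1) * d" using d1 by simp
          ultimately have "c1 / (real (n + 1) * d) \<le> c1 / (real (i + 1) * d)"
            by (intro frac_le) (use flat(2) in linarith)+
          then have "c1 / real (n + 1) / d \<le> c1 / (real (i + 1) * d)" unfolding divide_divide_eq_left .
          then have ee: "exp (- c1 / (real (i + 1) * d)) \<le> exp (- (c1 / real (n + 1)) / d)" by simp
          have "\<bar>H (real (i + 1) * d) - E (real (i + 1) * d)\<bar> \<le> Gm * exp (- c1 / (real (i + 1) * d))" using elim(1) i by blast
          also have "\<dots> \<le> \<bar>Gm\<bar> * exp (- (c1 / real (n + 1)) / d)" using ee by (intro mult_mono) auto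
          finally show "\<bar>(-1) ^ i * real (n choose i) * (H (real (i + 1) * d) - E (real (i + 1) * d))\<bar> \<le> real (n choose i) * (\<bar>Gm\<bar> * exp (- (c1 / real (n + 1)) / d))"
            by (simp add: abs_mult mult_left_mono)
        qed
        also have "\<dots> = 2 ^ n * (\<bar>Gm\<bar> * exp (- (c1 / real (n + 1)) / d))"
          unfolding sum_distrib_right[symmetric] using choose_row_sum[of n] by (simp flip: of_nat_sum)
        finally show ?thesis .
      qed
      have upper: "s * (\<integral>t. F t * g t \<partial>lborel) \<le> C2 * (R * d * exp (R * d)) ^ n + 2 ^ n * (\<bar>Gm\<bar> * exp (- (c1 / real (n + 1)) / d))"
      proof -
        have "s * (\<integral>t. F t * g t \<partial>lborel) \<le> \<bar>\<integral>t. F t * g t \<partial>lborel\<bar>" using s(1) by auto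
        also have "\<dots> \<le> \<bar>bin (\<lambda>i. E (real (i + 1) * d))\<bar> + \<bar>bin (\<lambda>i. H (real (i + 1) * d)) - bin (\<lambda>i. E (real (i + 1) * d))\<bar>"
          unfolding binH by linarith
        finally show ?thesis using binE binHE by linarith
      qed
      \<comment> \<open>\<open>lo\<close> is what the window guarantees and \<open>hi\<close> the
        possible damage on [-T, T]; elsewhere the integrand has the favourable sign.\<close>
      define lo where "lo = (\<lambda>t. indicator {M..M + 1} t * (m1 * (d * (M * exp (- d * (M + 1)))) ^ n))"
      define hi where "hi = (\<lambda>t. indicator {-T..T} t * (Fb * exp (pi / 2 * T) * (d * (T * exp (d * T))) ^ n))"
      have ptw: "lo t - hi t \<le> s * (F t * g t)" for t
      proof -
        have gabs: "\<bar>g t\<bar> \<le> exp (pi / 2 * T) * (d * (T * exp (d * T))) ^ n" if "\<bar>t\<bar> \<le> T"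
        proof -
          have "(pi / 2 - d) * t \<le> (pi / 2 - d) * \<bar>t\<bar>" using d1 by (intro mult_left_mono) auto
          also have "\<dots> \<le> pi / 2 * T" using d1 that by (intro mult_mono) auto
          finally have 1: "exp ((pi / 2 - d) * t) \<le> exp (pi / 2 * T)" by simp
          have "\<bar>1 - exp (- d * t)\<bar> \<le> \<bar>- d * t\<bar> * exp \<bar>- d * t\<bar>"
            by (rule abs_one_minus_exp)
          also have "\<dots> \<le> (d * T) * exp (d * T)" using d1 that by (intro mult_mono) (auto simp: abs_mult)
          finally have "\<bar>1 - exp (- d * t)\<bar> ^ n \<le> (d * (T * exp (d * T))) ^ n" by (intro power_mono) auto
          with 1 show ?thesis unfolding g_def abs_mult power_abs by (intro mult_mono) auto
        qed
        consider "\<bar>t\<bar> \<le> T" | "t \<in> {M..M + 1}" | "\<bar>t\<bar> > T" "t \<notin> {M..M + 1}" by linarith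
        then show ?thesis
        proof cases
          case 1
          then have "t \<notin> {M..M + 1}" "t \<in> {-T..T}" using M by auto
          then have "lo t = 0" "hi t = Fb * (exp (pi / 2 * T) * (d * (T * exp (d * T))) ^ n)"
            by (simp_all add: lo_def hi_def mult.assoc)
          moreover have "\<bar>s * (F t * g t)\<bar> \<le> Fb * (exp (pi / 2 * T) * (d * (T * exp (d * T))) ^ n)"
          proof -
            have "\<bar>s * (F t * g t)\<bar> = \<bar>F t\<bar> * \<bar>g t\<bar>" using s(1) by (auto simp: abs_mult)
            also have "\<dots> \<le> Fb * (exp (pi / 2 * T) * (d * (T * exp (d * T))) ^ n)"
              using Fb gabs[OF 1] by (intro mult_mono) auto
            finally show ?thesis .
          qed
          ultimately show ?thesis by linarith
        next
          case 2
          then have t: "t > 0" "t \<ge> T" "M \<le> t" "t \<le> M + 1" using M by auto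
          \<comment> \<open>From 1 + x \<le> exp x follows x exp(-x) \<le> 1 - exp(-x), used with x
            = d t.\<close>
          have "(d * (M * exp (- d * (M + 1)))) ^ n \<le> (1 - exp (- d * t)) ^ n"
          proof (rule power_mono)
            have "d * (M * exp (- d * (M + 1))) \<le> d * (t * exp (- d * t))"
              using d1 t M by (intro mult_left_mono mult_mono) auto
            also have "\<dots> = (1 + d * t) * exp (- d * t) - exp (- d * t)" by (simp add: algebra_simps)
            also have "(1 + d * t) * exp (- d * t) \<le> exp (d * t) * exp (- d * t)" by (intro mult_right_mono exp_ge_add_one_self) auto
            also have "exp (d * t) * exp (- d * t) = 1" by (simp add: exp_add[symmetric])
            finally show "d * (M * exp (- d * (M + 1))) \<le> 1 - exp (- d * t)" by simp
          qed (use d1 M in auto)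
          moreover have "1 \<le> exp ((pi / 2 - d) * t)" using d1 t by simp
          ultimately have "1 * (d * (M * exp (- d * (M + 1)))) ^ n \<le> g t" unfolding g_def using d1 M by (intro mult_mono) auto
          moreover have "m1 \<le> s * F t"
          proof -
            have "s * F t = \<bar>F t\<bar>" using s(2)[OF t(2)] s(1) by auto
            then show ?thesis using m1(2)[OF 2] by simp
          qed
          ultimately have "m1 * (d * (M * exp (- d * (M + 1)))) ^ n \<le> (s * F t) * g t" using m1(1) d1 M by (intro mult_mono) auto
          moreover have "hi t \<ge> 0" using Fb d1 T by (simp add: hi_def)
          ultimately show ?thesis using 2 by (simp add: lo_def mult.assoc)
        next
          case 3
          have y: "1 - exp (- d * t) \<ge> 0" if "t > 0" using that d1 by simp
          have y': "1 - exp (- d * t) \<le> 0" if "t < 0" using that d1 by (simp add: mult_nonneg_nonpos)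
          have "0 \<le> s * F t * (1 - exp (- d * t)) ^ n" by (rule sign[OF n]) (use 3 y y' in auto)
          from mult_nonneg_nonneg[OF this exp_ge_zero, of "(pi / 2 - d) * t"]
          have "0 \<le> s * (F t * g t)" by (simp only: g_def mult_ac)
          moreover have "hi t = 0" using 3 by (auto simp: hi_def indicator_def)
          ultimately show ?thesis using 3 by (simp add: lo_def)
        qed
      qed
      have loi: "integrable lborel lo" "(\<integral>t. lo t \<partial>lborel) = m1 * (d * (M * exp (- d * (M + 1)))) ^ n"
        unfolding lo_def using M by simp_all
      have hii: "integrable lborel hi" "(\<integral>t. hi t \<partial>lborel) = C3 * (d * (T * exp (d * T))) ^ n"
        unfolding hi_def using T by (simp_all add: C3_def)
      have "(\<integral>t. lo t - hi t \<partial>lborel) \<le> (\<integral>t. s * (F t * g t) \<partial>lborel)"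
        by (rule integral_mono[OF _ _ ptw]) (use loi hii Fgi in auto)
      then have "m1 * (d * (M * exp (- d * (M + 1)))) ^ n - C3 * (d * (T * exp (d * T))) ^ n \<le> s * (\<integral>t. F t * g t \<partial>lborel)"
        using loi hii by simp
      with upper have "m1 * (d * (M * exp (- d * (M + 1)))) ^ n \<le> C3 * (d * (T * exp (d * T))) ^ n +
          (C2 * (R * d * exp (R * d)) ^ n + 2 ^ n * (\<bar>Gm\<bar> * exp (- (c1 / real (n + 1)) / d)))" by linarith
      also have "\<dots> = d ^ n * rhs d"
        using d1 by (simp add: rhs_def power_mult_distrib algebra_simps)
      also have "m1 * (d * (M * exp (- d * (M + 1)))) ^ n = d ^ n * lhs d"
        by (simp add: lhs_def power_mult_distrib algebra_simps)
      finally show "lhs d \<le> rhs d" using d1 by simp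
    qed
    moreover have "(lhs \<longlongrightarrow> m1 * (M * exp (- 0 * (M + 1))) ^ n) (at_right 0)"
      unfolding lhs_def by (intro tendsto_intros)
    moreover have "(rhs \<longlongrightarrow> C3 * (T * exp (0 * T)) ^ n + (C2 * (R * exp (R * 0)) ^ n + 2 ^ n * \<bar>Gm\<bar> * 0)) (at_right 0)"
    proof -
      define cc where "cc = c1 / real (n + 1)"
      have "cc > 0" using flat(2) by (simp add: cc_def)
      \<comment> \<open>Flatness is used here: the error still vanishes after division by
        d^n.\<close>
      then have "((\<lambda>d. exp (- cc / d) / d ^ n) \<longlongrightarrow> 0) (at_right 0)" by real_asymp
      then show ?thesis unfolding rhs_def cc_def by (intro tendsto_intros)
    qed
    ultimately have "m1 * (M * exp (- 0 * (M + 1))) ^ n \<le> C3 * (T * exp (0 * T)) ^ n + (C2 * (R * exp (R * 0)) ^ n + 2 ^ n * \<bar>Gm\<bar> * 0)"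
      by (intro tendsto_le[of "at_right 0"]) auto
    then show ?thesis by simp
  qed
  \<comment> \<open>n = 2 l + p runs through the admissible parity; as X / M < 1, letting l grow
    forces m1 \<le> 0, against m1 > 0.\<close>
  have ratio: "m1 \<le> (C3 + C2) * (X / M) ^ (2 * l + p)" for l
  proof -
    let ?n = "2 * l + p"
    have "m1 * M ^ ?n \<le> C3 * T ^ ?n + C2 * R ^ ?n" by (rule moment) simp
    also have "\<dots> \<le> C3 * X ^ ?n + C2 * X ^ ?n"
      using C23 M T R by (intro add_mono mult_left_mono power_mono) auto
    finally have "m1 * M ^ ?n \<le> (C3 + C2) * X ^ ?n" by (simp add: algebra_simps)
    then show ?thesis using M by (simp add: power_divide pos_le_divide_eq)
  qed
  have "(\<lambda>n. (C3 + C2) * (X / M) ^ n) \<longlonglongrightarrow> (C3 + C2) * 0"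
    by (intro tendsto_intros LIMSEQ_power_zero) (use M in \<open>simp add: M_def\<close>)
  moreover have "filterlim (\<lambda>l. 2 * l + p) at_top sequentially"
    by (rule filterlim_subseq) (auto simp: strict_mono_def)
  ultimately have "(\<lambda>l. (C3 + C2) * (X / M) ^ (2 * l + p)) \<longlonglongrightarrow> (C3 + C2) * 0"
    by (rule filterlim_compose)
  then have "m1 \<le> (C3 + C2) * 0" by (rule LIMSEQ_le_const) (use ratio in auto)
  then show False using m1(1) by simp
qed

section \<open>Zeros on the critical line\<close>

text \<open>Convergence of the binomial series at 1/2 bounds (a)_n / n! by B 2^n; the second
  factorial then leaves an exponential series as majorant.\<close>

lemma hypergeo_1F1_summable: "summable (\<lambda>n. pochhammer a n / (fact n * fact n) * w ^ n :: complex)"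
proof -
  define b where "b = (\<lambda>n. pochhammer a n / fact n :: complex)"
  have "(\<lambda>n. (- a gchoose n) * (- (1 / 2)) ^ n) sums (1 + - (1 / 2)) powr (- a)"
    by (rule gen_binomial_complex) simp
  moreover have "(- a gchoose n) * (- (1 / 2)) ^ n = b n * (1 / 2) ^ n" for n
    by (simp add: b_def gbinomial_pochhammer power_minus[of "1 / 2"] mult_ac)
  ultimately have "summable (\<lambda>n. b n * (1 / 2) ^ n)" by (simp add: sums_iff)
  then have "Bseq (\<lambda>n. b n * (1 / 2) ^ n)"
    by (intro convergent_imp_Bseq) (auto simp: convergent_def dest: summable_LIMSEQ_zero)
  then obtain B where B: "\<And>n. norm (b n * (1 / 2) ^ n) \<le> B" using BseqE by blast
  have bn: "norm (b n) \<le> B * 2 ^ n" for n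
    using B[of n] by (simp add: norm_mult norm_divide norm_power power_divide field_simps)
  show ?thesis
  proof (rule summable_comparison_test')
    show "summable (\<lambda>n. B * (inverse (fact n) * (2 * norm w) ^ n))"
      by (intro summable_mult summable_exp)
    show "norm (pochhammer a n / (fact n * fact n) * w ^ n) \<le> B * (inverse (fact n) * (2 * norm w) ^ n)" if "n \<ge> 0" for n
    proof -
      have "norm (pochhammer a n / (fact n * fact n) * w ^ n) = norm (b n) * (inverse (fact n) * norm w ^ n)"
        by (simp add: b_def norm_mult norm_divide norm_power field_simps)
      also have "\<dots> \<le> (B * 2 ^ n) * (inverse (fact n) * norm w ^ n)" by (intro mult_right_mono bn) auto
      finally show ?thesis by (simp add: power_mult_distrib mult_ac)
    qed
  qed
qed

lemma hypergeo_1F1_cnj: "cnj (hypergeo_1F1 a 1 w) = hypergeo_1F1 (cnj a) 1 (cnj w)"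
proof -
  have p: "cnj (pochhammer a n) = pochhammer (cnj a) n" for n by (simp add: pochhammer_prod)
  have "(\<lambda>n. cnj (pochhammer a n / (fact n * fact n) * w ^ n)) sums cnj (hypergeo_1F1 a 1 w)"
    unfolding hypergeo_1F1_series sums_cnj by (rule summable_sums[OF hypergeo_1F1_summable])
  then show ?thesis unfolding hypergeo_1F1_series by (simp add: p sums_iff)
qed

context epstein_form begin

text \<open>On the critical line the parameter 1 - cnj s + i l is the conjugate of 1 - s - i l, so
  the two 1F1 terms are conjugate to each other; as \<open>Lc\<close> is real, so is the
  summand.\<close>

lemma F_term_critical:
  "F_term A B C z l (1 / 2 + \<i> * of_real t) = of_real (2 * Re (Lc (t + l) * hypergeo_1F1 (1 / 2 - \<i> * of_real (t + l)) 1 (z\<^sup>2 / 4)))"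
proof -
  define h where "h = hypergeo_1F1 (1 / 2 - \<i> * of_real (t + l)) 1 (z\<^sup>2 / 4)"
  have 1: "1 / 2 + \<i> * of_real t + \<i> * of_real l = 1 / 2 + \<i> * complex_of_real (t + l)"
    and 2: "1 - (1 / 2 + \<i> * of_real t) - \<i> * of_real l = 1 / 2 - \<i> * complex_of_real (t + l)"
    and 3: "1 - cnj (1 / 2 + \<i> * of_real t) + \<i> * of_real l = cnj (1 / 2 - \<i> * complex_of_real (t + l))"
    by (simp_all add: complex_eq_iff)
  have 4: "(cnj z)\<^sup>2 / 4 = cnj (z\<^sup>2 / 4)" by simp
  have "F_term A B C z l (1 / 2 + \<i> * of_real t) = Lc (t + l) * (h + cnj h)"
    unfolding F_term_def 1 2 3 4 epstein_zeta_critical hypergeo_1F1_cnj[symmetric] h_def ..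
  also have "\<dots> = of_real (2 * Re (Lc (t + l) * h))"
    using Lc_real[of "t + l"] by (simp add: complex_eq_iff)
  finally show ?thesis by (simp only: h_def)
qed

text \<open>With Delta = k^2 the square of 2 sqrt pi / Delta^(3/4) is 4 pi / k^3, twice the decay
  exponent at the cusp.\<close>

lemma region_D_bound:
  assumes "z \<in> region_D A B C"
  shows "(Re z)\<^sup>2 < 2 * (2 * pi / (of_int k) ^ 3)" "(Im z)\<^sup>2 < 2 * (2 * pi / (of_int k) ^ 3)"
proof -
  define b where "b = 2 * sqrt pi / of_int (form_disc A B C) powr (3 / 4)"
  have "real_of_int (form_disc A B C) = of_int k powr 2"
    using k_pos unfolding k_disc[symmetric] by (simp add: powr_numeral)
  then have "real_of_int (form_disc A B C) powr (3 / 4) = of_int k powr (3 / 2)"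
    by (simp add: powr_powr)
  moreover have "(real_of_int k powr (3 / 2))\<^sup>2 = of_int k ^ 3"
    using k_pos by (simp add: powr_power powr_numeral)
  ultimately have b2: "b\<^sup>2 = 2 * (2 * pi / (of_int k) ^ 3)"
    by (simp add: b_def power_divide power_mult_distrib)
  have "\<bar>Re z\<bar> < b" "\<bar>Im z\<bar> < b" using assms by (auto simp: region_D_def b_def)
  then have "\<bar>Re z\<bar>\<^sup>2 < b\<^sup>2" "\<bar>Im z\<bar>\<^sup>2 < b\<^sup>2" by (simp_all only: power_strict_mono abs_ge_zero zero_less_numeral)
  then show "(Re z)\<^sup>2 < 2 * (2 * pi / (of_int k) ^ 3)" "(Im z)\<^sup>2 < 2 * (2 * pi / (of_int k) ^ 3)"
    by (simp_all add: b2)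
qed

theorem infinitely_many_critical_zeros:
  fixes c lam :: "nat \<Rightarrow> real"
  assumes c: "summable (\<lambda>j. \<bar>c j\<bar>)" and lam: "bounded (range lam)" and z: "z \<in> region_D A B C"
  shows "infinite {s. Re s = 1 / 2 \<and> F_fun A B C c lam z s = 0}"
proof -
  define w where "w = z\<^sup>2 / 4"
  define hy where "hy = (\<lambda>t::real. hypergeo_1F1 (1 / 2 - \<i> * of_real t) 1 w)"
  define Phi where "Phi = (\<lambda>t. 2 * Re (Lc t * hy t))"
  define kap where "kap = 2 * pi / (real_of_int k) ^ 3"
  have kap: "kap > 0" using k_pos' by (simp add: kap_def)
  have hyc: "continuous_on UNIV hy" unfolding hy_def by (rule hypergeo_1F1_critical_continuous)
  have Lhc: "continuous_on UNIV (\<lambda>t. Lc t * hy t)" by (intro continuous_intros Lc_continuous hyc)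
  have decay: "\<exists>K>0. \<forall>t. norm (Lc t * hy t) \<le> K * exp (- a * \<bar>t\<bar>)" if a: "0 \<le> a" "a < pi / 2" for a
  proof -
    \<comment> \<open>A rate strictly between a and pi / 2; the surplus a' - a pays for the growth
      of 1F1.\<close>
    define a' where "a' = (a + pi / 2) / 2"
    have a': "0 \<le> a'" "a' < pi / 2" "a' - a > 0" using a by (auto simp: a'_def)
    obtain K1 where K1: "K1 > 0" "\<And>t. norm (Lc t) \<le> K1 * exp (- a' * \<bar>t\<bar>)" using Lc_bound[OF a'(1,2)] by blast
    obtain K2 where K2: "K2 > 0" "\<And>t. norm (hy t) \<le> K2 * exp ((a' - a) * \<bar>t\<bar>)"
      unfolding hy_def using hypergeo_1F1_critical_growth[OF a'(3), of w] by blast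
    have "norm (Lc t * hy t) \<le> (K1 * K2) * exp (- a * \<bar>t\<bar>)" for t
    proof -
      have "norm (Lc t * hy t) \<le> (K1 * exp (- a' * \<bar>t\<bar>)) * (K2 * exp ((a' - a) * \<bar>t\<bar>))"
        unfolding norm_mult using K1 K2 by (intro mult_mono) auto
      also have "\<dots> = (K1 * K2) * (exp (- a' * \<bar>t\<bar>) * exp ((a' - a) * \<bar>t\<bar>))" by simp
      also have "exp (- a' * \<bar>t\<bar>) * exp ((a' - a) * \<bar>t\<bar>) = exp (- a * \<bar>t\<bar>)"
        by (simp add: exp_add[symmetric] algebra_simps)
      finally show ?thesis .
    qed
    then show ?thesis using K1(1) K2(1) by (intro exI[of _ "K1 * K2"]) auto
  qed
  have Phi_decay: "\<exists>K>0. \<forall>t. \<bar>Phi t\<bar> \<le> K * exp (- a * \<bar>t\<bar>)" if a: "0 \<le> a" "a < pi / 2" for a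
  proof -
    obtain K where K: "K > 0" "\<And>t. norm (Lc t * hy t) \<le> K * exp (- a * \<bar>t\<bar>)" using decay[OF a] by blast
    have "\<bar>Phi t\<bar> \<le> (2 * K) * exp (- a * \<bar>t\<bar>)" for t
      using abs_Re_le_cmod[of "Lc t * hy t"] K(2)[of t] unfolding Phi_def abs_mult by simp
    then show ?thesis using K(1) by (intro exI[of _ "2 * K"]) auto
  qed
  have Phi_cont: "continuous_on UNIV Phi" unfolding Phi_def by (intro continuous_intros continuous_on_Re Lhc)
  define J where "J = (\<lambda>b. \<integral>t. Lc t * hy t * exp (of_real ((pi / 2 - b) * t)) \<partial>lborel)"
  have Phi_J: "(\<integral>t. Phi t * exp ((pi / 2 - b) * t) \<partial>lborel) = 2 * Re (J b)" if b: "0 < b" "b < pi / 2" for b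
  proof -
    obtain K where K: "K > 0" "\<And>t. norm (Lc t * hy t) \<le> K * exp (- (pi / 2 - b / 2) * \<bar>t\<bar>)"
      using decay[of "pi / 2 - b / 2"] b by auto
    have i: "integrable lborel (\<lambda>t. Lc t * hy t * exp (of_real ((pi / 2 - b) * t)))"
    proof (rule Bochner_Integration.integrable_bound[OF integrable_mult_right[OF integrable_exp_abs[of "b / 2"], of K]])
      show "AE t in lborel. norm (Lc t * hy t * exp (of_real ((pi / 2 - b) * t))) \<le> norm (K * exp (- (b / 2) * \<bar>t\<bar>))"
      proof (rule AE_I2)
        fix t
        have "(pi / 2 - b) * t \<le> (pi / 2 - b) * \<bar>t\<bar>" using b by (intro mult_left_mono) auto
        then have "norm (exp (complex_of_real ((pi / 2 - b) * t))) \<le> exp ((pi / 2 - b) * \<bar>t\<bar>)"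
          by (simp only: norm_exp_eq_Re Re_complex_of_real exp_le_cancel_iff)
        then have "norm (Lc t * hy t * exp (of_real ((pi / 2 - b) * t))) \<le> (K * exp (- (pi / 2 - b / 2) * \<bar>t\<bar>)) * exp ((pi / 2 - b) * \<bar>t\<bar>)"
          unfolding norm_mult[of "Lc t * hy t"] using K by (intro mult_mono) auto
        also have "\<dots> = K * exp (- (b / 2) * \<bar>t\<bar>)"
          unfolding mult.assoc exp_add[symmetric] by (simp add: algebra_simps)
        also have "\<dots> \<le> norm (K * exp (- (b / 2) * \<bar>t\<bar>))" unfolding real_norm_def by (rule abs_ge_self)
        finally show "norm (Lc t * hy t * exp (of_real ((pi / 2 - b) * t))) \<le> norm (K * exp (- (b / 2) * \<bar>t\<bar>))" .
      qed
      have "continuous_on UNIV (\<lambda>t. Lc t * hy t * exp (of_real ((pi / 2 - b) * t)))"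
        by (intro continuous_intros Lc_continuous hyc)
      then show "(\<lambda>t. Lc t * hy t * exp (of_real ((pi / 2 - b) * t))) \<in> borel_measurable lborel"
        by (simp only: measurable_lborel2 borel_measurable_continuous_onI)
    qed (use b in simp)
    have R: "Re (Lc t * hy t * exp (of_real ((pi / 2 - b) * t))) = Re (Lc t * hy t) * exp ((pi / 2 - b) * t)" for t
    proof -
      have "Re (x * of_real y) = Re x * y" for x y by simp
      then show ?thesis unfolding exp_of_real .
    qed
    have "Re (J b) = (\<integral>t. Re (Lc t * hy t) * exp ((pi / 2 - b) * t) \<partial>lborel)"
      unfolding J_def R[symmetric] by (rule integral_Re[OF i, symmetric])
    moreover have "(\<integral>t. Phi t * exp ((pi / 2 - b) * t) \<partial>lborel) = 2 * (\<integral>t. Re (Lc t * hy t) * exp ((pi / 2 - b) * t) \<partial>lborel)"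
      unfolding Phi_def mult.assoc by (rule integral_mult_right_zero)
    ultimately show ?thesis by simp
  qed
  obtain r c0 where r: "r > 1" "c0 > 0" and opt: "\<And>xi. norm xi = 1 \<Longrightarrow>
      Re (w * of_real r * xi) + Re (\<i> * of_real kap / (of_real r * xi)) + Im w - kap \<le> - c0"
    using region_optimal_circle[OF kap region_D_bound[OF z, folded kap_def]] unfolding w_def by blast
  obtain K c1 where K: "K > 0" "c1 > 0" and Jev: "\<forall>\<^sub>F b in at_right 0. norm (J b + 2 * pi * (exp (\<i> * of_real (pi / 2 - b) / 2) * exp w + exp (- (\<i> * of_real (pi / 2 - b) / 2)))) \<le> K * exp (- c1 / b)"
    using cusp_flat[OF r opt[unfolded kap_def]] unfolding J_def hy_def by blast
  \<comment> \<open>Up to a flat error J is - 2 pi (exp y exp w + exp(- y)) with y = i (pi / 2 - b)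
    / 2. As y is imaginary, exp(- y) and exp y have the same real part, so in 2 Re J both terms
    combine under the single exponential exp y.\<close>
  define Q where "Q = complex_of_real (- 4 * pi) * (exp w + 1)"
  have flat: "\<forall>\<^sub>F b in at_right 0. \<bar>(\<integral>t. Phi t * exp ((pi / 2 - b) * t) \<partial>lborel) - Re (Q * exp (\<i> * of_real (pi / 2 - b) / 2))\<bar> \<le> (2 * K) * exp (- c1 / b)"
  proof -
    have "\<forall>\<^sub>F b in at_right (0::real). 0 < b" by (rule eventually_at_right_less)
    moreover have "\<forall>\<^sub>F b in at_right (0::real). b < pi / 2" by (intro order_tendstoD(2)[OF tendsto_ident_at]) simp
    ultimately show ?thesis using Jev
    proof eventually_elim
      case (elim b)
      define y where "y = \<i> * complex_of_real (pi / 2 - b) / 2"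
      have ey: "Re (exp (- y)) = Re (exp y)" by (simp add: y_def Re_exp)
      have Rm: "Re (of_real x * v) = x * Re v" for x v by simp
      have Qy: "Re (Q * exp y) = - 4 * pi * (Re (exp y * exp w) + Re (exp y))"
      proof -
        have "Q * exp y = of_real (- 4 * pi) * (exp y * exp w + exp y)" by (simp add: Q_def algebra_simps)
        then show ?thesis unfolding Rm by (simp only: Rm plus_complex.sel)
      qed
      have "2 * Re (J b) - Re (Q * exp y) = 2 * Re (J b + of_real (2 * pi) * (exp y * exp w + exp (- y)))"
        unfolding Qy by (simp only: Rm plus_complex.sel ey) (simp add: algebra_simps)
      then have "\<bar>2 * Re (J b) - Re (Q * exp y)\<bar> \<le> 2 * norm (J b + of_real (2 * pi) * (exp y * exp w + exp (- y)))"
        using abs_Re_le_cmod[of "J b + of_real (2 * pi) * (exp y * exp w + exp (- y))"] by (simp only: abs_mult)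
      also have "\<dots> \<le> 2 * (K * exp (- c1 / b))"
        using elim(3) by (intro mult_left_mono) (simp_all only: y_def)
      finally show ?case unfolding Phi_J[OF elim(1,2)] y_def by (simp only: mult.assoc)
    qed
  qed
  obtain L where L: "\<And>j. \<bar>lam j\<bar> \<le> L" using lam by (auto simp: bounded_iff)
  have K2: "2 * K > 0" using K(1) by simp
  have inf: "infinite {t. (\<Sum>j. c j * Phi (t + lam j)) = 0}"
    by (rule infinitely_many_zeros_from_flat_transform[OF Phi_cont Phi_decay c L K2 K(2) flat])
  have Ff: "F_fun A B C c lam z (1 / 2 + \<i> * of_real t) = of_real (\<Sum>j. c j * Phi (t + lam j))" for t
  proof -
    obtain K where K: "\<And>t. \<bar>Phi t\<bar> \<le> K * exp (- 0 * \<bar>t\<bar>)" using Phi_decay[of 0] by auto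
    have "summable (\<lambda>j. c j * Phi (t + lam j))"
    proof (rule summable_comparison_test'[OF summable_mult2[OF c, of K]])
      show "norm (c j * Phi (t + lam j)) \<le> \<bar>c j\<bar> * K" for j
        using K[of "t + lam j"] by (simp add: abs_mult mult_left_mono)
    qed
    then have "of_real (\<Sum>j. c j * Phi (t + lam j)) = (\<Sum>j. complex_of_real (c j * Phi (t + lam j)))"
      by (rule suminf_of_real)
    then show ?thesis unfolding F_fun_def F_term_critical Phi_def hy_def w_def by simp
  qed
  have "infinite ((\<lambda>t. 1 / 2 + \<i> * complex_of_real t) ` {t. (\<Sum>j. c j * Phi (t + lam j)) = 0})"
    using inf by (subst finite_image_iff) (auto simp: inj_on_def)
  then show ?thesis
    by (rule infinite_super[rotated]) (auto simp: Ff)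
qed

end

theorem theorem1p2:
  fixes A B C :: int
    and c lam :: "nat \<Rightarrow> real"
    and z :: complex
  assumes "pos_def_form A B C"
    and "gcd A (gcd B C) = 1"
    and "\<exists>k::int. sqrt (of_int (form_disc A B C)) = of_int k \<and> [k = 2] (mod 4)"
    and "\<And>j. c j \<noteq> 0"
    and "summable (\<lambda>j. \<bar>c j\<bar>)"
    and "inj lam"
    and "bounded (range lam)"
    and "attains_bounds lam"
    and "z \<in> region_D A B C"
  shows "infinite {s. Re s = 1 / 2 \<and> F_fun A B C c lam z s = 0}"
proof -
  obtain k :: int where k: "sqrt (of_int (form_disc A B C)) = of_int k" "[k = 2] (mod 4)"
    using assms(3) by blast
  have D: "form_disc A B C > 0" by (rule pos_def_formD(3)[OF assms(1)])
  have "real_of_int k > 0" using D unfolding k(1)[symmetric] by simp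
  moreover have "(real_of_int k)\<^sup>2 = of_int (form_disc A B C)" using D unfolding k(1)[symmetric] by simp
  then have "k\<^sup>2 = form_disc A B C" by (metis of_int_eq_iff of_int_power)
  ultimately interpret epstein_form A B C k
    using assms(1) k(2) by unfold_locales (auto simp: cong_def)
  show ?thesis by (rule infinitely_many_critical_zeros[OF assms(5,7,9)])
qed

end
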